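(* Let $\Gamma$ be an exact countable group and let $(X,\mu)$ be an ergodic probability measure preserving action of $\Gamma$ with $(X,\mu)\xhookrightarrow{inf}\Gamma$. Let $\mathcal R$ be the orbit equivalence relation and $\mathcal S\subset\mathcal R$ a measurable sub-equivalence relation. Then $X=\bigsqcup_{i\ge0}X_i$, where $\mathcal S|_{X_0}$ is hyperfinite, and for each $i\ge1$ either $X_i$ is empty or $\mu(X_i)>0$ and $\mathcal S|_{X_i}$ is strongly ergodic.
   Context: A measure preserving action $(X,\mu)$ of a countable group $\Gamma$ is an action on a standard Borel space preserving a $\sigma$-finite measure; $\Gamma$ acting on itself by left translation carries counting measure. Infinitesimal containment: $(X,\mu)\xhookrightarrow{inf}(Y,\nu)$ means that for every finite $F\subset\Gamma$, every $k\in\mathbb N$ and every $\varepsilon>0$ there is $\delta>0$ such that for all positive measure sets $A_1,\dots,A_k\subset X$ with $\mu(A_i)\le\delta$ there exist $\lambda>0$ and measurable $B_1,\dots,B_k\subset Y$ with $|\mu(A_i\cap\gamma A_j)-\lambda\nu(B_i\cap\gamma B_j)|\le\varepsilon\max_{l}\mu(A_l)$ for all $i,j$ and all $\gamma\in F$. Hyperfinite: increasing union of finite equivalence relations (up to null sets). Strongly ergodic: every asymptotically invariant sequence of measurable subsets $A_n\subset X_i$ satisfies $\mu(A_n)\mu(X_i\setminus A_n)\to0$. *)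

theory Defs
  imports "HOL-Probability.Probability"
begin

text \<open>Exactness of a countable discrete group, in the standard form
  (Higson--Roe / Ozawa): for every finite K and eps > 0 there are a finite S and
  probability vectors xi_x on the group, supported in x + S, with
  norm-one distance of xi_x and xi_y below eps whenever -x + y lies in K.\<close>
definition exact_group :: "'g::group_add itself \<Rightarrow> bool" where
  "exact_group T \<longleftrightarrow>
    (\<forall>K::'g set. finite K \<longrightarrow> (\<forall>\<epsilon>::real. \<epsilon> > 0 \<longrightarrow>
      (\<exists>S::'g set. finite S \<and> (\<exists>\<xi>::'g \<Rightarrow> 'g \<Rightarrow> real.
         (\<forall>x z. 0 \<le> \<xi> x z) \<and>
         (\<forall>x z. z \<notin> (\<lambda>s. x + s) ` S \<longrightarrow> \<xi> x z = 0) \<and>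
         (\<forall>x. (\<Sum>z\<in>(\<lambda>s. x + s) ` S. \<xi> x z) = 1) \<and>
         (\<forall>x y. - x + y \<in> K \<longrightarrow>
            (\<Sum>z\<in>(\<lambda>s. x + s) ` S \<union> (\<lambda>s. y + s) ` S. \<bar>\<xi> x z - \<xi> y z\<bar>) < \<epsilon>)))))"

text \<open>Infinitesimal containment of the action a of 'g on (space M, M) into the
  left translation action of 'g on itself with counting measure.  A term
  lambda * nu(B_i \<inter> gamma B_j) with an infinite set would be infinite, so the
  inequality forces finiteness; we state the finiteness explicitly.\<close>
definition inf_contained_in_group :: "'x measure \<Rightarrow> ('g::group_add \<Rightarrow> 'x \<Rightarrow> 'x) \<Rightarrow> bool" where
  "inf_contained_in_group M a \<longleftrightarrow>
    (\<forall>F::'g set. finite F \<longrightarrow> (\<forall>k::nat. \<forall>\<epsilon>::real. \<epsilon> > 0 \<longrightarrow>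
      (\<exists>\<delta>::real. \<delta> > 0 \<and> (\<forall>A::nat \<Rightarrow> 'x set.
         (\<forall>i<k. A i \<in> sets M \<and> 0 < measure M (A i) \<and> measure M (A i) \<le> \<delta>) \<longrightarrow>
         (\<exists>c::real. c > 0 \<and> (\<exists>B::nat \<Rightarrow> 'g set.
            \<forall>i<k. \<forall>j<k. \<forall>\<gamma>\<in>F.
              finite (B i \<inter> (\<lambda>b. \<gamma> + b) ` B j) \<and>
              \<bar>measure M (A i \<inter> a \<gamma> ` A j)
                 - c * real (card (B i \<inter> (\<lambda>b. \<gamma> + b) ` B j))\<bar>
                \<le> \<epsilon> * Max ((\<lambda>l. measure M (A l)) ` {..<k})))))))"

definition ergodic_action :: "'x measure \<Rightarrow> ('g \<Rightarrow> 'x \<Rightarrow> 'x) \<Rightarrow> bool" where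
  "ergodic_action M a \<longleftrightarrow>
    (\<forall>A\<in>sets M. (\<forall>g. a g ` A = A) \<longrightarrow> measure M A = 0 \<or> measure M A = 1)"

definition orbit_rel :: "('g \<Rightarrow> 'x \<Rightarrow> 'x) \<Rightarrow> ('x \<times> 'x) set" where
  "orbit_rel a = {(x, a g x) | x g. True}"

definition hyperfinite_on :: "'x measure \<Rightarrow> ('x \<times> 'x) set \<Rightarrow> 'x set \<Rightarrow> bool" where
  "hyperfinite_on M S Y \<longleftrightarrow>
    (\<exists>E::nat \<Rightarrow> ('x \<times> 'x) set.
       (\<forall>n. E n \<in> sets (M \<Otimes>\<^sub>M M) \<and> equiv Y (E n) \<and>
            (\<forall>x\<in>Y. finite (E n `` {x})) \<and> E n \<subseteq> E (Suc n)) \<and>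
       (\<exists>N\<in>null_sets M. \<forall>x\<in>Y - N. \<forall>y\<in>Y - N.
            (x, y) \<in> S \<longleftrightarrow> (\<exists>n. (x, y) \<in> E n)))"

definition full_group_on :: "'x measure \<Rightarrow> ('x \<times> 'x) set \<Rightarrow> 'x set \<Rightarrow> ('x \<Rightarrow> 'x) set" where
  "full_group_on M S Y =
    {\<theta>. bij_betw \<theta> Y Y \<and>
         \<theta> \<in> measurable (restrict_space M Y) (restrict_space M Y) \<and>
         the_inv_into Y \<theta> \<in> measurable (restrict_space M Y) (restrict_space M Y) \<and>
         (\<forall>x\<in>Y. (x, \<theta> x) \<in> S)}"

definition asymp_invariant_seq :: "'x measure \<Rightarrow> ('x \<times> 'x) set \<Rightarrow> 'x set \<Rightarrow> (nat \<Rightarrow> 'x set) \<Rightarrow> bool" where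
  "asymp_invariant_seq M S Y A \<longleftrightarrow>
    (\<forall>n. A n \<in> sets M \<and> A n \<subseteq> Y) \<and>
    (\<forall>\<theta>\<in>full_group_on M S Y.
       (\<lambda>n. measure M ((A n - \<theta> ` A n) \<union> (\<theta> ` A n - A n))) \<longlonglongrightarrow> 0)"

definition strongly_ergodic_on :: "'x measure \<Rightarrow> ('x \<times> 'x) set \<Rightarrow> 'x set \<Rightarrow> bool" where
  "strongly_ergodic_on M S Y \<longleftrightarrow>
    (\<forall>A. asymp_invariant_seq M S Y A \<longrightarrow>
       (\<lambda>n. measure M (A n) * measure M (Y - A n)) \<longlonglongrightarrow> 0)"

end

theory Submission
  imports Defs "HOL-Library.Ramsey"
begin

text \<open>
  Remove from \<open>X\<close> a maximal disjoint family of sets on which \<open>S\<close> is strongly ergodic; it is countable, and the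
  claim is that \<open>S\<close> is hyperfinite on what remains, \<open>X\<^sub>0\<close>.  If it were not, then some \<open>Y \<subseteq> X\<^sub>0\<close> of positive
  measure would satisfy a uniform isoperimetric inequality: every finite subset of a class of \<open>S\<close> restricted to
  \<open>Y\<close> has large boundary (otherwise finite sets with small boundary exhaust \<open>X\<^sub>0\<close>).  No
  positive-measure subset of \<open>Y\<close> is strongly ergodic, so \<open>Y\<close> contains arbitrarily small almost invariant
  sets \<open>A\<close>.  Infinitesimal containment replaces \<open>A\<close>, together with the local pattern of \<open>S\<close> on it, by a
  finite subset of the group with almost the same statistics.  Exactness cuts such a finite set
  into bounded pieces with small total boundary, and at most points the pattern is that of an actual
  point of \<open>A\<close>, so the isoperimetric inequality is violated.
\<close>

section \<open>Measurability and boundaries\<close>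

text \<open>The obstacle is uniformity. The threshold in infinitesimal containment depends on the
  number of sets, so the patterns into which \<open>A\<close> is split must be bounded in number
  before \<open>A\<close> is known: they record only the behaviour under a finite window of group
  elements, fixed by \<open>K\<close> and by the supports that exactness provides. The allowed error
  is proportional to the measure of the sets themselves, which is why arbitrarily small sets stay
  under control. Only coincidences of pairs of sets are transferred, so the model in the group need
  not look like part of an orbit globally. Within a bounded piece, however, the pattern at one point
  governs those at the points related to it, and a whole class of the piece can be copied into the
  orbit of one point of \<open>A\<close>, where expansion is known. Zorn's lemma would produce
  uncountable unions, which need not be measurable; both exhaustions are therefore greedy along
  sequences.\<close>

locale subrelation = prob_space M for M :: "'x::polish_space measure" +
  fixes a :: "'g::{group_add, countable} \<Rightarrow> 'x \<Rightarrow> 'x"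
    and S :: "('x \<times> 'x) set"
  assumes std_borel: "sets M = sets borel"
    and act_zero: "\<And>x. a 0 x = x"
    and act_add: "\<And>g h x. a (g + h) x = a g (a h x)"
    and act_meas: "\<And>g. a g \<in> measurable M M"
    and act_pres: "\<And>g. distr M M (a g) = M"
    and S_sub: "S \<subseteq> orbit_rel a"
    and S_equiv: "equiv (space M) S"
    and S_meas: "S \<in> sets (M \<Otimes>\<^sub>M M)"
begin

section \<open>The action, the relation and measurability\<close>

lemma space_UNIV [simp]: "space M = UNIV"
  using sets_eq_imp_space_eq[OF std_borel] by simp

lemma act_inv [simp]: "a (- g) (a g x) = x" "a g (a (- g) x) = x"
  by (simp_all flip: act_add add: act_zero)

text \<open>Group inverses turn forward images into preimages, so images of measurable sets are
  measurable for elementary reasons.\<close>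

lemma act_image: "a g ` A = a (- g) -` A"
proof (intro equalityI subsetI)
  fix x assume "x \<in> a (- g) -` A"
  then have "x = a g (a (- g) x)" "a (- g) x \<in> A" by auto
  then show "x \<in> a g ` A" by blast
qed auto

lemma sets_act_vimage [measurable]:
  assumes "A \<in> sets M" shows "a g -` A \<in> sets M"
  using measurable_sets[OF act_meas assms, of g] by simp

lemma sets_act_image [measurable]:
  assumes "A \<in> sets M" shows "a g ` A \<in> sets M"
  unfolding act_image by (rule sets_act_vimage[OF assms])

lemma measure_act_vimage:
  assumes "A \<in> sets M" shows "measure M (a g -` A) = measure M A"
  using measure_distr[OF act_meas assms, of g] act_pres[of g] by simp

lemma measure_act_image:
  assumes "A \<in> sets M" shows "measure M (a g ` A) = measure M A"
  unfolding act_image by (rule measure_act_vimage[OF assms])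

lemma S_refl: "(x, x) \<in> S"
  using S_equiv by (auto simp: equiv_def refl_on_def)

lemma S_sym: "(x, y) \<in> S \<Longrightarrow> (y, x) \<in> S"
  using S_equiv by (auto simp: equiv_def sym_def)

lemma S_trans: "(x, y) \<in> S \<Longrightarrow> (y, z) \<in> S \<Longrightarrow> (x, z) \<in> S"
  using S_equiv by (auto simp: equiv_def trans_def)

lemma S_orbit: "(x, y) \<in> S \<Longrightarrow> \<exists>g. y = a g x"
  using S_sub by (auto simp: orbit_rel_def)

lemma measurable_pair_act:
  "(\<lambda>x. (a g x, a h x)) \<in> measurable M (M \<Otimes>\<^sub>M M)"
  using act_meas by measurable

lemma sets_act_rel:
  assumes "E \<in> sets (M \<Otimes>\<^sub>M M)"
  shows "{x. (a g x, a h x) \<in> E} \<in> sets M"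
  using measurable_sets[OF measurable_pair_act[of g h] assms] by (simp add: vimage_def)

lemma sets_rel [measurable]:
  assumes "E \<in> sets (M \<Otimes>\<^sub>M M)"
  shows "{x. (x, a h x) \<in> E} \<in> sets M"
  using sets_act_rel[OF assms, of 0 h] by (simp add: act_zero)

lemma sets_act_eq: "{x. a g x = a h x} \<in> sets M"
proof -
  have [measurable]: "a g \<in> borel_measurable M" "a h \<in> borel_measurable M"
    using act_meas std_borel by (auto cong: measurable_cong_sets)
  have "{x \<in> space M. a g x = a h x} \<in> sets M" by measurable
  then show ?thesis by simp
qed

lemma sets_pair_eq: "{(x, y). y = a g x} \<in> sets (M \<Otimes>\<^sub>M M)"
proof -
  have id: "(\<lambda>x. x) \<in> measurable M borel" using std_borel by (auto cong: measurable_cong_sets)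
  have ag: "a g \<in> measurable M borel"
    using act_meas std_borel by (auto cong: measurable_cong_sets)
  have [measurable]: "(\<lambda>p. a g (fst p)) \<in> borel_measurable (M \<Otimes>\<^sub>M M)"
    by (rule measurable_compose[OF measurable_fst ag])
  have [measurable]: "snd \<in> borel_measurable (M \<Otimes>\<^sub>M M)"
    by (rule measurable_compose[OF measurable_snd id])
  have "{p \<in> space (M \<Otimes>\<^sub>M M). snd p = a g (fst p)} \<in> sets (M \<Otimes>\<^sub>M M)" by measurable
  moreover have "{p \<in> space (M \<Otimes>\<^sub>M M). snd p = a g (fst p)} = {(x, y). y = a g x}"
    by (auto simp: space_pair_measure)
  ultimately show ?thesis by simp
qed

lemma sets_edge:
  assumes "A \<in> sets M" "B \<in> sets M" "E \<in> sets (M \<Otimes>\<^sub>M M)"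
  shows "{x \<in> A. a g x \<in> B \<and> (x, a g x) \<in> E} \<in> sets M"
proof -
  have "{x \<in> A. a g x \<in> B \<and> (x, a g x) \<in> E} = A \<inter> a g -` B \<inter> {x. (x, a g x) \<in> E}" by auto
  then show ?thesis using assms by (auto intro: sets_act_vimage sets_rel)
qed

text \<open>One-sided edge boundary of \<open>A\<close> in the graph that the labels
  \<open>K\<close> induce on \<open>S\<close> restricted to \<open>Y\<close>.\<close>

definition bdry :: "'g set \<Rightarrow> 'x set \<Rightarrow> 'x set \<Rightarrow> real" where
  "bdry K Y A = (\<Sum>g\<in>K. measure M {x \<in> A. a g x \<in> Y - A \<and> (x, a g x) \<in> S})"

text \<open>Edge expansion of the graph on the class of \<open>x\<close> inside \<open>Z\<close>. It
  is a property of the class, so \<open>x\<close> need not lie in \<open>Z\<close>; labels rather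
  than endpoints are counted.\<close>

definition isoperimetric :: "'g set \<Rightarrow> 'x set \<Rightarrow> real \<Rightarrow> 'x \<Rightarrow> bool" where
  "isoperimetric K Z e x \<longleftrightarrow> (\<forall>L. finite L \<longrightarrow> L \<noteq> {} \<longrightarrow> L \<subseteq> S `` {x} \<inter> Z \<longrightarrow>
     e * real (card L) \<le> (\<Sum>g\<in>K. real (card {y \<in> L. a g y \<in> Z - L \<and> (y, a g y) \<in> S})))"

text \<open>An edge is charged when it leaves its \<open>E\<close>-class, whether it stays in
  \<open>W\<close> or runs into the rest of \<open>Z\<close>. The loss is relative to the measure of
  \<open>W\<close>, so disjoint tiles can be added up.\<close>

definition tile :: "'g set \<Rightarrow> 'x set \<Rightarrow> real \<Rightarrow> 'x set \<Rightarrow> ('x \<times> 'x) set \<Rightarrow> bool" where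
  "tile K Z e W E \<longleftrightarrow> W \<in> sets M \<and> W \<subseteq> Z \<and> E \<in> sets (M \<Otimes>\<^sub>M M) \<and> equiv W E \<and>
     (\<forall>x\<in>W. finite (E `` {x})) \<and> E \<subseteq> S \<and>
     (\<Sum>g\<in>K. measure M {x \<in> W. a g x \<in> Z \<and> (x, a g x) \<in> S - E}) \<le> e * measure M W"

end

section \<open>Isoperimetry along the group\<close>

context subrelation begin

text \<open>A discrete co-area argument: a nonnegative function is a stack of multiples of
  indicators of its level sets, and expansion is applied to each layer.\<close>

lemma isoperimetric_fun:
  assumes iso: "isoperimetric K Z e x" and "finite K" "finite P" "P \<subseteq> S `` {x} \<inter> Z"
    and "\<And>y. 0 \<le> f y" "\<And>y. y \<notin> P \<Longrightarrow> f y = 0"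
  shows "e * (\<Sum>y\<in>P. f y) \<le>
    (\<Sum>g\<in>K. \<Sum>y | y \<in> P \<and> a g y \<in> Z \<and> (y, a g y) \<in> S. max 0 (f y - f (a g y)))"
  using assms(5,6)
proof (induction "card {y \<in> P. f y \<noteq> 0}" arbitrary: f rule: less_induct)
  case less
  define L where "L = {y \<in> P. f y \<noteq> 0}"
  have finL: "finite L" using \<open>finite P\<close> by (simp add: L_def)
  show ?case
  proof (cases "L = {}")
    case True
    then have "(\<Sum>y\<in>P. f y) = 0" by (intro sum.neutral) (auto simp: L_def)
    then show ?thesis by (auto intro!: sum_nonneg)
  next
    case False
    \<comment> \<open>The bottom layer of \<open>f\<close> is \<open>m\<close> times the indicator
      of \<open>L\<close>. Removing it leaves \<open>f'\<close> with strictly smaller support, which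
      drives the induction.\<close>
    define m where "m = Min (f ` L)"
    define f' where "f' y = (if y \<in> L then f y - m else 0)" for y
    have m_in: "m \<in> f ` L" unfolding m_def using finL False by (intro Min_in) auto
    have m_le: "m \<le> f y" if "y \<in> L" for y unfolding m_def using finL that by auto
    have m_pos: "m > 0" using m_in less.prems(1) by (force simp: L_def order_less_le)
    have f0: "f y = 0" if "y \<notin> L" for y using that less.prems(2) by (auto simp: L_def)
    have sub: "{y \<in> P. f' y \<noteq> 0} \<subset> L"
    proof -
      obtain y where "y \<in> L" "f y = m" using m_in by auto
      then have "y \<notin> {y \<in> P. f' y \<noteq> 0}" by (auto simp: f'_def)
      moreover have "{y \<in> P. f' y \<noteq> 0} \<subseteq> L" by (auto simp: f'_def split: if_splits)
      ultimately show ?thesis using \<open>y \<in> L\<close> by blast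
    qed
    have IH: "e * (\<Sum>y\<in>P. f' y) \<le>
        (\<Sum>g\<in>K. \<Sum>y | y \<in> P \<and> a g y \<in> Z \<and> (y, a g y) \<in> S. max 0 (f' y - f' (a g y)))"
    proof (rule less.hyps)
      show "card {y \<in> P. f' y \<noteq> 0} < card {y \<in> P. f y \<noteq> 0}"
        using psubset_card_mono[OF finL sub] by (simp add: L_def)
      show "0 \<le> f' y" for y using m_le[of y] by (simp add: f'_def)
      show "f' y = 0" if "y \<notin> P" for y using that by (simp add: f'_def L_def)
    qed
    have iso': "e * real (card L) \<le> (\<Sum>g\<in>K. real (card {y \<in> L. a g y \<in> Z - L \<and> (y, a g y) \<in> S}))"
      using iso False finL assms(4) unfolding isoperimetric_def by (auto simp: L_def)
    have "(\<Sum>y\<in>P. f y) = (\<Sum>y\<in>P. f' y + (if y \<in> L then m else 0))"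
      by (intro sum.cong) (auto simp: f'_def f0)
    also have "\<dots> = (\<Sum>y\<in>P. f' y) + m * real (card L)"
      using \<open>finite P\<close> by (simp add: sum.distrib sum.If_cases L_def Int_def)
    finally have "e * (\<Sum>y\<in>P. f y) = e * (\<Sum>y\<in>P. f' y) + m * (e * real (card L))"
      by (simp add: algebra_simps)
    also have "\<dots> \<le> (\<Sum>g\<in>K. \<Sum>y | y \<in> P \<and> a g y \<in> Z \<and> (y, a g y) \<in> S. max 0 (f' y - f' (a g y)))
         + m * (\<Sum>g\<in>K. real (card {y \<in> L. a g y \<in> Z - L \<and> (y, a g y) \<in> S}))"
      using IH iso' m_pos by (intro add_mono mult_left_mono) auto
    also have "\<dots> = (\<Sum>g\<in>K. (\<Sum>y | y \<in> P \<and> a g y \<in> Z \<and> (y, a g y) \<in> S. max 0 (f' y - f' (a g y)))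
         + m * real (card {y \<in> L. a g y \<in> Z - L \<and> (y, a g y) \<in> S}))"
      by (simp add: sum.distrib sum_distrib_left)
    also have "\<dots> \<le> (\<Sum>g\<in>K. \<Sum>y | y \<in> P \<and> a g y \<in> Z \<and> (y, a g y) \<in> S. max 0 (f y - f (a g y)))"
    proof (rule sum_mono)
      fix g assume "g \<in> K"
      define Pg where "Pg = {y. y \<in> P \<and> a g y \<in> Z \<and> (y, a g y) \<in> S}"
      have fin: "finite Pg" using \<open>finite P\<close> by (auto simp: Pg_def)
      have eq: "{y \<in> L. a g y \<in> Z - L \<and> (y, a g y) \<in> S} = {y \<in> Pg. y \<in> L \<and> a g y \<notin> L}"
        by (auto simp: Pg_def L_def)
      have "m * real (card {y \<in> L. a g y \<in> Z - L \<and> (y, a g y) \<in> S})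
          = (\<Sum>y\<in>Pg. if y \<in> L \<and> a g y \<notin> L then m else 0)"
        unfolding eq using fin by (simp add: sum.If_cases Int_def)
      then have "(\<Sum>y\<in>Pg. max 0 (f' y - f' (a g y))) + m * real (card {y \<in> L. a g y \<in> Z - L \<and> (y, a g y) \<in> S})
        = (\<Sum>y\<in>Pg. max 0 (f' y - f' (a g y)) + (if y \<in> L \<and> a g y \<notin> L then m else 0))"
        by (simp add: sum.distrib)
      \<comment> \<open>On an edge leaving \<open>L\<close> the drop of \<open>f\<close> is the drop
        of \<open>f'\<close> plus \<open>m\<close>; on an edge inside \<open>L\<close> both drops
        agree.\<close>
      also have "\<dots> \<le> (\<Sum>y\<in>Pg. max 0 (f y - f (a g y)))"
      proof (rule sum_mono)
        fix y
        show "max 0 (f' y - f' (a g y)) + (if y \<in> L \<and> a g y \<notin> L then m else 0) \<le> max 0 (f y - f (a g y))"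
          using m_le[of y] m_le[of "a g y"] f0[of y] f0[of "a g y"] m_pos less.prems(1)[of y]
          by (auto simp: f'_def max_def)
      qed
      finally show "(\<Sum>y | y \<in> P \<and> a g y \<in> Z \<and> (y, a g y) \<in> S. max 0 (f' y - f' (a g y)))
         + m * real (card {y \<in> L. a g y \<in> Z - L \<and> (y, a g y) \<in> S})
         \<le> (\<Sum>y | y \<in> P \<and> a g y \<in> Z \<and> (y, a g y) \<in> S. max 0 (f y - f (a g y)))"
        unfolding Pg_def .
    qed
    finally show ?thesis .
  qed
qed

text \<open>The action need not be free, so a finite subset \<open>C\<close> of the group is pushed to the orbit of
  \<open>x\<^sub>0\<close> as a multiset; this is why the isoperimetric inequality is needed for functions.\<close>

lemma isoperimetric_pullback:
  fixes C :: "'g set" and h :: "'g \<Rightarrow> real" and u :: 'g and x :: 'x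
  defines "p \<equiv> \<lambda>w. a (w - u) x"
  assumes iso: "isoperimetric K Y e x" and "finite K" "finite C" "\<And>w. 0 \<le> h w"
    and inY: "\<And>w. w \<in> C \<Longrightarrow> p w \<in> Y \<and> (x, p w) \<in> S"
    and Q: "\<And>w g. w \<in> C \<Longrightarrow> g \<in> K \<Longrightarrow> a g (p w) \<in> Y \<Longrightarrow> (p w, a g (p w)) \<in> S \<Longrightarrow> g \<in> Q w"
  shows "e * (\<Sum>w\<in>C. h w) \<le>
    (\<Sum>g\<in>K. \<Sum>w | w \<in> C \<and> g \<in> Q w. max 0 (h w - (if g + w \<in> C then h (g + w) else 0)))"
proof -
  \<comment> \<open>Fibre sums: \<open>f\<close> is the push-forward of the weight \<open>h\<close>,
    so points identified by a stabiliser merge their weights.\<close>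
  define f where "f y = (\<Sum>w | w \<in> C \<and> p w = y. h w)" for y
  define H where "H v = (if v \<in> C then h v else 0)" for v
  define P where "P = p ` C"
  have finP: "finite P" using \<open>finite C\<close> by (simp add: P_def)
  have f_nonneg: "0 \<le> f y" for y using assms(5) by (auto simp: f_def intro: sum_nonneg)
  have f0: "f y = 0" if "y \<notin> P" for y
  proof -
    have "{w. w \<in> C \<and> p w = y} = {}" using that by (auto simp: P_def)
    then show ?thesis unfolding f_def by (metis sum.empty)
  qed
  have p_shift: "p (g + w) = a g (p w)" for g w
    unfolding p_def by (simp add: act_add[symmetric] add_diff_eq)
  have "(\<Sum>w\<in>C. h w) = (\<Sum>y\<in>P. f y)"
    unfolding P_def f_def by (rule sum.image_gen[OF \<open>finite C\<close>])
  then have "e * (\<Sum>w\<in>C. h w) = e * (\<Sum>y\<in>P. f y)" by simp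
  also have "\<dots> \<le> (\<Sum>g\<in>K. \<Sum>y | y \<in> P \<and> a g y \<in> Y \<and> (y, a g y) \<in> S. max 0 (f y - f (a g y)))"
    by (rule isoperimetric_fun[OF iso \<open>finite K\<close> finP _ f_nonneg f0]) (use inY in \<open>auto simp: P_def\<close>)
  also have "\<dots> \<le> (\<Sum>g\<in>K. \<Sum>w | w \<in> C \<and> g \<in> Q w. max 0 (h w - H (g + w)))"
  proof (rule sum_mono)
    fix g assume g: "g \<in> K"
    define Cg where "Cg = {w \<in> C. a g (p w) \<in> Y \<and> (p w, a g (p w)) \<in> S}"
    have P': "{y. y \<in> P \<and> a g y \<in> Y \<and> (y, a g y) \<in> S} = p ` Cg"
      by (auto simp: P_def Cg_def)
    have "(\<Sum>y\<in>p ` Cg. max 0 (f y - f (a g y))) \<le> (\<Sum>y\<in>p ` Cg. \<Sum>w | w \<in> Cg \<and> p w = y. max 0 (h w - H (g + w)))"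
    proof (rule sum_mono)
      fix y assume y: "y \<in> p ` Cg"
      then have same: "{w. w \<in> Cg \<and> p w = y} = {w. w \<in> C \<and> p w = y}" by (auto simp: Cg_def)
      define D where "D = {w. w \<in> C \<and> p w = y}"
      have finD: "finite D" using \<open>finite C\<close> by (simp add: D_def)
      \<comment> \<open>Left translation by \<open>g\<close> carries the part of the fibre over
        \<open>y\<close> that stays in \<open>C\<close> injectively into the fibre over
        \<open>a g y\<close>. Hence the drop of \<open>f\<close> is at most the sum of the drops of
        \<open>h\<close> over the fibre.\<close>
      have "(\<Sum>w\<in>D. H (g + w)) = (\<Sum>w | w \<in> D \<and> g + w \<in> C. h (g + w))"
        using finD by (simp add: H_def sum.If_cases Int_def)
      also have "\<dots> = (\<Sum>v\<in>(+) g ` {w. w \<in> D \<and> g + w \<in> C}. h v)"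
        by (subst sum.reindex) (auto simp: inj_on_def)
      also have "\<dots> \<le> f (a g y)"
        unfolding f_def using \<open>finite C\<close> assms(5)
        by (intro sum_mono2) (auto simp: D_def p_shift)
      finally have "f y - f (a g y) \<le> (\<Sum>w\<in>D. h w - H (g + w))"
        by (simp add: f_def D_def sum_subtractf)
      also have "\<dots> \<le> (\<Sum>w\<in>D. max 0 (h w - H (g + w)))" by (intro sum_mono) auto
      finally have "f y - f (a g y) \<le> (\<Sum>w\<in>D. max 0 (h w - H (g + w)))" .
      moreover have "0 \<le> (\<Sum>w\<in>D. max 0 (h w - H (g + w)))" by (intro sum_nonneg) auto
      ultimately show "max 0 (f y - f (a g y)) \<le> (\<Sum>w | w \<in> Cg \<and> p w = y. max 0 (h w - H (g + w)))"
        unfolding same D_def by simp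
    qed
    also have "\<dots> = (\<Sum>w\<in>Cg. max 0 (h w - H (g + w)))"
      by (rule sum.image_gen[symmetric]) (use \<open>finite C\<close> in \<open>auto simp: Cg_def\<close>)
    also have "\<dots> \<le> (\<Sum>w | w \<in> C \<and> g \<in> Q w. max 0 (h w - H (g + w)))"
      by (intro sum_mono2) (use \<open>finite C\<close> Q g in \<open>auto simp: Cg_def\<close>)
    finally show "(\<Sum>y | y \<in> P \<and> a g y \<in> Y \<and> (y, a g y) \<in> S. max 0 (f y - f (a g y)))
        \<le> (\<Sum>w | w \<in> C \<and> g \<in> Q w. max 0 (h w - H (g + w)))"
      unfolding P' .
  qed
  finally show ?thesis unfolding H_def .
qed

text \<open>The weights \<open>\<eta> w z\<close> form a partition of unity with bounded supports.
  On one support the condition \<open>v - w \<in> R w\<close> behaves as an equivalence relation,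
  and each class is transported to the orbit of \<open>pt x\<close> for a representative
  \<open>x\<close>, where expansion applies to the weight. Summing over \<open>z\<close> recovers
  the count of \<open>G\<close>.\<close>

lemma isoperimetric_core:
  fixes G Bt Zs F F0 K :: "'g set" and R Q :: "'g \<Rightarrow> 'g set" and pt :: "'g \<Rightarrow> 'x"
    and \<eta> :: "'g \<Rightarrow> 'g \<Rightarrow> real"
  assumes fin: "finite G" "finite K" "finite Zs"
    and iso: "\<And>x. x \<in> G \<Longrightarrow> isoperimetric K Y e (pt x)"
    and F0: "\<And>w v z. w \<in> G \<Longrightarrow> v \<in> G \<Longrightarrow> \<eta> w z \<noteq> 0 \<Longrightarrow> \<eta> v z \<noteq> 0 \<Longrightarrow> v - w \<in> F0"
    and R0: "\<And>x. x \<in> G \<Longrightarrow> 0 \<in> R x"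
    and RQ: "\<And>x. x \<in> G \<Longrightarrow> R x \<subseteq> Q x"
    and cR: "\<And>x w g. x \<in> G \<Longrightarrow> w \<in> G \<Longrightarrow> w - x \<in> R x \<Longrightarrow> w - x \<in> F0 \<Longrightarrow> g \<in> F0 \<union> K \<Longrightarrow>
        g \<in> R w \<longleftrightarrow> g + (w - x) \<in> R x"
    and cQ: "\<And>x w g. x \<in> G \<Longrightarrow> w \<in> G \<Longrightarrow> w - x \<in> R x \<Longrightarrow> w - x \<in> F0 \<Longrightarrow> g \<in> K \<Longrightarrow>
        g + (w - x) \<in> Q x \<Longrightarrow> g \<in> Q w"
    and Q1: "\<And>x g. x \<in> G \<Longrightarrow> g \<in> F0 \<Longrightarrow> g \<in> Q x \<Longrightarrow> a g (pt x) \<in> Y \<and> (pt x, a g (pt x)) \<in> S"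
    and Q2: "\<And>x g h. x \<in> G \<Longrightarrow> g \<in> K \<Longrightarrow> h \<in> F0 \<Longrightarrow> a (g + h) (pt x) \<in> Y \<Longrightarrow>
        (pt x, a (g + h) (pt x)) \<in> S \<Longrightarrow> g + h \<in> Q x"
    and RB: "\<And>x g. x \<in> G \<Longrightarrow> g \<in> K \<Longrightarrow> g \<in> R x \<Longrightarrow> g + x \<in> Bt"
    and \<eta>0: "\<And>w z. 0 \<le> \<eta> w z"
    and \<eta>1: "\<And>w. w \<in> G \<Longrightarrow> (\<Sum>z\<in>Zs. \<eta> w z) = 1"
    and \<eta>2: "\<And>w g. w \<in> G \<Longrightarrow> g \<in> K \<Longrightarrow> g + w \<in> G \<Longrightarrow> (\<Sum>z\<in>Zs. \<bar>\<eta> w z - \<eta> (g + w) z\<bar>) \<le> e'"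
    and "0 \<le> e'" and Bt: "finite Bt"
  shows "e * real (card G) \<le> real (card K) * e' * real (card G) + real (card K) * real (card (Bt - G))
           + (\<Sum>w\<in>G. real (card {g \<in> K. g \<in> Q w - R w}))"
proof -
  \<comment> \<open>One term for each reason why weight is lost along \<open>g\<close>: variation of
    \<open>\<eta>\<close>, a translate that is not good, and a genuine boundary label.\<close>
  define t where "t g w z = (if g + w \<in> G then \<bar>\<eta> w z - \<eta> (g + w) z\<bar> else 0)
      + (if g + w \<in> Bt - G then \<eta> w z else 0) + (if g \<in> Q w - R w then \<eta> w z else 0)" for g w z
  have t0: "0 \<le> t g w z" for g w z using \<eta>0 by (auto simp: t_def)
  have z_bound: "e * (\<Sum>w\<in>G. \<eta> w z) \<le> (\<Sum>w\<in>G. \<Sum>g\<in>K. t g w z)" for z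
  proof -
    define V where "V = {w \<in> G. \<eta> w z \<noteq> 0}"
    define cl where "cl w = {v \<in> V. v - w \<in> R w}" for w
    have finV: "finite V" using fin by (simp add: V_def)
    have VG: "V \<subseteq> G" by (auto simp: V_def)
    have inF0: "v - w \<in> F0" if "v \<in> V" "w \<in> V" for v w using that F0 by (auto simp: V_def)
    have refl: "w \<in> cl w" if "w \<in> V" for w using that R0 by (auto simp: cl_def V_def)
    \<comment> \<open>Through \<open>cR\<close>, differences can be tested at \<open>w\<close> or at
      \<open>x\<close> with the same outcome; this makes the sets \<open>cl w\<close> a partition of
      \<open>V\<close>.\<close>
    have step: "v - w \<in> R w \<longleftrightarrow> v - x \<in> R x" if "x \<in> V" "w \<in> V" "v \<in> V" "w - x \<in> R x" for x w v
    proof -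
      have "v - w + (w - x) = v - x" by (simp add: add_diff_eq)
      moreover have "v - w \<in> R w \<longleftrightarrow> v - w + (w - x) \<in> R x"
        using that VG inF0 by (intro cR) auto
      ultimately show ?thesis by simp
    qed
    have cl_eq: "cl w = cl x" if "x \<in> V" "w \<in> cl x" for x w
    proof -
      have "w \<in> V" "w - x \<in> R x" using that(2) by (simp_all add: cl_def)
      then show ?thesis unfolding cl_def using step[OF that(1)] by (intro Collect_cong) blast
    qed
    have cl_iff: "{w \<in> V. cl w = cl x} = cl x" if "x \<in> V" for x
    proof (intro equalityI subsetI)
      fix w assume "w \<in> cl x"
      moreover from this have "w \<in> V" by (simp add: cl_def)
      ultimately show "w \<in> {w \<in> V. cl w = cl x}" using cl_eq[OF that] by simp
    next
      fix w assume "w \<in> {w \<in> V. cl w = cl x}"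
      then show "w \<in> cl x" using refl[of w] by simp
    qed
    have cls: "e * (\<Sum>w\<in>cl x. \<eta> w z) \<le> (\<Sum>w\<in>cl x. \<Sum>g\<in>K. t g w z)" if x: "x \<in> V" for x
    proof -
      let ?C = "cl x"
      have CV: "?C \<subseteq> V" by (auto simp: cl_def)
      have xG: "x \<in> G" using x VG by auto
      have "e * (\<Sum>w\<in>?C. \<eta> w z) \<le> (\<Sum>g\<in>K. \<Sum>w | w \<in> ?C \<and> g \<in> Q w.
             max 0 (\<eta> w z - (if g + w \<in> ?C then \<eta> (g + w) z else 0)))"
      \<comment> \<open>The point \<open>w\<close> is sent to \<open>a (w - x) (pt x)\<close>.
        \<open>RQ\<close> and \<open>Q1\<close> put the images in \<open>Y\<close>, while
        \<open>Q2\<close> and \<open>cQ\<close> ensure that every real edge at an image has its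
        label in \<open>Q w\<close>.\<close>
      proof (rule isoperimetric_pullback[where u = x and x = "pt x" and Q = Q and h = "\<lambda>w. \<eta> w z", OF iso[OF xG] fin(2)])
        show "finite ?C" using CV finV finite_subset by blast
        show "0 \<le> \<eta> w z" for w by (rule \<eta>0)
        fix w assume w: "w \<in> ?C"
        then have wV: "w \<in> V" and wR: "w - x \<in> R x" by (auto simp: cl_def)
        have wF: "w - x \<in> F0" using inF0[OF wV x] .
        show pw: "a (w - x) (pt x) \<in> Y \<and> (pt x, a (w - x) (pt x)) \<in> S"
          using Q1[OF xG wF] wR RQ[OF xG] by auto
        fix g assume g: "g \<in> K" and gY: "a g (a (w - x) (pt x)) \<in> Y"
          and gS: "(a (w - x) (pt x), a g (a (w - x) (pt x))) \<in> S"
        have "(pt x, a g (a (w - x) (pt x))) \<in> S" using S_trans pw gS by blast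
        then have "g + (w - x) \<in> Q x" using Q2[OF xG g wF] gY by (simp add: act_add)
        then show "g \<in> Q w" using cQ[OF xG _ wR wF g] wV VG by auto
      qed
      also have "\<dots> \<le> (\<Sum>g\<in>K. \<Sum>w\<in>?C. t g w z)"
      proof (intro sum_mono)
        fix g assume g: "g \<in> K"
        have finC: "finite ?C" using CV finV finite_subset by blast
        have "(\<Sum>w | w \<in> ?C \<and> g \<in> Q w. max 0 (\<eta> w z - (if g + w \<in> ?C then \<eta> (g + w) z else 0)))
           \<le> (\<Sum>w | w \<in> ?C \<and> g \<in> Q w. t g w z)"
        proof (rule sum_mono)
          fix w assume "w \<in> {w. w \<in> ?C \<and> g \<in> Q w}"
          then have w: "w \<in> ?C" and gQ: "g \<in> Q w" by auto
          have wV: "w \<in> V" and wG: "w \<in> G" using w CV VG by auto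
          have "\<eta> w z - (if g + w \<in> ?C then \<eta> (g + w) z else 0) \<le> t g w z"
          proof (cases "g \<in> R w")
            case True
            have B: "g + w \<in> Bt" using RB wG g True by auto
            show ?thesis
            proof (cases "g + w \<in> G")
              case gG: True
              \<comment> \<open>Along a label of \<open>R w\<close>, leaving the class while staying
                in \<open>G\<close> means leaving the support, so the lost weight equals the
                variation of \<open>\<eta>\<close>.\<close>
              have "\<eta> (g + w) z = 0" if "g + w \<notin> ?C"
              proof (rule ccontr)
                assume "\<eta> (g + w) z \<noteq> 0"
                then have "g + w \<in> V" using gG by (auto simp: V_def)
                moreover have "g + w - w \<in> R w" using True by (simp add: add_diff_eq)
                ultimately have "g + w \<in> cl w" by (auto simp: cl_def)
                then show False using cl_eq[OF x w] that by auto
              qed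
              then show ?thesis using \<eta>0[of w z] gG by (auto simp: t_def)
            next
              case False
              then have "t g w z \<ge> \<eta> w z" using B \<eta>0[of w z] by (auto simp: t_def)
              then show ?thesis using \<eta>0[of "g + w" z] by (auto)
            qed
          next
            case False
            then have "t g w z \<ge> \<eta> w z" using gQ \<eta>0[of w z] by (auto simp: t_def)
            then show ?thesis using \<eta>0[of "g + w" z] by (auto)
          qed
          then show "max 0 (\<eta> w z - (if g + w \<in> ?C then \<eta> (g + w) z else 0)) \<le> t g w z"
            using t0 by simp
        qed
        also have "\<dots> \<le> (\<Sum>w\<in>?C. t g w z)" using finC t0 by (intro sum_mono2) auto
        finally show "(\<Sum>w | w \<in> ?C \<and> g \<in> Q w. max 0 (\<eta> w z - (if g + w \<in> ?C then \<eta> (g + w) z else 0)))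
           \<le> (\<Sum>w\<in>?C. t g w z)" .
      qed
      also have "\<dots> = (\<Sum>w\<in>?C. \<Sum>g\<in>K. t g w z)" by (rule sum.swap)
      finally show ?thesis .
    qed
    have "(\<Sum>w\<in>G. \<eta> w z) = (\<Sum>w\<in>V. \<eta> w z)"
      unfolding V_def using fin by (intro sum.mono_neutral_right) auto
    also have "\<dots> = (\<Sum>c\<in>cl ` V. \<Sum>w | w \<in> V \<and> cl w = c. \<eta> w z)" by (rule sum.image_gen[OF finV])
    finally have "e * (\<Sum>w\<in>G. \<eta> w z) = (\<Sum>c\<in>cl ` V. e * (\<Sum>w | w \<in> V \<and> cl w = c. \<eta> w z))"
      by (simp add: sum_distrib_left)
    also have "\<dots> \<le> (\<Sum>c\<in>cl ` V. \<Sum>w | w \<in> V \<and> cl w = c. \<Sum>g\<in>K. t g w z)"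
      by (rule sum_mono) (use cls cl_iff in auto)
    also have "\<dots> = (\<Sum>w\<in>V. \<Sum>g\<in>K. t g w z)" by (rule sum.image_gen[OF finV, symmetric])
    also have "\<dots> \<le> (\<Sum>w\<in>G. \<Sum>g\<in>K. t g w z)"
      using fin VG t0 by (intro sum_mono2) (auto intro: sum_nonneg)
    finally show ?thesis .
  qed
  have "e * real (card G) = (\<Sum>w\<in>G. e * (\<Sum>z\<in>Zs. \<eta> w z))" using \<eta>1 by simp
  also have "\<dots> = (\<Sum>z\<in>Zs. e * (\<Sum>w\<in>G. \<eta> w z))"
    by (simp add: sum_distrib_left) (rule sum.swap)
  also have "\<dots> \<le> (\<Sum>z\<in>Zs. \<Sum>w\<in>G. \<Sum>g\<in>K. t g w z)" by (intro sum_mono z_bound)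
  also have "\<dots> = (\<Sum>w\<in>G. \<Sum>z\<in>Zs. \<Sum>g\<in>K. t g w z)" by (rule sum.swap)
  also have "\<dots> = (\<Sum>w\<in>G. \<Sum>g\<in>K. \<Sum>z\<in>Zs. t g w z)"
    by (rule sum.cong[OF refl], rule sum.swap)
  also have "\<dots> \<le> (\<Sum>w\<in>G. \<Sum>g\<in>K. e' + (if g + w \<in> Bt - G then 1 else 0) + (if g \<in> Q w - R w then 1 else 0))"
  proof (intro sum_mono)
    fix w g assume w: "w \<in> G" and g: "g \<in> K"
    have "(\<Sum>z\<in>Zs. t g w z) = (\<Sum>z\<in>Zs. (if g + w \<in> G then \<bar>\<eta> w z - \<eta> (g + w) z\<bar> else 0))
      + (\<Sum>z\<in>Zs. (if g + w \<in> Bt - G then \<eta> w z else 0)) + (\<Sum>z\<in>Zs. (if g \<in> Q w - R w then \<eta> w z else 0))"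
      unfolding t_def by (simp add: sum.distrib)
    also have "\<dots> \<le> e' + (if g + w \<in> Bt - G then 1 else 0) + (if g \<in> Q w - R w then 1 else 0)"
      using \<eta>1[OF w] \<eta>2[OF w g] \<open>0 \<le> e'\<close> by (intro add_mono; cases "g + w \<in> G") auto
    finally show "(\<Sum>z\<in>Zs. t g w z) \<le> \<dots>" .
  qed
  also have "\<dots> = real (card K) * e' * real (card G) + (\<Sum>w\<in>G. \<Sum>g\<in>K. (if g + w \<in> Bt - G then 1 else 0))
      + (\<Sum>w\<in>G. \<Sum>g\<in>K. if g \<in> Q w - R w then 1 else 0)"
    by (simp add: sum.distrib)
  also have "(\<Sum>w\<in>G. \<Sum>g\<in>K. (if g + w \<in> Bt - G then 1 else (0::real))) = (\<Sum>g\<in>K. \<Sum>w\<in>G. (if g + w \<in> Bt - G then 1 else 0))"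
    by (rule sum.swap)
  also have "\<dots> \<le> (\<Sum>g\<in>K. real (card (Bt - G)))"
  proof (rule sum_mono)
    fix g
    \<comment> \<open>Translation by \<open>g\<close> is injective, so each label hits a point of
      \<open>Bt - G\<close> at most once.\<close>
    have "(\<Sum>w\<in>G. (if g + w \<in> Bt - G then 1 else (0::real))) = real (card {w \<in> G. g + w \<in> Bt - G})"
      using fin by (simp add: sum.If_cases Int_def)
    also have "card {w \<in> G. g + w \<in> Bt - G} = card ((+) g ` {w \<in> G. g + w \<in> Bt - G})"
      by (rule card_image[symmetric]) (auto simp: inj_on_def)
    also have "\<dots> \<le> card (Bt - G)" using Bt by (intro card_mono) auto
    finally show "(\<Sum>w\<in>G. (if g + w \<in> Bt - G then 1 else (0::real))) \<le> real (card (Bt - G))" by simp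
  qed
  also have "(\<Sum>w\<in>G. \<Sum>g\<in>K. if g \<in> Q w - R w then 1 else (0::real)) = (\<Sum>w\<in>G. real (card {g \<in> K. g \<in> Q w - R w}))"
    using fin by (simp add: sum.If_cases Int_def)
  finally show ?thesis by simp
qed

end

section \<open>Transfer to the group\<close>

text \<open>Truncated inclusion-exclusion. Every overlap is charged in both orders, a harmless loss
  when all overlaps are small.\<close>

lemma sum_card_le_card_UN:
  assumes "finite J" "\<And>j. j \<in> J \<Longrightarrow> finite (U j)"
  shows "(\<Sum>j\<in>J. card (U j)) \<le> card (\<Union>j\<in>J. U j) + (\<Sum>j\<in>J. \<Sum>j'\<in>J - {j}. card (U j \<inter> U j'))"
  using assms
proof (induction J)
  case (insert x J)
  have fin: "finite (U x)" "finite (\<Union>j\<in>J. U j)" using insert by auto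
  have IH: "(\<Sum>j\<in>J. card (U j)) \<le> card (\<Union>j\<in>J. U j) + (\<Sum>j\<in>J. \<Sum>j'\<in>J - {j}. card (U j \<inter> U j'))"
    using insert by simp
  have 1: "card (U x) + card (\<Union>j\<in>J. U j) = card (\<Union>j\<in>insert x J. U j) + card (U x \<inter> (\<Union>j\<in>J. U j))"
    using card_Un_Int[OF fin] by simp
  have 2: "card (U x \<inter> (\<Union>j\<in>J. U j)) \<le> (\<Sum>j'\<in>J. card (U x \<inter> U j'))"
    unfolding Int_UN_distrib by (rule card_UN_le[OF insert(1)])
  have 3: "(\<Sum>j\<in>J. \<Sum>j'\<in>J - {j}. card (U j \<inter> U j')) \<le> (\<Sum>j\<in>J. \<Sum>j'\<in>insert x J - {j}. card (U j \<inter> U j'))"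
    using insert(1) by (intro sum_mono sum_mono2) auto
  have 4: "insert x J - {x} = J" using insert by auto
  show ?case using IH 1 2 3 insert(1,2) by (simp add: 4)
qed simp

text \<open>Pairwise counts alone force structure. Disjoint cells give nearly disjoint
  \<open>B i\<close>; a label in \<open>R i\<close> keeps nearly all of \<open>B i\<close> inside
  \<open>Bt\<close>, as it keeps its cell inside the union of the cells; coincidences of mass zero
  are rare. There are finitely many kinds of failure, each costing a multiple of
  \<open>\<theta>\<close>.\<close>

lemma card_coincidence_bounds:
  fixes B :: "nat \<Rightarrow> 'g::group_add set" and m :: "nat \<Rightarrow> 'g \<Rightarrow> nat \<Rightarrow> real"
  assumes "finite F1" "0 \<in> F1" and finB: "\<And>i. i < k \<Longrightarrow> finite (B i)" and "0 < c"
    and approx: "\<And>i j g. i < k \<Longrightarrow> j < k \<Longrightarrow> g \<in> F1 \<Longrightarrow>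
      \<bar>m i g j - c * real (card {b \<in> B i. g + b \<in> B j})\<bar> \<le> \<theta>"
    and mR: "\<And>i g. i < k \<Longrightarrow> g \<in> F1 \<Longrightarrow> g \<in> R i \<Longrightarrow> m i 0 i \<le> (\<Sum>j<k. m i g j)"
    and m0: "\<And>i j. i < k \<Longrightarrow> j < k \<Longrightarrow> i \<noteq> j \<Longrightarrow> m i 0 j = 0"
    and m_nonneg: "\<And>i j g. 0 \<le> m i g j"
  defines "Bt \<equiv> \<Union>i<k. B i"
  defines "G \<equiv> {b \<in> Bt. \<forall>i<k. \<forall>g\<in>F1. b \<in> B i \<longrightarrow>
     (g \<in> R i \<longrightarrow> g + b \<in> Bt) \<and> (\<forall>j<k. g + b \<in> B j \<longrightarrow> 0 < m i g j)}"
  shows "c * real (card (Bt - G)) \<le> real (k * card F1 * (1 + k)\<^sup>2) * \<theta>" (is ?bad)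
    and "(\<Sum>i<k. m i 0 i) - real (k + k\<^sup>2) * \<theta> \<le> c * real (card Bt)" (is ?low)
proof -
  define n where "n i g j = card {b \<in> B i. g + b \<in> B j}" for i g j
  have up: "c * real (n i g j) \<le> m i g j + \<theta>" and lo: "m i g j - \<theta> \<le> c * real (n i g j)"
    if "i < k" "j < k" "g \<in> F1" for i g j
    using approx[OF that] by (auto simp: n_def)
  have n_self: "n i 0 i = card (B i)" for i by (simp add: n_def)
  have \<theta>: "0 \<le> \<theta>" if "k \<noteq> 0"
    using approx[of 0 0 0] that \<open>0 \<in> F1\<close> by linarith
  have finBt: "finite Bt" using finB by (auto simp: Bt_def)
  \<comment> \<open>Since \<open>m j 0 j'\<close> vanishes for distinct cells, the approximation at
    \<open>g = 0\<close> bounds all overlaps of the \<open>B j\<close>.\<close>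
  have pairs: "c * real (\<Sum>j<k. \<Sum>j'\<in>{..<k} - {j}. n j 0 j') \<le> real (k\<^sup>2) * \<theta>"
  proof -
    have "c * real (\<Sum>j<k. \<Sum>j'\<in>{..<k} - {j}. n j 0 j') = (\<Sum>j<k. \<Sum>j'\<in>{..<k} - {j}. c * real (n j 0 j'))"
      by (simp add: sum_distrib_left)
    also have "\<dots> \<le> (\<Sum>j<k. \<Sum>j'\<in>{..<k} - {j}. \<theta>)"
      using up m0 \<open>0 \<in> F1\<close> by (intro sum_mono) (fastforce)
    also have "\<dots> \<le> (\<Sum>j<k. real k * \<theta>)"
    proof (rule sum_mono)
      fix j assume "j \<in> {..<k}"
      then show "(\<Sum>j'\<in>{..<k} - {j}. \<theta>) \<le> real k * \<theta>"
        using \<theta> by (simp add: mult_right_mono)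
    qed
    finally show ?thesis by (simp add: power2_eq_square)
  qed
  have "(\<Sum>i<k. card (B i)) \<le> card Bt + (\<Sum>j<k. \<Sum>j'\<in>{..<k} - {j}. card (B j \<inter> B j'))"
    unfolding Bt_def using finB by (intro sum_card_le_card_UN) auto
  also have "(\<Sum>j<k. \<Sum>j'\<in>{..<k} - {j}. card (B j \<inter> B j')) = (\<Sum>j<k. \<Sum>j'\<in>{..<k} - {j}. n j 0 j')"
    by (simp add: n_def Int_def)
  finally have "real (\<Sum>i<k. card (B i)) \<le> real (card Bt + (\<Sum>j<k. \<Sum>j'\<in>{..<k} - {j}. n j 0 j'))"
    by (rule of_nat_mono)
  then have "c * real (\<Sum>i<k. card (B i)) \<le> c * (real (card Bt) + real (\<Sum>j<k. \<Sum>j'\<in>{..<k} - {j}. n j 0 j'))"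
    using \<open>0 < c\<close> by (intro mult_left_mono) auto
  then have "c * real (\<Sum>i<k. card (B i)) \<le> c * real (card Bt) + real (k\<^sup>2) * \<theta>"
    using pairs by (simp add: algebra_simps)
  moreover have "c * real (\<Sum>i<k. card (B i)) \<ge> (\<Sum>i<k. m i 0 i - \<theta>)"
    unfolding of_nat_sum sum_distrib_left using lo \<open>0 \<in> F1\<close> by (intro sum_mono) (auto simp flip: n_self)
  ultimately show ?low by (simp add: sum_subtractf algebra_simps)

  \<comment> \<open>The two kinds of failure: a label that should stay in \<open>Bt\<close> but does
    not, and a coincidence of mass zero.\<close>
  define P1 where "P1 = (SIGMA i:{..<k}. F1 \<inter> R i)"
  define P2 where "P2 = {(i, g, j). i < k \<and> g \<in> F1 \<and> j < k \<and> m i g j = 0}"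
  have finP1: "finite P1" using \<open>finite F1\<close> by (auto simp: P1_def)
  have P2_sub: "P2 \<subseteq> {..<k} \<times> F1 \<times> {..<k}" by (auto simp: P2_def)
  have finP2: "finite P2" by (rule finite_subset[OF P2_sub]) (use \<open>finite F1\<close> in auto)
  have cP1: "card P1 \<le> k * card F1"
  proof -
    have "card P1 \<le> card ({..<k} \<times> F1)" using \<open>finite F1\<close> by (intro card_mono) (auto simp: P1_def)
    then show ?thesis by (simp add: card_cartesian_product)
  qed
  have cP2: "card P2 \<le> k * card F1 * k"
  proof -
    have "card P2 \<le> card ({..<k} \<times> F1 \<times> {..<k})" using \<open>finite F1\<close> P2_sub by (intro card_mono) auto
    then show ?thesis by (simp add: card_cartesian_product)
  qed
  have sub: "Bt - G \<subseteq> (\<Union>(i, g)\<in>P1. {b \<in> B i. g + b \<notin> Bt}) \<union> (\<Union>(i, g, j)\<in>P2. {b \<in> B i. g + b \<in> B j})"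
  proof
    fix b assume "b \<in> Bt - G"
    then obtain i g where "i < k" "g \<in> F1" "b \<in> B i"
      and "g \<in> R i \<and> g + b \<notin> Bt \<or> (\<exists>j<k. g + b \<in> B j \<and> \<not> 0 < m i g j)"
      unfolding G_def by blast
    then show "b \<in> (\<Union>(i, g)\<in>P1. {b \<in> B i. g + b \<notin> Bt}) \<union> (\<Union>(i, g, j)\<in>P2. {b \<in> B i. g + b \<in> B j})"
      using m_nonneg by (force simp: P1_def P2_def not_less intro: antisym)
  qed
  \<comment> \<open>The summands \<open>1\<close>, \<open>k\<close> and \<open>k\<^sup>2\<close>
    count the errors of \<open>B i\<close>, of the sets \<open>U j\<close>, and of their overlaps,
    which translation by \<open>g\<close> maps into overlaps of the \<open>B j\<close>. By
    \<open>mR\<close> the main terms cancel.\<close>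
  have U1: "c * real (card {b \<in> B i. g + b \<notin> Bt}) \<le> real (1 + k + k\<^sup>2) * \<theta>" if "(i, g) \<in> P1" for i g
  proof -
    have ig: "i < k" "g \<in> F1" "g \<in> R i" using that by (auto simp: P1_def)
    define U where "U j = {b \<in> B i. g + b \<in> B j}" for j
    have finU: "finite (U j)" for j using finB ig by (auto simp: U_def)
    have Uint: "card (U j \<inter> U j') \<le> n j 0 j'" if "j < k" for j j'
    proof -
      have "card (U j \<inter> U j') = card ((+) g ` (U j \<inter> U j'))"
        by (rule card_image[symmetric]) (auto simp: inj_on_def)
      also have "\<dots> \<le> n j 0 j'"
        unfolding n_def using finB[OF that] by (intro card_mono) (auto simp: U_def)
      finally show ?thesis .
    qed
    have eq: "{b \<in> B i. g + b \<notin> Bt} = B i - (\<Union>j<k. U j)" by (auto simp: U_def Bt_def)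
    have "card (B i - (\<Union>j<k. U j)) = card (B i) - card (\<Union>j<k. U j)"
      using finB ig by (intro card_Diff_subset) (auto simp: U_def)
    moreover have "card (\<Union>j<k. U j) \<le> card (B i)"
      using finB ig by (intro card_mono) (auto simp: U_def)
    ultimately have e1: "real (card {b \<in> B i. g + b \<notin> Bt}) = real (card (B i)) - real (card (\<Union>j<k. U j))"
      by (simp add: eq)
    have "(\<Sum>j<k. card (U j)) \<le> card (\<Union>j<k. U j) + (\<Sum>j<k. \<Sum>j'\<in>{..<k} - {j}. card (U j \<inter> U j'))"
      using finU by (intro sum_card_le_card_UN) auto
    also have "\<dots> \<le> card (\<Union>j<k. U j) + (\<Sum>j<k. \<Sum>j'\<in>{..<k} - {j}. n j 0 j')"
      using Uint by (intro add_left_mono sum_mono) auto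
    finally have "real (\<Sum>j<k. card (U j)) \<le> real (card (\<Union>j<k. U j) + (\<Sum>j<k. \<Sum>j'\<in>{..<k} - {j}. n j 0 j'))"
      by (rule of_nat_mono)
    then have "c * real (\<Sum>j<k. card (U j)) \<le> c * (real (card (\<Union>j<k. U j)) + real (\<Sum>j<k. \<Sum>j'\<in>{..<k} - {j}. n j 0 j'))"
      using \<open>0 < c\<close> by (intro mult_left_mono) auto
    then have e2: "c * real (\<Sum>j<k. card (U j)) \<le> c * real (card (\<Union>j<k. U j)) + real (k\<^sup>2) * \<theta>"
      using pairs by (simp add: algebra_simps)
    have e3: "c * real (\<Sum>j<k. card (U j)) \<ge> (\<Sum>j<k. m i g j - \<theta>)"
      unfolding of_nat_sum sum_distrib_left
      using lo ig by (intro sum_mono) (auto simp: U_def n_def)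
    have e4: "c * real (card (B i)) \<le> m i 0 i + \<theta>" using up[of i i 0] ig \<open>0 \<in> F1\<close> by (simp add: n_self)
    have "c * real (card {b \<in> B i. g + b \<notin> Bt}) = c * real (card (B i)) - c * real (card (\<Union>j<k. U j))"
      by (simp add: e1 algebra_simps)
    also have "\<dots> \<le> \<theta> + real k * \<theta> + real (k\<^sup>2) * \<theta>"
      using e2 e3 e4 mR[OF ig] by (simp add: sum_subtractf)
    finally show ?thesis by (simp add: algebra_simps)
  qed
  have fin1: "finite (\<Union>(i, g)\<in>P1. {b \<in> B i. g + b \<notin> Bt})"
    using finP1 finB by (auto simp: P1_def)
  have fin2: "finite (\<Union>(i, g, j)\<in>P2. {b \<in> B i. g + b \<in> B j})"
    using finP2 finB by (auto simp: P2_def)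
  have "card (Bt - G) \<le> card (\<Union>(i, g)\<in>P1. {b \<in> B i. g + b \<notin> Bt}) + card (\<Union>(i, g, j)\<in>P2. {b \<in> B i. g + b \<in> B j})"
    using card_mono[OF _ sub] fin1 fin2 card_Un_le by (meson finite_UnI order_trans)
  also have "\<dots> \<le> (\<Sum>(i, g)\<in>P1. card {b \<in> B i. g + b \<notin> Bt}) + (\<Sum>(i, g, j)\<in>P2. card {b \<in> B i. g + b \<in> B j})"
    unfolding case_prod_unfold using finP1 finP2 by (intro add_mono card_UN_le)
  finally have "real (card (Bt - G)) \<le> real ((\<Sum>(i, g)\<in>P1. card {b \<in> B i. g + b \<notin> Bt}) + (\<Sum>(i, g, j)\<in>P2. card {b \<in> B i. g + b \<in> B j}))"
    by (rule of_nat_mono)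
  then have "c * real (card (Bt - G)) \<le> c * real ((\<Sum>(i, g)\<in>P1. card {b \<in> B i. g + b \<notin> Bt}) + (\<Sum>(i, g, j)\<in>P2. card {b \<in> B i. g + b \<in> B j}))"
    using \<open>0 < c\<close> by (intro mult_left_mono) auto
  also have "\<dots> = (\<Sum>(i, g)\<in>P1. c * real (card {b \<in> B i. g + b \<notin> Bt})) + (\<Sum>(i, g, j)\<in>P2. c * real (card {b \<in> B i. g + b \<in> B j}))"
    by (simp add: sum_distrib_left case_prod_unfold distrib_left)
  also have "\<dots> \<le> (\<Sum>(i, g)\<in>P1. real (1 + k + k\<^sup>2) * \<theta>) + (\<Sum>(i, g, j)\<in>P2. \<theta>)"
  proof (intro add_mono sum_mono; clarify)
    fix i g j assume "(i, g, j) \<in> P2"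
    then show "c * real (card {b \<in> B i. g + b \<in> B j}) \<le> \<theta>"
      using up[of i j g] by (auto simp: P2_def n_def)
  qed (rule U1)
  also have "\<dots> = real (card P1) * (real (1 + k + k\<^sup>2) * \<theta>) + real (card P2) * \<theta>"
    by (simp add: case_prod_unfold)
  also have "\<dots> \<le> real (k * card F1) * (real (1 + k + k\<^sup>2) * \<theta>) + real (k * card F1 * k) * \<theta>"
  proof (cases "k = 0")
    case False
    then show ?thesis using cP1 cP2 \<theta> by (intro add_mono mult_right_mono) (simp_all only: of_nat_le_iff, auto)
  qed (use cP1 cP2 in auto)
  \<comment> \<open>Here \<open>(1 + k + k\<^sup>2) + k = (1 + k)\<^sup>2\<close>.\<close>
  also have "\<dots> = real (k * card F1 * (1 + k)\<^sup>2) * \<theta>"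
    by (simp add: power2_eq_square algebra_simps)
  finally show ?bad .
qed

text \<open>The kernel is \<open>\<eta> w z = \<xi> (- w) (- z)\<close>: exactness controls \<open>\<xi>\<close> along right translations, while the
  group acts on itself by left translations.\<close>

lemma exact_kernel:
  fixes K :: "'g::group_add set"
  assumes "exact_group TYPE('g)" "finite K" "e > 0"
  shows "\<exists>(T :: 'g set) (\<eta> :: 'g \<Rightarrow> 'g \<Rightarrow> real). finite T \<and> (\<forall>w z. 0 \<le> \<eta> w z) \<and>
    (\<forall>w z. \<eta> w z \<noteq> 0 \<longrightarrow> w - z \<in> T) \<and>
    (\<forall>w Z. finite Z \<longrightarrow> (\<lambda>t. - t + w) ` T \<subseteq> Z \<longrightarrow> (\<Sum>z\<in>Z. \<eta> w z) = 1) \<and>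
    (\<forall>w g Z. g \<in> K \<longrightarrow> finite Z \<longrightarrow> (\<Sum>z\<in>Z. \<bar>\<eta> w z - \<eta> (g + w) z\<bar>) \<le> e)"
proof -
  \<comment> \<open>For the arguments \<open>- w\<close> and \<open>- (g + w)\<close> the difference
    tested by exactness is \<open>- g\<close>, so the negatives of \<open>K\<close> are
    supplied.\<close>
  have finK: "finite (uminus ` K)" using assms by simp
  obtain T :: "'g set" and \<xi> where T: "finite T" "\<forall>x z. 0 \<le> \<xi> x z"
    "\<forall>x z. z \<notin> (\<lambda>s. x + s) ` T \<longrightarrow> \<xi> x z = 0"
    "\<forall>x. (\<Sum>z\<in>(\<lambda>s. x + s) ` T. \<xi> x z) = 1"
    "\<forall>x y. - x + y \<in> uminus ` K \<longrightarrow>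
            (\<Sum>z\<in>(\<lambda>s. x + s) ` T \<union> (\<lambda>s. y + s) ` T. \<bar>\<xi> x z - \<xi> y z\<bar>) < e"
    using assms(1)[unfolded exact_group_def, THEN spec, THEN mp, OF finK, THEN spec, THEN mp, OF assms(3)]
    by (elim exE conjE) (rule that)
  define \<eta> where "\<eta> w z = \<xi> (- w) (- z)" for w z
  show ?thesis
  proof (intro exI conjI allI impI)
    show "finite T" "0 \<le> \<eta> w z" for w z using T by (auto simp: \<eta>_def)
    show "w - z \<in> T" if "\<eta> w z \<noteq> 0" for w z
    proof -
      have "- z \<in> (\<lambda>s. - w + s) ` T" using that T(3) unfolding \<eta>_def by blast
      then obtain t where "- z = - w + t" "t \<in> T" by blast
      then have "w + - z = t" by (simp add: add.assoc[symmetric])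
      then show ?thesis using \<open>t \<in> T\<close> by simp
    qed
    show "(\<Sum>z\<in>Z. \<eta> w z) = 1" if "finite Z" "(\<lambda>t. - t + w) ` T \<subseteq> Z" for w Z
    proof -
      have "(\<Sum>z\<in>Z. \<eta> w z) = (\<Sum>z\<in>uminus ` Z. \<xi> (- w) z)"
        by (subst sum.reindex) (auto simp: \<eta>_def inj_on_def)
      also have "\<dots> = (\<Sum>z\<in>(\<lambda>s. - w + s) ` T. \<xi> (- w) z)"
      proof (rule sum.mono_neutral_right)
        show "(\<lambda>s. - w + s) ` T \<subseteq> uminus ` Z"
        proof
          fix z assume "z \<in> (\<lambda>s. - w + s) ` T"
          then obtain s where "s \<in> T" "z = - w + s" by auto
          then have "z = - (- s + w)" "- s + w \<in> Z" using that(2) by (auto simp: minus_add)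
          then show "z \<in> uminus ` Z" by blast
        qed
      qed (use that T(3) in auto)
      finally show ?thesis using T(4) by simp
    qed
    show "(\<Sum>z\<in>Z. \<bar>\<eta> w z - \<eta> (g + w) z\<bar>) \<le> e" if "g \<in> K" "finite Z" for w g Z
    proof -
      let ?D = "(\<lambda>s. - w + s) ` T \<union> (\<lambda>s. - (g + w) + s) ` T"
      let ?h = "\<lambda>z. \<bar>\<xi> (- w) z - \<xi> (- (g + w)) z\<bar>"
      have "(\<Sum>z\<in>Z. \<bar>\<eta> w z - \<eta> (g + w) z\<bar>) = sum ?h (uminus ` Z)"
        by (subst sum.reindex) (auto simp: \<eta>_def inj_on_def)
      also have "\<dots> = sum ?h (uminus ` Z \<inter> ?D)"
        using that T(3) by (intro sum.mono_neutral_right) auto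
      also have "\<dots> \<le> sum ?h ?D" using T(1) by (intro sum_mono2) auto
      also have "\<dots> \<le> e"
      proof -
        have "- (- w) + - (g + w) = - g"
          by (simp only: minus_add minus_minus add.assoc[symmetric] add.right_inverse add_0_left)
        then have "- (- w) + - (g + w) \<in> uminus ` K" using that(1) by (metis imageI)
        then show ?thesis using T(5) less_imp_le by blast
      qed
      finally show ?thesis .
    qed
  qed
qed

context subrelation begin

text \<open>A small \<open>A\<close> with boundary at most \<open>e/8\<close> times its measure
  would have a finite model in the group with too few boundary labels for the expansion that its
  pieces inherit from \<open>Y\<close>. All finite data, and hence \<open>\<delta>\<close>, are
  fixed before \<open>A\<close>.\<close>

lemma no_small_almost_invariant:
  assumes exact: "exact_group TYPE('g)" and infc: "inf_contained_in_group M a"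
    and Y: "Y \<in> sets M" and K: "finite K" and e: "e > 0"
    and iso: "AE x in M. x \<in> Y \<longrightarrow> isoperimetric K Y e x"
  shows "\<exists>\<delta>>0. \<exists>\<eta>>0. \<forall>A\<in>sets M. A \<subseteq> Y \<longrightarrow> 0 < measure M A \<longrightarrow> measure M A \<le> \<delta> \<longrightarrow>
    \<eta> * measure M A < bdry K Y A"
proof -
  \<comment> \<open>Over all labels in \<open>K\<close> the variation of the kernel uses at most a
    quarter of \<open>e\<close>; the added \<open>1\<close> covers empty \<open>K\<close>.\<close>
  define e' where "e' = e / (4 * (1 + real (card K)))"
  have e': "e' > 0" "real (card K) * e' \<le> e / 4"
    using e by (auto simp: e'_def divide_simps)
  obtain T and \<eta> :: "'g \<Rightarrow> 'g \<Rightarrow> real" where T: "finite T" and \<eta>0': "\<forall>w z. 0 \<le> \<eta> w z"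
    and \<eta>T': "\<forall>w z. \<eta> w z \<noteq> 0 \<longrightarrow> w - z \<in> T"
    and \<eta>1': "\<forall>w Z. finite Z \<longrightarrow> (\<lambda>t. - t + w) ` T \<subseteq> Z \<longrightarrow> (\<Sum>z\<in>Z. \<eta> w z) = 1"
    and \<eta>2': "\<forall>w g Z. g \<in> K \<longrightarrow> finite Z \<longrightarrow> (\<Sum>z\<in>Z. \<bar>\<eta> w z - \<eta> (g + w) z\<bar>) \<le> e'"
    using exact_kernel[OF exact K e'(1)] by (elim exE conjE) (rule that)
  note \<eta>0 = \<eta>0'[rule_format] and \<eta>T = \<eta>T'[rule_format] and \<eta>1 = \<eta>1'[rule_format] and \<eta>2 = \<eta>2'[rule_format]
  \<comment> \<open>\<open>F0\<close> holds the differences of two points in one support,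
    \<open>F1\<close> the elements tested on the model. \<open>F\<close> consists of sums because
    comparing patterns at \<open>w\<close> and \<open>x\<close> shifts a tested element by
    \<open>w - x\<close>.\<close>
  define F0 where "F0 = (\<lambda>(s, t). s - t) ` (T \<times> T)"
  define F1 where "F1 = insert 0 (F0 \<union> K)"
  define F where "F = (\<lambda>(g, h). g + h) ` (F1 \<times> F1)"
  have finF1: "finite F1" using T K by (auto simp: F1_def F0_def)
  then have finF: "finite F" by (auto simp: F_def)
  have F1F: "g + h \<in> F" if "g \<in> F1" "h \<in> F1" for g h using that by (force simp: F_def)
  have zF1: "0 \<in> F1" by (simp add: F1_def)
  have F1subF: "F1 \<subseteq> F" using F1F[OF _ zF1] by auto
  \<comment> \<open>All conceivable patterns. Their number \<open>\<kappa>\<close> is independent of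
    \<open>A\<close>, so one threshold can serve every possible number of cells.\<close>
  define Typ where "Typ = Pow F \<times> Pow F"
  have finTyp: "finite Typ" using finF by (simp add: Typ_def)
  define \<kappa> where "\<kappa> = card Typ"
  define D where "D = 1 + real (\<kappa> * card F1 * (1 + \<kappa>)\<^sup>2) + real (\<kappa> + \<kappa>\<^sup>2)"
  \<comment> \<open>Chosen so that the transfer errors cost at most a quarter of the measure of
    \<open>A\<close>, and after multiplication by \<open>card K\<close> at most \<open>e/8\<close>
    of it.\<close>
  define \<theta>0 where "\<theta>0 = min (1/4) (e/8) / ((1 + real (card K)) * D)"
  have D1: "D \<ge> 1" unfolding D_def by simp
  have \<theta>0: "\<theta>0 > 0" using D1 e by (auto simp: \<theta>0_def divide_simps zero_less_mult_iff)
  have \<theta>0_eq: "\<theta>0 * ((1 + real (card K)) * D) = min (1/4) (e/8)"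
    using D1 by (simp add: \<theta>0_def add_nonneg_eq_0_iff)
  have small: "(real (k * card F1 * (1 + k)\<^sup>2) + real (k + k\<^sup>2)) * \<theta>0 \<le> 1/4"
    "real (card K) * ((real (k * card F1 * (1 + k)\<^sup>2) + real (k + k\<^sup>2)) * \<theta>0) \<le> e/8" if "k \<le> \<kappa>" for k
  proof -
    have "k * card F1 * (1 + k)\<^sup>2 \<le> \<kappa> * card F1 * (1 + \<kappa>)\<^sup>2" "k + k\<^sup>2 \<le> \<kappa> + \<kappa>\<^sup>2"
      using that by (intro mult_mono add_mono power_mono; simp)+
    then have "real (k * card F1 * (1 + k)\<^sup>2) \<le> real (\<kappa> * card F1 * (1 + \<kappa>)\<^sup>2)" "real (k + k\<^sup>2) \<le> real (\<kappa> + \<kappa>\<^sup>2)"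
      by (simp_all only: of_nat_le_iff)
    then have "real (k * card F1 * (1 + k)\<^sup>2) + real (k + k\<^sup>2) \<le> D"
      unfolding D_def by linarith
    then have l: "(real (k * card F1 * (1 + k)\<^sup>2) + real (k + k\<^sup>2)) * \<theta>0 \<le> D * \<theta>0"
      using \<theta>0 by (intro mult_right_mono) auto
    have eq: "D * \<theta>0 + real (card K) * (D * \<theta>0) = min (1/4) (e/8)"
      using \<theta>0_eq by (simp add: algebra_simps)
    have nn: "0 \<le> D * \<theta>0" "0 \<le> real (card K) * (D * \<theta>0)" using D1 \<theta>0 by auto
    show "(real (k * card F1 * (1 + k)\<^sup>2) + real (k + k\<^sup>2)) * \<theta>0 \<le> 1/4" using l eq nn by linarith
    have "real (card K) * ((real (k * card F1 * (1 + k)\<^sup>2) + real (k + k\<^sup>2)) * \<theta>0) \<le> real (card K) * (D * \<theta>0)"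
      using l by (intro mult_left_mono) auto
    then show "real (card K) * ((real (k * card F1 * (1 + k)\<^sup>2) + real (k + k\<^sup>2)) * \<theta>0) \<le> e/8"
      using eq nn by linarith
  qed
  \<comment> \<open>Containment compares a set with forward translates, whereas the counts ask where
    a point is sent; the change of viewpoint negates the group element.\<close>
  have finmF1: "finite (uminus ` F1)" using finF1 by simp
  define appr where "appr k A \<longleftrightarrow> (\<exists>c::real. c > 0 \<and> (\<exists>B::nat \<Rightarrow> 'g set.
            \<forall>i<k. \<forall>j<k. \<forall>\<gamma>\<in>uminus ` F1.
              finite (B i \<inter> (\<lambda>b. \<gamma> + b) ` B j) \<and>
              \<bar>measure M (A i \<inter> a \<gamma> ` A j)
                 - c * real (card (B i \<inter> (\<lambda>b. \<gamma> + b) ` B j))\<bar>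
                \<le> \<theta>0 * Max ((\<lambda>l. measure M (A l)) ` {..<k})))" for k :: nat and A :: "nat \<Rightarrow> 'x set"
  have "\<exists>\<delta>>0. \<forall>A. (\<forall>i<k. A i \<in> sets M \<and> 0 < measure M (A i) \<and> measure M (A i) \<le> \<delta>) \<longrightarrow> appr k A" for k
    unfolding appr_def
    by (rule infc[unfolded inf_contained_in_group_def, THEN spec, THEN mp, OF finmF1, THEN spec, THEN spec, THEN mp, OF \<theta>0])
  then obtain d where d: "\<And>k. d k > 0" and d_approx: "\<And>k A.
      \<forall>i<k. A i \<in> sets M \<and> 0 < measure M (A i) \<and> measure M (A i) \<le> d k \<Longrightarrow> appr k A"
    by metis
  define \<delta> where "\<delta> = Min (d ` {..\<kappa>})"
  have \<delta>: "\<delta> > 0" "\<And>k. k \<le> \<kappa> \<Longrightarrow> \<delta> \<le> d k"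
    using d by (auto simp: \<delta>_def)
  have "(e/8) * measure M A < bdry K Y A"
    if A: "A \<in> sets M" and AY: "A \<subseteq> Y" and Apos: "0 < measure M A" and A\<delta>: "measure M A \<le> \<delta>" for A
  proof (rule ccontr)
    assume "\<not> (e/8) * measure M A < bdry K Y A"
    then have bd: "bdry K Y A \<le> (e/8) * measure M A" by simp
    \<comment> \<open>The first component sees the class structure inside \<open>A\<close>, the
      second also the edges leaving \<open>A\<close> within \<open>Y\<close>; their difference on
      \<open>K\<close> is the boundary at \<open>x\<close>.\<close>
    define ty where "ty x = ({g \<in> F. a g x \<in> A \<and> (x, a g x) \<in> S}, {g \<in> F. a g x \<in> Y \<and> (x, a g x) \<in> S})" for x
    define cell where "cell \<tau> = {x \<in> A. ty x = \<tau>}" for \<tau>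
    have sets_ind: "{x. (P x \<longleftrightarrow> b)} \<in> sets M" if "{x. P x} \<in> sets M" for P b
    proof (cases b)
      case False
      then have "{x. (P x \<longleftrightarrow> b)} = space M - {x. P x}" by auto
      then show ?thesis using that by (metis sets.compl_sets)
    qed (use that in simp)
    have sets_cell: "cell \<tau> \<in> sets M" for \<tau>
    proof (cases "\<tau> \<in> Typ")
      case True
      have "cell \<tau> = A \<inter> (\<Inter>g\<in>F. {x. (a g x \<in> A \<and> (x, a g x) \<in> S) \<longleftrightarrow> g \<in> fst \<tau>} \<inter>
          {x. (a g x \<in> Y \<and> (x, a g x) \<in> S) \<longleftrightarrow> g \<in> snd \<tau>})"
        using True unfolding cell_def ty_def Typ_def by (cases \<tau>) auto
      also have "\<dots> \<in> sets M"
      proof (intro sets.Int A sets.finite_INT sets_ind finF)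
        have *: "{x. a g x \<in> B \<and> (x, a g x) \<in> S} \<in> sets M" if "B \<in> sets M" for B g
        proof -
          have "{x. a g x \<in> B \<and> (x, a g x) \<in> S} = a g -` B \<inter> {x. (x, a g x) \<in> S}" by auto
          then show ?thesis using that S_meas by (auto intro: sets_act_vimage sets_rel)
        qed
        show "{x. a g x \<in> A \<and> (x, a g x) \<in> S} \<in> sets M" "{x. a g x \<in> Y \<and> (x, a g x) \<in> S} \<in> sets M" for g
          using A Y * by auto
        show "F \<noteq> {}" using F1subF zF1 by auto
      qed
      finally show ?thesis .
    next
      case False
      then have "cell \<tau> = {}" by (auto simp: cell_def ty_def Typ_def)
      then show ?thesis by simp
    qed
    \<comment> \<open>Containment is available only for sets of positive measure, so null cells are
      dropped. What they cover is null, also after translation.\<close>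
    define N where "N = {\<tau> \<in> Typ. 0 < measure M (cell \<tau>)}"
    have finN: "finite N" using finTyp by (simp add: N_def)
    define k where "k = card N"
    have k\<kappa>: "k \<le> \<kappa>" unfolding k_def \<kappa>_def using finTyp by (intro card_mono) (auto simp: N_def)
    obtain idx where idx: "bij_betw idx {..<k} N"
      using ex_bij_betw_nat_finite[OF finN] unfolding k_def atLeast0LessThan by blast
    have idxN: "idx i \<in> N" if "i < k" for i using idx that by (auto simp: bij_betw_def)
    have "ty x \<in> Typ" for x by (auto simp: ty_def Typ_def)
    then have A_UN: "A = (\<Union>\<tau>\<in>Typ. cell \<tau>)"
      unfolding cell_def by blast
    have cell_disj: "disjoint_family_on cell J" for J
      by (auto simp: disjoint_family_on_def cell_def)
    have sum_N: "(\<Sum>\<tau>\<in>N. measure M (cell \<tau>)) = measure M A"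
    proof -
      have "measure M A = (\<Sum>\<tau>\<in>Typ. measure M (cell \<tau>))"
        unfolding A_UN using finTyp sets_cell cell_disj by (intro finite_measure_finite_Union) auto
      also have "\<dots> = (\<Sum>\<tau>\<in>N. measure M (cell \<tau>))"
        using finTyp by (intro sum.mono_neutral_right) (auto simp: N_def not_less measure_le_0_iff)
      finally show ?thesis by simp
    qed
    define Z where "Z = A - (\<Union>\<tau>\<in>N. cell \<tau>)"
    have Z_sets: "Z \<in> sets M" unfolding Z_def using A finN sets_cell by (intro sets.Diff sets.finite_UN)
    have Z_null: "measure M Z = 0"
    proof -
      have "measure M Z = measure M A - measure M (\<Union>\<tau>\<in>N. cell \<tau>)"
        unfolding Z_def using A finN sets_cell by (intro finite_measure_Diff) (auto simp: cell_def)
      also have "measure M (\<Union>\<tau>\<in>N. cell \<tau>) = measure M A"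
        unfolding sum_N[symmetric] using finN sets_cell cell_disj by (intro finite_measure_finite_Union) auto
      finally show ?thesis by simp
    qed
    define Ac where "Ac i = cell (idx i)" for i
    have Ac_sets: "Ac i \<in> sets M" for i by (simp add: Ac_def sets_cell)
    have Ac_pos: "0 < measure M (Ac i)" if "i < k" for i using idxN[OF that] by (auto simp: Ac_def N_def)
    have Ac_le: "measure M (Ac i) \<le> measure M A" for i
      using A Ac_sets by (intro finite_measure_mono) (auto simp: Ac_def cell_def)
    have sumA: "(\<Sum>i<k. measure M (Ac i)) = measure M A"
      unfolding sum_N[symmetric] Ac_def using idx by (rule sum.reindex_bij_betw)
    have kpos: "k \<noteq> 0" using sumA Apos by (intro notI) simp
    define m where "m i g j = measure M {x \<in> Ac i. a g x \<in> Ac j}" for i g j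
    have m_sets: "{x \<in> Ac i. a g x \<in> Ac j} \<in> sets M" for i g j
    proof -
      have "{x \<in> Ac i. a g x \<in> Ac j} = Ac i \<inter> a g -` Ac j" by auto
      then show ?thesis using Ac_sets by (auto intro: sets_act_vimage)
    qed
    \<comment> \<open>The measure of all of \<open>A\<close> dominates the maximum over the cells,
      giving one error bound relative to \<open>A\<close>.\<close>
    define \<theta> where "\<theta> = \<theta>0 * measure M A"
    have "\<forall>i<k. Ac i \<in> sets M \<and> 0 < measure M (Ac i) \<and> measure M (Ac i) \<le> d k"
      using Ac_sets Ac_pos Ac_le A\<delta> \<delta>(2)[OF k\<kappa>] by (meson order_trans)
    from d_approx[OF this, unfolded appr_def] obtain c B where c: "c > 0" and
      B: "\<forall>i<k. \<forall>j<k. \<forall>\<gamma>\<in>uminus ` F1.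
              finite (B i \<inter> (\<lambda>b. \<gamma> + b) ` B j) \<and>
              \<bar>measure M (Ac i \<inter> a \<gamma> ` Ac j)
                 - c * real (card (B i \<inter> (\<lambda>b. \<gamma> + b) ` B j))\<bar>
                \<le> \<theta>0 * Max ((\<lambda>l. measure M (Ac l)) ` {..<k})" by blast
    have finB: "finite (B i)" if "i < k" for i
    proof -
      have "0 \<in> uminus ` F1" using zF1 by (metis imageI minus_zero)
      from B[rule_format, OF that that this] have "finite (B i \<inter> (+) 0 ` B i)" by (rule conjunct1)
      then show ?thesis by simp
    qed
    have approx: "\<bar>m i g j - c * real (card {b \<in> B i. g + b \<in> B j})\<bar> \<le> \<theta>" if "i < k" "j < k" "g \<in> F1" for i g j
    proof -
      have 1: "Ac i \<inter> a (- g) ` Ac j = {x \<in> Ac i. a g x \<in> Ac j}"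
        unfolding act_image by auto
      have 2: "B i \<inter> (\<lambda>b. - g + b) ` B j = {b \<in> B i. g + b \<in> B j}"
      proof (intro equalityI subsetI)
        fix b assume "b \<in> {b \<in> B i. g + b \<in> B j}"
        moreover have "b = - g + (g + b)" by (simp add: add.assoc[symmetric])
        ultimately show "b \<in> B i \<inter> (\<lambda>b. - g + b) ` B j" by blast
      qed (auto simp: add.assoc[symmetric])
      have "Max ((\<lambda>l. measure M (Ac l)) ` {..<k}) \<le> measure M A"
        using kpos Ac_le by (intro Max.boundedI) auto
      then have "\<theta>0 * Max ((\<lambda>l. measure M (Ac l)) ` {..<k}) \<le> \<theta>"
        unfolding \<theta>_def using \<theta>0 by (intro mult_left_mono) auto
      moreover have "- g \<in> uminus ` F1" using that by blast
      ultimately show ?thesis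
        using B[rule_format, OF that(1,2), of "- g"] unfolding 1 2 m_def by linarith
    qed
    have m00: "m i 0 i = measure M (Ac i)" for i by (simp add: m_def act_zero)
    define R where "R i = fst (idx i)" for i
    define Q where "Q i = snd (idx i)" for i
    have Rx: "R i = {g \<in> F. a g x \<in> A \<and> (x, a g x) \<in> S}"
      and Qx: "Q i = {g \<in> F. a g x \<in> Y \<and> (x, a g x) \<in> S}" and AcA: "x \<in> A" if "x \<in> Ac i" for x i
    proof -
      have "idx i = ty x" and "x \<in> A" using that by (auto simp: Ac_def cell_def)
      then show "R i = {g \<in> F. a g x \<in> A \<and> (x, a g x) \<in> S}"
        "Q i = {g \<in> F. a g x \<in> Y \<and> (x, a g x) \<in> S}" "x \<in> A"
        by (simp_all add: R_def Q_def ty_def)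
    qed
    have mR: "m i 0 i \<le> (\<Sum>j<k. m i g j)" if "i < k" "g \<in> F1" "g \<in> R i" for i g
    proof -
      \<comment> \<open>A label in the pattern returns the point to \<open>A\<close>, hence to one
        of the retained cells or to the null remainder.\<close>
      have "Ac i \<subseteq> (\<Union>j<k. {x \<in> Ac i. a g x \<in> Ac j}) \<union> a g -` Z"
      proof
        fix x assume x: "x \<in> Ac i"
        then have "a g x \<in> A" using Rx[OF x] that by auto
        show "x \<in> (\<Union>j<k. {x \<in> Ac i. a g x \<in> Ac j}) \<union> a g -` Z"
        proof (cases "a g x \<in> Z")
          case False
          then obtain \<tau> where "\<tau> \<in> N" "a g x \<in> cell \<tau>" using \<open>a g x \<in> A\<close> by (auto simp: Z_def)
          moreover from this obtain j where "j < k" "\<tau> = idx j" using idx by (auto simp: bij_betw_def)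
          ultimately show ?thesis using x by (auto simp: Ac_def)
        qed simp
      qed
      then have "measure M (Ac i) \<le> measure M ((\<Union>j<k. {x \<in> Ac i. a g x \<in> Ac j}) \<union> a g -` Z)"
        using m_sets Z_sets by (intro finite_measure_mono) (auto intro: sets_act_vimage)
      also have "\<dots> \<le> measure M (\<Union>j<k. {x \<in> Ac i. a g x \<in> Ac j}) + measure M (a g -` Z)"
        using m_sets Z_sets by (intro measure_Un_le) (auto intro: sets_act_vimage)
      also have "\<dots> \<le> (\<Sum>j<k. m i g j)"
        using m_sets measure_act_vimage[OF Z_sets] Z_null unfolding m_def
        by (simp add: measure_UNION_le)
      finally show ?thesis by (simp add: m00)
    qed
    have idx_inj: "i = j" if "i < k" "j < k" "idx i = idx j" for i j
      using idx that by (auto simp: bij_betw_def inj_on_def)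
    have m0: "m i 0 j = 0" if "i < k" "j < k" "i \<noteq> j" for i j
    proof -
      have "{x \<in> Ac i. a 0 x \<in> Ac j} = {}" using that idx_inj by (auto simp: act_zero Ac_def cell_def)
      then show ?thesis unfolding m_def by (simp only: measure_empty)
    qed
    define Bt where "Bt = (\<Union>i<k. B i)"
    define G where "G = {b \<in> Bt. \<forall>i<k. \<forall>g\<in>F1. b \<in> B i \<longrightarrow>
       (g \<in> R i \<longrightarrow> g + b \<in> Bt) \<and> (\<forall>j<k. g + b \<in> B j \<longrightarrow> 0 < m i g j)}"
    have m_nn: "0 \<le> m i g j" for i g j by (simp add: m_def)
    note bounds = card_coincidence_bounds[where m = m and R = R, OF finF1 zF1 finB c approx mR m0 m_nn,
        folded Bt_def, folded G_def]
    have bad: "c * real (card (Bt - G)) \<le> real (k * card F1 * (1 + k)\<^sup>2) * \<theta>" using bounds(1) .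
    have low: "measure M A - real (k + k\<^sup>2) * \<theta> \<le> c * real (card Bt)" using bounds(2) by (simp add: m00 sumA)
    have finBt: "finite Bt" using finB by (auto simp: Bt_def)
    have GBt: "G \<subseteq> Bt" by (auto simp: G_def)
    have finG: "finite G" using GBt finBt by (rule finite_subset)
    define \<tau> where "\<tau> w = (SOME i. i < k \<and> w \<in> B i)" for w
    have \<tau>: "\<tau> w < k" "w \<in> B (\<tau> w)" if "w \<in> G" for w
    proof -
      have "\<exists>i. i < k \<and> w \<in> B i" using that GBt by (auto simp: Bt_def)
      from someI_ex[OF this] show "\<tau> w < k" "w \<in> B (\<tau> w)" by (auto simp: \<tau>_def)
    qed
    \<comment> \<open>The cell has positive measure, so it contains a point outside the null set
      where expansion fails. This point realises the pattern of \<open>w\<close> in the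
      space.\<close>
    define pt where "pt w = (SOME x. x \<in> Ac (\<tau> w) \<and> isoperimetric K Y e x)" for w
    have pt: "pt w \<in> Ac (\<tau> w)" "isoperimetric K Y e (pt w)" if "w \<in> G" for w
    proof -
      have "\<exists>x. x \<in> Ac (\<tau> w) \<and> isoperimetric K Y e x"
      proof (rule ccontr)
        assume "\<nexists>x. x \<in> Ac (\<tau> w) \<and> isoperimetric K Y e x"
        then have "AE x in M. x \<notin> Ac (\<tau> w)" using iso AcA AY by (auto elim!: eventually_mono)
        then have "measure M (Ac (\<tau> w)) = 0"
          using Ac_sets by (simp add: AE_iff_null_sets[symmetric] measure_eq_0_null_sets)
        then show False using Ac_pos[OF \<tau>(1)[OF that]] by simp
      qed
      from someI_ex[OF this] show "pt w \<in> Ac (\<tau> w)" "isoperimetric K Y e (pt w)" by (auto simp: pt_def)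
    qed
    \<comment> \<open>Good points have no coincidence of mass zero, so a tested translation between
      two of them also occurs between actual points of their cells. Comparing patterns there gives
      the compatibility of \<open>R\<close> and \<open>Q\<close>.\<close>
    have link: "\<exists>p. p \<in> Ac (\<tau> x) \<and> a g p \<in> Ac (\<tau> w)" if "x \<in> G" "w \<in> G" "g \<in> F1" "w = g + x" for x w g
    proof -
      have "0 < m (\<tau> x) g (\<tau> w)" using that \<tau>[OF that(1)] \<tau>[OF that(2)] by (auto simp: G_def)
      then have "{p \<in> Ac (\<tau> x). a g p \<in> Ac (\<tau> w)} \<noteq> {}" unfolding m_def by (metis measure_empty less_irrefl)
      then show ?thesis by blast
    qed
    define Zs where "Zs = (\<Union>w\<in>G. (\<lambda>t. - t + w) ` T)"
    have finZs: "finite Zs" using finG T by (auto simp: Zs_def)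
    have core: "e * real (card G) \<le> real (card K) * e' * real (card G) + real (card K) * real (card (Bt - G))
           + (\<Sum>w\<in>G. real (card {g \<in> K. g \<in> Q (\<tau> w) - R (\<tau> w)}))"
    proof (rule isoperimetric_core[where pt = pt and Y = Y and \<eta> = \<eta> and Zs = Zs and ?F0.0 = "F0 \<union> {0}"
          and R = "\<lambda>w. R (\<tau> w)" and Q = "\<lambda>w. Q (\<tau> w)"])
      show "v - w \<in> F0 \<union> {0}" if "\<eta> w z \<noteq> 0" "\<eta> v z \<noteq> 0" for w v z
      proof -
        have "v - w = (v - z) - (w - z)" by (simp add: diff_diff_eq2)
        then show ?thesis using \<eta>T[OF that(1)] \<eta>T[OF that(2)] by (force simp: F0_def)
      qed
      show "0 \<in> R (\<tau> x)" if "x \<in> G" for x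
        using Rx[OF pt(1)[OF that]] AcA[OF pt(1)[OF that]] F1subF zF1 S_refl by (auto simp: act_zero)
      show "R (\<tau> x) \<subseteq> Q (\<tau> x)" if "x \<in> G" for x
        using Rx[OF pt(1)[OF that]] Qx[OF pt(1)[OF that]] AY by auto
      have rel: "(g \<in> R (\<tau> w) \<longleftrightarrow> g + (w - x) \<in> R (\<tau> x)) \<and> (g \<in> Q (\<tau> w) \<longleftrightarrow> g + (w - x) \<in> Q (\<tau> x))"
        if "x \<in> G" "w \<in> G" "w - x \<in> R (\<tau> x)" "w - x \<in> F0 \<union> {0}" "g \<in> F1" for x w g
      proof -
        have wx: "w - x \<in> F1" using that by (auto simp: F1_def)
        have "\<exists>p. p \<in> Ac (\<tau> x) \<and> a (w - x) p \<in> Ac (\<tau> w)" using link[OF that(1,2) wx] by simp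
        then obtain p where p: "p \<in> Ac (\<tau> x)" "a (w - x) p \<in> Ac (\<tau> w)" by blast
        have S1: "(p, a (w - x) p) \<in> S" using Rx[OF p(1)] that(3) by auto
        have S2: "(a (w - x) p, y) \<in> S \<longleftrightarrow> (p, y) \<in> S" for y
          using S1 S_trans S_sym by blast
        have gF: "g \<in> F" "g + (w - x) \<in> F" using F1subF F1F[OF that(5) wx] that(5) by auto
        show ?thesis
          unfolding Rx[OF p(1)] Rx[OF p(2)] Qx[OF p(1)] Qx[OF p(2)] using gF S2 by (simp add: act_add)
      qed
      show "g \<in> R (\<tau> w) \<longleftrightarrow> g + (w - x) \<in> R (\<tau> x)"
        if "x \<in> G" "w \<in> G" "w - x \<in> R (\<tau> x)" "w - x \<in> F0 \<union> {0}" "g \<in> F0 \<union> {0} \<union> K" for x w g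
        using rel[OF that(1-4)] that(5) by (auto simp: F1_def)
      show "g \<in> Q (\<tau> w)"
        if "x \<in> G" "w \<in> G" "w - x \<in> R (\<tau> x)" "w - x \<in> F0 \<union> {0}" "g \<in> K" "g + (w - x) \<in> Q (\<tau> x)" for x w g
        using rel[OF that(1-4)] that(5,6) by (auto simp: F1_def)
      show "a g (pt x) \<in> Y \<and> (pt x, a g (pt x)) \<in> S" if "x \<in> G" "g \<in> F0 \<union> {0}" "g \<in> Q (\<tau> x)" for x g
        using Qx[OF pt(1)[OF that(1)]] that(3) by auto
      show "g + h \<in> Q (\<tau> x)" if "x \<in> G" "g \<in> K" "h \<in> F0 \<union> {0}" "a (g + h) (pt x) \<in> Y"
        "(pt x, a (g + h) (pt x)) \<in> S" for x g h
      proof -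
        have "g + h \<in> F" using that(2,3) by (intro F1F) (auto simp: F1_def)
        then show ?thesis using Qx[OF pt(1)[OF that(1)]] that(4,5) by auto
      qed
      show "g + x \<in> Bt" if "x \<in> G" "g \<in> K" "g \<in> R (\<tau> x)" for x g
        using that \<tau>[OF that(1)] by (auto simp: G_def F1_def)
      show "(\<Sum>z\<in>Zs. \<eta> w z) = 1" if "w \<in> G" for w
        using that by (intro \<eta>1 finZs) (auto simp: Zs_def)
      show "(\<Sum>z\<in>Zs. \<bar>\<eta> w z - \<eta> (g + w) z\<bar>) \<le> e'" if "g \<in> K" for w g
        using that finZs by (rule \<eta>2)
    qed (use finG K finZs finBt e' \<eta>0 pt in auto)
    define E where "E i = {g \<in> K. g \<in> Q i - R i}" for i
    \<comment> \<open>Each label in \<open>E i\<close> makes the whole cell \<open>i\<close> part of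
      the boundary of \<open>A\<close>. Replacing the measure of the cell by the scaled size of
      \<open>B i\<close> costs one error per label.\<close>
    have edge: "c * (\<Sum>w\<in>G. real (card (E (\<tau> w)))) \<le> bdry K Y A + real (card K) * (real k * \<theta>)"
    proof -
      have "(\<Sum>w\<in>G. real (card (E (\<tau> w)))) = (\<Sum>i\<in>\<tau> ` G. \<Sum>w | w \<in> G \<and> \<tau> w = i. real (card (E (\<tau> w))))"
        by (rule sum.image_gen[OF finG])
      also have "\<dots> = (\<Sum>i\<in>\<tau> ` G. real (card {w \<in> G. \<tau> w = i}) * real (card (E i)))"
        by simp
      also have "\<dots> \<le> (\<Sum>i\<in>\<tau> ` G. real (card (B i)) * real (card (E i)))"
      proof (intro sum_mono mult_right_mono)
        fix i assume "i \<in> \<tau> ` G"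
        then have "i < k" using \<tau> by auto
        then show "real (card {w \<in> G. \<tau> w = i}) \<le> real (card (B i))"
          unfolding of_nat_le_iff using finB \<tau>(2) by (intro card_mono) auto
      qed simp
      also have "\<dots> \<le> (\<Sum>i<k. real (card (B i)) * real (card (E i)))"
        using \<tau> by (intro sum_mono2) auto
      finally have "c * (\<Sum>w\<in>G. real (card (E (\<tau> w)))) \<le> c * (\<Sum>i<k. real (card (B i)) * real (card (E i)))"
        using c by (intro mult_left_mono) auto
      also have "\<dots> = (\<Sum>i<k. (c * real (card (B i))) * real (card (E i)))"
        by (simp add: sum_distrib_left mult.assoc)
      also have "\<dots> \<le> (\<Sum>i<k. measure M (Ac i) * real (card (E i)) + real (card K) * \<theta>)"
      proof (rule sum_mono)
        fix i assume "i \<in> {..<k}"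
        then have "c * real (card (B i)) \<le> measure M (Ac i) + \<theta>"
          using approx[of i i 0] zF1 by (auto simp: m00)
        then have "(c * real (card (B i))) * real (card (E i)) \<le> (measure M (Ac i) + \<theta>) * real (card (E i))"
          by (intro mult_right_mono) auto
        also have "\<dots> = measure M (Ac i) * real (card (E i)) + \<theta> * real (card (E i))"
          by (simp add: algebra_simps)
        also have "\<theta> * real (card (E i)) \<le> \<theta> * real (card K)"
          using \<theta>0 K by (intro mult_left_mono) (auto simp: \<theta>_def E_def intro!: card_mono)
        finally show "(c * real (card (B i))) * real (card (E i)) \<le> measure M (Ac i) * real (card (E i)) + real (card K) * \<theta>"
          by (simp add: algebra_simps)
      qed
      also have "\<dots> = (\<Sum>i<k. measure M (Ac i) * real (card (E i))) + real (card K) * (real k * \<theta>)"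
        by (simp add: sum.distrib)
      also have "(\<Sum>i<k. measure M (Ac i) * real (card (E i))) = (\<Sum>i<k. \<Sum>g\<in>K. if g \<in> E i then measure M (Ac i) else 0)"
        using K by (intro sum.cong) (auto simp: sum.If_cases E_def Int_def)
      also have "\<dots> = (\<Sum>g\<in>K. \<Sum>i<k. if g \<in> E i then measure M (Ac i) else 0)" by (rule sum.swap)
      also have "\<dots> \<le> bdry K Y A"
        unfolding bdry_def
      proof (rule sum_mono)
        fix g assume g: "g \<in> K"
        let ?X = "{x \<in> A. a g x \<in> Y - A \<and> (x, a g x) \<in> S}"
        have X: "?X \<in> sets M" using A Y S_meas by (intro sets_edge sets.Diff)
        have "(\<Sum>i<k. if g \<in> E i then measure M (Ac i) else 0) = (\<Sum>i | i < k \<and> g \<in> E i. measure M (Ac i))"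
          by (simp add: sum.If_cases Int_def)
        also have "\<dots> = measure M (\<Union>i\<in>{i. i < k \<and> g \<in> E i}. Ac i)"
          using Ac_sets idx_inj
          by (intro finite_measure_finite_Union[symmetric]) (auto simp: disjoint_family_on_def Ac_def cell_def)
        also have "\<dots> \<le> measure M ?X"
        proof (intro finite_measure_mono X subsetI)
          fix x assume "x \<in> (\<Union>i\<in>{i. i < k \<and> g \<in> E i}. Ac i)"
          then obtain i where i: "g \<in> E i" "x \<in> Ac i" by auto
          have "g \<in> F" using g F1subF by (auto simp: F1_def)
          then show "x \<in> ?X" using i Rx[OF i(2)] Qx[OF i(2)] AcA[OF i(2)] by (auto simp: E_def)
        qed
        finally show "(\<Sum>i<k. if g \<in> E i then measure M (Ac i) else 0) \<le> measure M ?X" .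
      qed
      finally show ?thesis by simp
    qed
    define \<mu> where "\<mu> = measure M A"
    \<comment> \<open>The scaled size \<open>s\<close> of the model is at least
      \<open>3/4 * \<mu>\<close>, while expansion yields
      \<open>3/4 * (e * s) \<le> e/4 * \<mu>\<close>; together these say
      \<open>9/16 \<le> 1/4\<close>.\<close>
    define s where "s = c * real (card G)"
    have "card Bt = card G + card (Bt - G)"
      using finBt GBt finG by (simp add: card_Diff_subset card_mono)
    then have "c * real (card Bt) = s + c * real (card (Bt - G))" by (simp add: s_def algebra_simps)
    then have s_low: "\<mu> - (real (k * card F1 * (1 + k)\<^sup>2) + real (k + k\<^sup>2)) * \<theta> \<le> s"
      using low bad by (simp add: \<mu>_def algebra_simps)
    have "(real (k * card F1 * (1 + k)\<^sup>2) + real (k + k\<^sup>2)) * \<theta> \<le> 1/4 * \<mu>"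
      using mult_right_mono[OF small(1)[OF k\<kappa>], of \<mu>] by (simp add: \<theta>_def \<mu>_def mult.assoc)
    then have s34: "3/4 * \<mu> \<le> s" using s_low by linarith
    have "c * (e * real (card G)) \<le> c * (real (card K) * e' * real (card G) + real (card K) * real (card (Bt - G))
           + (\<Sum>w\<in>G. real (card (E (\<tau> w)))))"
      using core c unfolding E_def by (intro mult_left_mono) auto
    then have "e * s \<le> real (card K) * e' * s + real (card K) * (c * real (card (Bt - G)))
           + c * (\<Sum>w\<in>G. real (card (E (\<tau> w))))"
      by (simp add: s_def algebra_simps)
    also have "real (card K) * e' * s \<le> e/4 * s"
      using e' c by (intro mult_right_mono) (auto simp: s_def)
    also have "real (card K) * (c * real (card (Bt - G))) \<le> real (card K) * (real (k * card F1 * (1 + k)\<^sup>2) * \<theta>)"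
      using bad by (intro mult_left_mono) auto
    also have "c * (\<Sum>w\<in>G. real (card (E (\<tau> w)))) \<le> (e/8) * \<mu> + real (card K) * (real (k + k\<^sup>2) * \<theta>)"
    proof -
      have "real k * \<theta> \<le> real (k + k\<^sup>2) * \<theta>" using \<theta>0 by (intro mult_right_mono) (auto simp: \<theta>_def)
      then have "real (card K) * (real k * \<theta>) \<le> real (card K) * (real (k + k\<^sup>2) * \<theta>)"
        by (intro mult_left_mono) auto
      then show ?thesis using edge bd by (simp add: \<mu>_def)
    qed
    finally have "e * s \<le> e/4 * s + real (card K) * ((real (k * card F1 * (1 + k)\<^sup>2) + real (k + k\<^sup>2)) * \<theta>) + (e/8) * \<mu>"
      by (simp add: algebra_simps)
    moreover have "real (card K) * ((real (k * card F1 * (1 + k)\<^sup>2) + real (k + k\<^sup>2)) * \<theta>) \<le> e/8 * \<mu>"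
      using mult_right_mono[OF small(2)[OF k\<kappa>], of \<mu>] by (simp add: \<theta>_def \<mu>_def mult.assoc)
    ultimately have "3/4 * (e * s) \<le> e/4 * \<mu>" by simp
    moreover have "e * (3/4 * \<mu>) \<le> e * s" using s34 e by (intro mult_left_mono) auto
    moreover have "0 < e * \<mu>" using e Apos by (simp add: \<mu>_def)
    ultimately show False by (simp add: algebra_simps)
  qed
  then show ?thesis using \<delta>(1) e by (intro exI[of _ \<delta>] conjI exI[of _ "e/8"]) auto
qed

end

section \<open>Small almost invariant sets\<close>

text \<open>Serves to cut a measurable set into countably many parts on which finitely many group
  elements either fix a point or move it out of a given open set.\<close>

lemma separating_open_sequence:
  obtains U :: "nat \<Rightarrow> 'a::{second_countable_topology, t1_space} set"
  where "\<And>i. open (U i)" "\<And>x P. finite P \<Longrightarrow> x \<notin> P \<Longrightarrow> \<exists>i. x \<in> U i \<and> U i \<inter> P = {}"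
proof -
  obtain B :: "'a set set" where B: "countable B" "topological_basis B"
    using ex_countable_basis by blast
  have ne: "B \<noteq> {}"
    using topological_basisE[OF B(2) open_UNIV UNIV_I] by blast
  show ?thesis
  proof
    show "open (from_nat_into B i)" for i
      using topological_basis_open[OF B(2)] from_nat_into[OF ne] by blast
    show "\<exists>i. x \<in> from_nat_into B i \<and> from_nat_into B i \<inter> P = {}" if "finite P" "x \<notin> P" for x P
    proof -
      have "open (- P)" "x \<in> - P" using finite_imp_closed[OF that(1)] that(2) by (simp_all add: open_Compl)
      then obtain V where "V \<in> B" "x \<in> V" "V \<subseteq> - P"
        using topological_basisE[OF B(2), of "- P" x] by blast
      moreover obtain i where "from_nat_into B i = V"
        using from_nat_into_surj[OF B(1) \<open>V \<in> B\<close>] by blast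
      ultimately show ?thesis by blast
    qed
  qed
qed

text \<open>Limits how many nearly disjoint sets of a given measure fit into the space.\<close>

lemma (in finite_measure) sum_measure_le_measure_UN:
  assumes "finite J" "\<And>j. j \<in> J \<Longrightarrow> U j \<in> sets M"
  shows "(\<Sum>j\<in>J. measure M (U j)) \<le> measure M (\<Union>j\<in>J. U j) + (\<Sum>j\<in>J. \<Sum>j'\<in>J - {j}. measure M (U j \<inter> U j'))"
  using assms
proof (induction J)
  case (insert x J)
  have s: "U x \<in> sets M" "(\<Union>j\<in>J. U j) \<in> sets M" using insert by auto
  have IH: "(\<Sum>j\<in>J. measure M (U j)) \<le> measure M (\<Union>j\<in>J. U j) + (\<Sum>j\<in>J. \<Sum>j'\<in>J - {j}. measure M (U j \<inter> U j'))"
    using insert by simp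
  have "measure M (U x \<union> (\<Union>j\<in>J. U j)) = measure M (U x) + measure M ((\<Union>j\<in>J. U j) - U x)"
    using s by (rule finite_measure_Union')
  moreover have "measure M ((\<Union>j\<in>J. U j) - U x) = measure M (\<Union>j\<in>J. U j) - measure M ((\<Union>j\<in>J. U j) \<inter> U x)"
    using s by (intro finite_measure_Diff')
  ultimately have 1: "measure M (U x) + measure M (\<Union>j\<in>J. U j) = measure M (\<Union>j\<in>insert x J. U j) + measure M (U x \<inter> (\<Union>j\<in>J. U j))"
    by (simp add: Int_commute)
  have 2: "measure M (U x \<inter> (\<Union>j\<in>J. U j)) \<le> (\<Sum>j'\<in>J. measure M (U x \<inter> U j'))"
    unfolding Int_UN_distrib using insert by (intro measure_UNION_le) auto
  have 3: "(\<Sum>j\<in>J. \<Sum>j'\<in>J - {j}. measure M (U j \<inter> U j')) \<le> (\<Sum>j\<in>J. \<Sum>j'\<in>insert x J - {j}. measure M (U j \<inter> U j'))"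
    using insert(1) by (intro sum_mono sum_mono2) auto
  have 4: "insert x J - {x} = J" using insert by auto
  show ?case using IH 1 2 3 insert(1,2) by (simp add: 4)
qed simp

text \<open>Completeness of the measure algebra, with the limit realised as the lower limit of a
  fast subsequence. This makes \<open>Z\<close> an actual subset of the union, not only up to a null
  set.\<close>

lemma (in finite_measure) Cauchy_sets_limit:
  fixes A :: "nat \<Rightarrow> 'a set"
  assumes A: "\<And>n. A n \<in> sets M"
    and Cauchy: "\<And>e. e > 0 \<Longrightarrow> \<exists>N. \<forall>n\<ge>N. \<forall>m\<ge>N. measure M (A n - A m) \<le> e"
  obtains Z r where "Z \<in> sets M" "\<And>k. k \<le> r k" "(\<lambda>k. measure M (A (r k) - Z)) \<longlonglongrightarrow> 0"
    "(\<lambda>k. measure M (Z - A (r k))) \<longlonglongrightarrow> 0" "Z \<subseteq> (\<Union>n. A n)"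
proof -
  have "\<exists>N. \<forall>n\<ge>N. \<forall>m\<ge>N. measure M (A n - A m) \<le> (1/2) ^ k" for k :: nat
    by (rule Cauchy) simp
  then obtain N where N: "\<And>k n m. n \<ge> N k \<Longrightarrow> m \<ge> N k \<Longrightarrow> measure M (A n - A m) \<le> (1/2) ^ k"
    by metis
  \<comment> \<open>The maximum over earlier thresholds makes the estimate at \<open>k\<close> valid
    for both \<open>r k\<close> and \<open>r (Suc k)\<close>; adding \<open>k\<close> forces the
    indices to infinity.\<close>
  define r where "r k = Max (N ` {..k}) + k" for k
  have rN: "N j \<le> r k" if "j \<le> k" for j k
    using that by (auto simp: r_def intro!: trans_le_add1 Max_ge)
  define B where "B k = A (r k)" for k
  have B[measurable]: "B k \<in> sets M" for k by (simp add: B_def A)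
  have step: "measure M (B k - B (Suc k)) \<le> (1/2) ^ k" "measure M (B (Suc k) - B k) \<le> (1/2) ^ k" for k
    unfolding B_def by (intro N rN; simp)+
  define Z where "Z = (\<Union>j. \<Inter>k\<in>{j..}. B k)"
  have Z: "Z \<in> sets M" unfolding Z_def by measurable
  have tail: "measure M (\<Union>i. C (j + i)) \<le> 2 * (1/2) ^ j"
    if C: "\<And>k. C k \<in> sets M" "\<And>k. measure M (C k) \<le> (1/2) ^ k" for C j
  proof -
    have geo: "(\<lambda>i. (1/2::real) ^ (j + i)) sums ((1/2) ^ j * 2)"
      using sums_mult[OF geometric_sums[of "1/2::real"], of "(1/2) ^ j"] by (simp add: power_add)
    have le: "norm (measure M (C (j + i))) \<le> (1/2) ^ (j + i)" for i using C by simp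
    have sm: "summable (\<lambda>i. measure M (C (j + i)))"
      by (rule summable_comparison_test'[OF sums_summable[OF geo] le])
    have "measure M (\<Union>i. C (j + i)) \<le> (\<Sum>i. measure M (C (j + i)))"
      using C sm by (intro finite_measure_subadditive_countably) auto
    also have "\<dots> \<le> (\<Sum>i. (1/2) ^ (j + i))"
      using C by (intro suminf_le sm sums_summable[OF geo]) auto
    also have "\<dots> = 2 * (1/2) ^ j" using sums_unique[OF geo] by simp
    finally show ?thesis .
  qed
  have b1: "measure M (B j - Z) \<le> 2 * (1/2) ^ j" for j
  proof -
    have "B j - Z \<subseteq> (\<Union>i. B (j + i) - B (Suc (j + i)))"
    proof
      fix x assume x: "x \<in> B j - Z"
      show "x \<in> (\<Union>i. B (j + i) - B (Suc (j + i)))"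
      proof (rule ccontr)
        assume n: "x \<notin> (\<Union>i. B (j + i) - B (Suc (j + i)))"
        have "x \<in> B (j + i)" for i
        proof (induction i)
          case (Suc i) then show ?case using n by auto
        qed (use x in simp)
        then have "\<forall>k\<in>{j..}. x \<in> B k" by (auto simp: le_iff_add)
        then have "x \<in> Z" unfolding Z_def by blast
        then show False using x by simp
      qed
    qed
    then have "measure M (B j - Z) \<le> measure M (\<Union>i. B (j + i) - B (Suc (j + i)))"
      by (intro finite_measure_mono) auto
    also have "\<dots> \<le> 2 * (1/2) ^ j"
      using tail[of "\<lambda>k. B k - B (Suc k)" j] step by auto
    finally show ?thesis .
  qed
  have b2: "measure M (Z - B j) \<le> 2 * (1/2) ^ j" for j
  proof -
    have "Z - B j \<subseteq> (\<Union>i. B (Suc (j + i)) - B (j + i))"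
    proof
      fix x assume x: "x \<in> Z - B j"
      show "x \<in> (\<Union>i. B (Suc (j + i)) - B (j + i))"
      proof (rule ccontr)
        assume n: "x \<notin> (\<Union>i. B (Suc (j + i)) - B (j + i))"
        have "x \<notin> B (j + i)" for i
        proof (induction i)
          case (Suc i) then show ?case using n by auto
        qed (use x in simp)
        moreover obtain l where "\<forall>k\<ge>l. x \<in> B k" using x by (auto simp: Z_def)
        ultimately show False using le_add2 by blast
      qed
    qed
    then have "measure M (Z - B j) \<le> measure M (\<Union>i. B (Suc (j + i)) - B (j + i))"
      by (intro finite_measure_mono) auto
    also have "\<dots> \<le> 2 * (1/2) ^ j"
      using tail[of "\<lambda>k. B (Suc k) - B k" j] step by auto
    finally show ?thesis .
  qed
  have lim0: "(\<lambda>j. 2 * (1/2::real) ^ j) \<longlonglongrightarrow> 0"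
    using tendsto_mult_right_zero[OF LIMSEQ_power_zero[of "1/2::real"]] by simp
  show ?thesis
  proof
    show "(\<lambda>k. measure M (A (r k) - Z)) \<longlonglongrightarrow> 0"
      by (rule real_tendsto_sandwich[OF _ _ tendsto_const lim0]) (use b1 in \<open>auto simp: B_def\<close>)
    show "(\<lambda>k. measure M (Z - A (r k))) \<longlonglongrightarrow> 0"
      by (rule real_tendsto_sandwich[OF _ _ tendsto_const lim0]) (use b2 in \<open>auto simp: B_def\<close>)
    show "Z \<subseteq> (\<Union>n. A n)" by (auto simp: Z_def B_def)
    show "k \<le> r k" for k by (simp add: r_def)
  qed (rule Z)
qed

context subrelation begin

section \<open>Boundary calculus and asymptotic invariance\<close>

lemma bdry_nonneg: "0 \<le> bdry K Y A"
  by (auto simp: bdry_def intro: sum_nonneg)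

lemma bdry_self [simp]: "bdry K Y Y = 0"
  by (simp add: bdry_def)

text \<open>An edge leaving an intersection leaves one of the two sets.\<close>

lemma bdry_Int:
  assumes "A \<in> sets M" "B \<in> sets M" "Y \<in> sets M"
  shows "bdry K Y (A \<inter> B) \<le> bdry K Y A + bdry K Y B"
  unfolding bdry_def sum.distrib[symmetric]
proof (rule sum_mono)
  fix g
  let ?e = "\<lambda>A. {x \<in> A. a g x \<in> Y - A \<and> (x, a g x) \<in> S}"
  have s: "?e A \<in> sets M" "?e B \<in> sets M" using assms S_meas by (auto intro!: sets_edge simp del: Diff_iff)
  have "measure M (?e (A \<inter> B)) \<le> measure M (?e A \<union> ?e B)"
    using s by (intro finite_measure_mono) auto
  also have "\<dots> \<le> measure M (?e A) + measure M (?e B)" using s by (rule measure_Un_le)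
  finally show "measure M (?e (A \<inter> B)) \<le> measure M (?e A) + measure M (?e B)" .
qed

text \<open>An edge leaving \<open>A\<close> within \<open>Y\<close> either ends in \<open>Z\<close>
  or leaves \<open>Z\<close>.\<close>

lemma bdry_trans:
  assumes "A \<in> sets M" "Z \<in> sets M" "Y \<in> sets M" "A \<subseteq> Z" "Z \<subseteq> Y"
  shows "bdry K Y A \<le> bdry K Z A + bdry K Y Z"
  unfolding bdry_def sum.distrib[symmetric]
proof (rule sum_mono)
  fix g
  let ?e = "\<lambda>Y A. {x \<in> A. a g x \<in> Y - A \<and> (x, a g x) \<in> S}"
  have s: "?e Z A \<in> sets M" "?e Y Z \<in> sets M" using assms S_meas by (auto intro!: sets_edge simp del: Diff_iff)
  have "measure M (?e Y A) \<le> measure M (?e Z A \<union> ?e Y Z)"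
    using s assms by (intro finite_measure_mono) auto
  also have "\<dots> \<le> measure M (?e Z A) + measure M (?e Y Z)" using s by (rule measure_Un_le)
  finally show "measure M (?e Y A) \<le> measure M (?e Z A) + measure M (?e Y Z)" .
qed

text \<open>A boundary edge of \<open>A\<close> that is not one of \<open>B\<close> starts in
  \<open>A - B\<close> or ends in \<open>B - A\<close>, and the action preserves the measure of the
  latter set.\<close>

lemma bdry_perturb:
  assumes "A \<in> sets M" "B \<in> sets M" "Y \<in> sets M"
  shows "bdry K Y A \<le> bdry K Y B + real (card K) * (measure M (A - B) + measure M (B - A))"
proof -
  have "bdry K Y A \<le> (\<Sum>g\<in>K. measure M {x \<in> B. a g x \<in> Y - B \<and> (x, a g x) \<in> S} + (measure M (A - B) + measure M (B - A)))"
    unfolding bdry_def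
  proof (rule sum_mono)
    fix g
    let ?e = "\<lambda>A. {x \<in> A. a g x \<in> Y - A \<and> (x, a g x) \<in> S}"
    have s: "?e B \<in> sets M" "A - B \<in> sets M" "a g -` (B - A) \<in> sets M"
      using assms S_meas by (auto intro!: sets_edge intro: sets_act_vimage simp del: Diff_iff)
    have "measure M (?e A) \<le> measure M (?e B \<union> ((A - B) \<union> a g -` (B - A)))"
      using s by (intro finite_measure_mono) auto
    also have "\<dots> \<le> measure M (?e B) + measure M ((A - B) \<union> a g -` (B - A))"
      using s by (intro measure_Un_le) auto
    also have "\<dots> \<le> measure M (?e B) + (measure M (A - B) + measure M (a g -` (B - A)))"
      using s by (intro add_left_mono measure_Un_le) auto
    also have "measure M (a g -` (B - A)) = measure M (B - A)"
      using assms by (intro measure_act_vimage) auto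
    finally show "measure M (?e A) \<le> measure M (?e B) + (measure M (A - B) + measure M (B - A))" .
  qed
  then show ?thesis by (simp add: sum.distrib bdry_def)
qed

text \<open>Asymptotic invariance is tested on bijections of \<open>Y\<close>, whereas a label
  follows \<open>S\<close> only on part of \<open>Y\<close>. Exchanging \<open>D\<close> with its
  disjoint image extends the partial map to an involution in the full group.\<close>

lemma swap_in_full_group:
  assumes Y: "Y \<in> sets M" and D: "D \<in> sets M" "D \<subseteq> Y" "a g ` D \<subseteq> Y" "D \<inter> a g ` D = {}"
    and DS: "\<And>x. x \<in> D \<Longrightarrow> (x, a g x) \<in> S"
  defines "\<theta> \<equiv> \<lambda>x. if x \<in> D then a g x else if a (- g) x \<in> D then a (- g) x else x"
  shows "\<theta> \<in> full_group_on M S Y" "\<And>x. \<theta> (\<theta> x) = x" "\<theta> \<in> measurable M M"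
proof -
  have nD: "a g x \<notin> D" if "x \<in> D" for x using D(4) that by blast
  show inv: "\<theta> (\<theta> x) = x" for x using nD by (auto simp: \<theta>_def)
  have \<theta>Y: "\<theta> x \<in> Y" if "x \<in> Y" for x using that D(2,3) by (auto simp: \<theta>_def)
  have "{x \<in> space M. x \<in> D} \<in> sets M" "{x \<in> space M. a (- g) x \<in> D} \<in> sets M"
    using D(1) sets_act_vimage[OF D(1), of "- g"] by (auto simp: vimage_def)
  then show \<theta>M: "\<theta> \<in> measurable M M"
    unfolding \<theta>_def by (intro measurable_If act_meas measurable_ident_sets[OF refl])
  have \<theta>R: "\<theta> \<in> measurable (restrict_space M Y) (restrict_space M Y)"
    using \<theta>M \<theta>Y by (intro measurable_restrict_space3) auto
  have bij: "bij_betw \<theta> Y Y"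
    by (rule bij_betw_byWitness[where f' = \<theta>]) (use inv \<theta>Y in auto)
  have "the_inv_into Y \<theta> x = \<theta> x" if "x \<in> Y" for x
    using bij inv \<theta>Y that by (intro the_inv_into_f_eq) (auto simp: bij_betw_def)
  then have "the_inv_into Y \<theta> \<in> measurable (restrict_space M Y) (restrict_space M Y) \<longleftrightarrow>
     \<theta> \<in> measurable (restrict_space M Y) (restrict_space M Y)"
    by (intro measurable_cong) (auto simp: space_restrict_space)
  moreover have "(x, \<theta> x) \<in> S" for x
    using DS[of x] DS[of "a (- g) x"] S_refl S_sym by (auto simp: \<theta>_def)
  ultimately show "\<theta> \<in> full_group_on M S Y"
    using bij \<theta>R by (auto simp: full_group_on_def)
qed

text \<open>A boundary edge moves its starting point, so these points are covered by countably many
  sets \<open>D i\<close> disjoint from their images under \<open>g\<close>. On each one a swap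
  reduces the claim to invariance under the full group.\<close>

lemma asymp_invariant_edge:
  assumes Y: "Y \<in> sets M" and A: "asymp_invariant_seq M S Y A"
  shows "(\<lambda>n. measure M {x \<in> A n. a g x \<in> Y - A n \<and> (x, a g x) \<in> S}) \<longlonglongrightarrow> 0"
proof -
  have A_sets: "A n \<in> sets M" and AY: "A n \<subseteq> Y" for n using A by (auto simp: asymp_invariant_seq_def)
  obtain U :: "nat \<Rightarrow> 'x set" where U: "\<And>i. open (U i)"
    and Usep: "\<And>x P. finite P \<Longrightarrow> x \<notin> P \<Longrightarrow> \<exists>i. x \<in> U i \<and> U i \<inter> P = {}"
    by (rule separating_open_sequence) blast
  have U_sets: "U i \<in> sets M" for i using U std_borel by auto
  define D where "D i = {x \<in> Y \<inter> U i. a g x \<in> Y - U i \<and> (x, a g x) \<in> S}" for i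
  have D_sets: "D i \<in> sets M" for i unfolding D_def using Y U_sets S_meas by (intro sets_edge) auto
  define bad where "bad n = {x \<in> A n. a g x \<in> Y - A n \<and> (x, a g x) \<in> S}" for n
  have bad_sets: "bad n \<in> sets M" for n unfolding bad_def using A_sets Y S_meas by (intro sets_edge) auto
  have bad_D: "bad n \<subseteq> (\<Union>i. D i)" for n
  proof
    fix x assume x: "x \<in> bad n"
    then have "x \<notin> {a g x}" by (auto simp: bad_def)
    then obtain i where "x \<in> U i" "U i \<inter> {a g x} = {}" using Usep[of "{a g x}" x] by auto
    then have "x \<in> D i" using x AY by (auto simp: bad_def D_def)
    then show "x \<in> (\<Union>i. D i)" by blast
  qed
  have lim_i: "(\<lambda>n. measure M (bad n \<inter> D i)) \<longlonglongrightarrow> 0" for i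
  proof -
    define \<theta> where "\<theta> = (\<lambda>x. if x \<in> D i then a g x else if a (- g) x \<in> D i then a (- g) x else x)"
    have "D i \<subseteq> Y" "a g ` D i \<subseteq> Y" "D i \<inter> a g ` D i = {}" and DS: "\<And>x. x \<in> D i \<Longrightarrow> (x, a g x) \<in> S"
      by (auto simp: D_def)
    note swap = swap_in_full_group[OF Y D_sets this]
    have sw: "\<theta> \<in> full_group_on M S Y" "\<theta> (\<theta> x) = x" "\<theta> \<in> measurable M M" for x
      unfolding \<theta>_def using swap by blast+
    have lim: "(\<lambda>n. measure M ((A n - \<theta> ` A n) \<union> (\<theta> ` A n - A n))) \<longlonglongrightarrow> 0"
      using A sw(1) by (auto simp: asymp_invariant_seq_def)
    have "measure M (bad n \<inter> D i) \<le> measure M ((A n - \<theta> ` A n) \<union> (\<theta> ` A n - A n))" for n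
    proof -
      have "\<theta> ` A n = \<theta> -` A n"
      proof (intro equalityI subsetI)
        fix x assume "x \<in> \<theta> -` A n"
        then have "\<theta> x \<in> A n" "x = \<theta> (\<theta> x)" using sw(2) by auto
        then show "x \<in> \<theta> ` A n" by blast
      qed (use sw(2) in auto)
      then have s: "\<theta> ` A n \<in> sets M"
        using measurable_sets[OF sw(3) A_sets[of n]] by simp
      have "measure M (bad n \<inter> D i) = measure M (a g ` (bad n \<inter> D i))"
        using bad_sets D_sets by (intro measure_act_image[symmetric]) auto
      also have "\<dots> \<le> measure M ((A n - \<theta> ` A n) \<union> (\<theta> ` A n - A n))"
      proof (intro finite_measure_mono)
        show "a g ` (bad n \<inter> D i) \<subseteq> (A n - \<theta> ` A n) \<union> (\<theta> ` A n - A n)"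
        proof
          fix y assume "y \<in> a g ` (bad n \<inter> D i)"
          then obtain x where x: "x \<in> bad n" "x \<in> D i" "y = a g x" by auto
          then have "y = \<theta> x" by (simp add: \<theta>_def)
          then show "y \<in> (A n - \<theta> ` A n) \<union> (\<theta> ` A n - A n)" using x by (auto simp: bad_def)
        qed
      qed (use s A_sets in auto)
      finally show ?thesis .
    qed
    then show ?thesis by (intro real_tendsto_sandwich[OF _ _ tendsto_const lim]) auto
  qed
  \<comment> \<open>The sets \<open>D i\<close> do not depend on \<open>n\<close>, so the cover can
    be cut off at a finite stage uniformly in \<open>n\<close>.\<close>
  have tail: "(\<lambda>N. measure M ((\<Union>i. D i) - (\<Union>i<N. D i))) \<longlonglongrightarrow> 0"
  proof -
    have "(\<lambda>N. measure M ((\<Union>i. D i) - (\<Union>i<N. D i))) \<longlonglongrightarrow> measure M (\<Inter>N. (\<Union>i. D i) - (\<Union>i<N. D i))"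
    proof (rule finite_Lim_measure_decseq)
      show "range (\<lambda>N. (\<Union>i. D i) - (\<Union>i<N. D i)) \<subseteq> sets M" using D_sets by auto
      show "decseq (\<lambda>N. (\<Union>i. D i) - (\<Union>i<N. D i))"
        unfolding decseq_def by (intro allI impI Diff_mono order_refl UN_mono) auto
    qed
    moreover have "(\<Inter>N. (\<Union>i. D i) - (\<Union>i<N. D i)) = {}" by auto
    ultimately show ?thesis by (metis (mono_tags, lifting) measure_empty)
  qed
  have "(\<lambda>n. measure M (bad n)) \<longlonglongrightarrow> 0"
  proof (rule LIMSEQ_I)
    fix e :: real assume e: "e > 0"
    obtain N where N: "measure M ((\<Union>i. D i) - (\<Union>i<N. D i)) < e / 2"
      using LIMSEQ_D[OF tail, of "e / 2"] e by auto
    have "(\<lambda>n. \<Sum>i<N. measure M (bad n \<inter> D i)) \<longlonglongrightarrow> (\<Sum>i<N. 0)"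
      by (intro tendsto_sum lim_i)
    then obtain n0 where n0: "\<And>n. n \<ge> n0 \<Longrightarrow> (\<Sum>i<N. measure M (bad n \<inter> D i)) < e / 2"
      using LIMSEQ_D[of "\<lambda>n. \<Sum>i<N. measure M (bad n \<inter> D i)" 0 "e / 2"] e by force
    have "measure M (bad n) < e" if "n \<ge> n0" for n
    proof -
      have "measure M (bad n) \<le> measure M ((\<Union>i<N. bad n \<inter> D i) \<union> ((\<Union>i. D i) - (\<Union>i<N. D i)))"
        using bad_sets D_sets bad_D[of n] by (intro finite_measure_mono) auto
      also have "\<dots> \<le> measure M (\<Union>i<N. bad n \<inter> D i) + measure M ((\<Union>i. D i) - (\<Union>i<N. D i))"
        using bad_sets D_sets by (intro measure_Un_le) auto
      also have "measure M (\<Union>i<N. bad n \<inter> D i) \<le> (\<Sum>i<N. measure M (bad n \<inter> D i))"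
        using bad_sets D_sets by (intro measure_UNION_le) auto
      finally show ?thesis using n0[OF that] N by linarith
    qed
    then show "\<exists>n0. \<forall>n\<ge>n0. norm (measure M (bad n) - 0) < e" by auto
  qed
  then show ?thesis by (simp add: bad_def)
qed

lemma asymp_invariant_bdry:
  assumes "Y \<in> sets M" "asymp_invariant_seq M S Y A"
  shows "(\<lambda>n. bdry K Y (A n)) \<longlonglongrightarrow> 0"
proof -
  have "(\<lambda>n. bdry K Y (A n)) \<longlonglongrightarrow> (\<Sum>g\<in>K. 0)"
    unfolding bdry_def by (intro tendsto_sum asymp_invariant_edge[OF assms])
  then show ?thesis by simp
qed

text \<open>The limits of measures along sets whose \<open>K\<close>-boundary tends to zero.\<close>

definition almost_invariant_value :: "'g set \<Rightarrow> 'x set \<Rightarrow> real \<Rightarrow> bool" where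
  "almost_invariant_value K Y c \<longleftrightarrow>
     (\<forall>t>0. \<exists>A\<in>sets M. A \<subseteq> Y \<and> bdry K Y A \<le> t \<and> \<bar>measure M A - c\<bar> \<le> t)"

text \<open>Compactness of the interval gives a subsequence with convergent measures, and the
  boundary still vanishes along it.\<close>

lemma almost_invariant_value_limit:
  assumes "\<And>n. A n \<in> sets M" "\<And>n. A n \<subseteq> Y" and lim: "(\<lambda>n. bdry K Y (A n)) \<longlonglongrightarrow> 0"
    and "\<And>n. l \<le> measure M (A n)" "\<And>n. measure M (A n) \<le> u"
  shows "\<exists>c. l \<le> c \<and> c \<le> u \<and> almost_invariant_value K Y c"
proof -
  have "seq_compact {l..u}" by (simp add: compact_imp_seq_compact)
  moreover have "\<forall>n. measure M (A n) \<in> {l..u}" using assms by auto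
  ultimately obtain c r where c: "c \<in> {l..u}" and r: "strict_mono r"
    and lc: "((\<lambda>n. measure M (A n)) \<circ> r) \<longlonglongrightarrow> c"
    unfolding seq_compact_def by metis
  have "almost_invariant_value K Y c"
    unfolding almost_invariant_value_def
  proof (intro allI impI)
    fix t :: real assume t: "t > 0"
    have "((\<lambda>n. bdry K Y (A n)) \<circ> r) \<longlonglongrightarrow> 0" by (rule LIMSEQ_subseq_LIMSEQ[OF lim r])
    then have "eventually (\<lambda>n. bdry K Y (A (r n)) < t) sequentially"
      using t by (auto dest: order_tendstoD(2))
    moreover have "eventually (\<lambda>n. dist (measure M (A (r n))) c < t) sequentially"
      using lc t by (auto dest: tendstoD)
    ultimately have "eventually (\<lambda>n. bdry K Y (A (r n)) < t \<and> dist (measure M (A (r n))) c < t) sequentially"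
      by (rule eventually_conj)
    then obtain n where "bdry K Y (A (r n)) < t" "dist (measure M (A (r n))) c < t"
      using eventually_happens by force
    then show "\<exists>A\<in>sets M. A \<subseteq> Y \<and> bdry K Y A \<le> t \<and> \<bar>measure M A - c\<bar> \<le> t"
      using assms(1,2) by (intro bexI[of _ "A (r n)"]) (auto simp: dist_real_def)
  qed
  then show ?thesis using c by auto
qed

text \<open>If the product of two measures stays above \<open>e\<close>, so does each factor, both
  being at most one. The limiting measure is thus bounded away from zero and from the measure of
  \<open>Z\<close>.\<close>

lemma not_strongly_ergodic_value:
  assumes Z: "Z \<in> sets M" and "\<not> strongly_ergodic_on M S Z"
  shows "\<exists>c. 0 < c \<and> c < measure M Z \<and> almost_invariant_value K Z c"
proof -
  obtain A where A: "asymp_invariant_seq M S Z A"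
    and nlim: "\<not> (\<lambda>n. measure M (A n) * measure M (Z - A n)) \<longlonglongrightarrow> 0"
    using assms(2) by (auto simp: strongly_ergodic_on_def)
  have A_sets: "A n \<in> sets M" and AZ: "A n \<subseteq> Z" for n using A by (auto simp: asymp_invariant_seq_def)
  obtain e where e: "e > 0" and "\<And>n. \<exists>m\<ge>n. \<not> norm (measure M (A m) * measure M (Z - A m) - 0) < e"
    using nlim unfolding LIMSEQ_iff by blast
  then obtain f where f: "\<And>n. n \<le> f n" and fe: "\<And>n. e \<le> \<bar>measure M (A (f n)) * measure M (Z - A (f n))\<bar>"
    by (simp add: not_less) metis
  have fe': "e \<le> measure M (A (f n)) * measure M (Z - A (f n))" for n using fe[of n] by simp
  have "filterlim f at_top sequentially"
    by (rule filterlim_at_top_mono[OF filterlim_ident]) (use f in auto)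
  then have lim: "(\<lambda>n. bdry K Z (A (f n))) \<longlonglongrightarrow> 0"
    using asymp_invariant_bdry[OF Z A, of K] filterlim_compose by blast
  have low: "e \<le> measure M (A (f n))" for n
    using fe'[of n] mult_left_le[of "measure M (Z - A (f n))" "measure M (A (f n))"] by auto
  have up: "measure M (A (f n)) \<le> measure M Z - e" for n
  proof -
    have "e \<le> measure M (Z - A (f n))"
      using fe'[of n] mult_right_le_one_le[of "measure M (Z - A (f n))" "measure M (A (f n))"]
      by (auto simp: mult.commute)
    then show ?thesis using finite_measure_Diff[OF Z A_sets AZ, of "f n"] by simp
  qed
  have "\<exists>c. e \<le> c \<and> c \<le> measure M Z - e \<and> almost_invariant_value K Z c"
    by (rule almost_invariant_value_limit[where A = "\<lambda>n. A (f n)"]) (use A_sets AZ lim low up in auto)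
  then obtain c where "e \<le> c" "c \<le> measure M Z - e" "almost_invariant_value K Z c" by blast
  then show ?thesis using e by (intro exI[of _ c]) auto
qed

text \<open>Let \<open>q\<close> be the least positive asymptotic measure of almost invariant sets.  Intersections of two
  almost invariant sets of measure about \<open>q\<close> have measure about \<open>0\<close> or \<open>q\<close>; Ramsey's theorem then extracts a
  Cauchy sequence, whose limit \<open>Z\<close> is invariant of measure \<open>q\<close>.  As \<open>Z\<close> is not strongly ergodic, it
  produces a smaller positive value.\<close>

lemma small_almost_invariant_set:
  assumes Y: "Y \<in> sets M" and Ypos: "0 < measure M Y" and "0 < \<delta>" "0 < \<eta>"
    and nse: "\<And>Z. Z \<in> sets M \<Longrightarrow> Z \<subseteq> Y \<Longrightarrow> 0 < measure M Z \<Longrightarrow> \<not> strongly_ergodic_on M S Z"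
  shows "\<exists>A\<in>sets M. A \<subseteq> Y \<and> 0 < measure M A \<and> measure M A \<le> \<delta> \<and> bdry K Y A \<le> \<eta> * measure M A"
proof (rule ccontr)
  assume no: "\<not> ?thesis"
  define C where "C = {c. 0 < c \<and> almost_invariant_value K Y c}"
  have C_low: "\<delta> / 2 \<le> c" if "c \<in> C" for c
  proof (rule ccontr)
    assume c\<delta>: "\<not> \<delta> / 2 \<le> c"
    have c: "c > 0" "almost_invariant_value K Y c" using that by (auto simp: C_def)
    \<comment> \<open>The first bound keeps the measure of the approximating set above
      \<open>c / 2\<close>, so the second makes its boundary small relative to that measure.\<close>
    define t where "t = min (c / 2) (\<eta> * c / 2)"
    have "t > 0" using c \<open>0 < \<eta>\<close> by (simp add: t_def)
    then obtain A where A: "A \<in> sets M" "A \<subseteq> Y" "bdry K Y A \<le> t" "\<bar>measure M A - c\<bar> \<le> t"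
      using c by (auto simp: almost_invariant_value_def)
    have t: "t \<le> c / 2" "t \<le> \<eta> * (c / 2)" by (auto simp: t_def)
    then have "c / 2 \<le> measure M A" "measure M A \<le> \<delta>" using A(4) c\<delta> by linarith+
    moreover from this have "\<eta> * (c / 2) \<le> \<eta> * measure M A" using \<open>0 < \<eta>\<close> by (intro mult_left_mono) auto
    ultimately show False using no A t c by auto
  qed
  \<comment> \<open>\<open>Y\<close> has no boundary within itself; thus \<open>C\<close> is
    nonempty and its infimum meaningful.\<close>
  have YC: "measure M Y \<in> C"
    using Ypos Y by (auto simp: C_def almost_invariant_value_def intro!: bexI[of _ Y])
  define q where "q = Inf C"
  have bdd: "bdd_below C" using C_low by (meson bdd_below.I)
  have q_low: "\<delta> / 2 \<le> q" unfolding q_def using YC C_low by (intro cInf_greatest) auto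
  then have qpos: "q > 0" using \<open>0 < \<delta>\<close> by linarith
  have q_least: "q \<le> c" if "c \<in> C" for c unfolding q_def by (rule cInf_lower[OF that bdd])
  have q_val: "almost_invariant_value K Y q"
    unfolding almost_invariant_value_def
  proof (intro allI impI)
    fix t :: real assume "t > 0"
    then obtain c where c: "c \<in> C" "c < q + t / 2"
      using cInf_lessD[of C "q + t / 2"] YC unfolding q_def by auto
    have "t / 2 > 0" using \<open>t > 0\<close> by simp
    then obtain A where A: "A \<in> sets M" "A \<subseteq> Y" "bdry K Y A \<le> t / 2" "\<bar>measure M A - c\<bar> \<le> t / 2"
      using c(1) unfolding C_def almost_invariant_value_def by blast
    have "\<bar>measure M A - q\<bar> \<le> t" "bdry K Y A \<le> t"
      using A(3,4) q_least[OF c(1)] c(2) \<open>t > 0\<close> by linarith+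
    then show "\<exists>A\<in>sets M. A \<subseteq> Y \<and> bdry K Y A \<le> t \<and> \<bar>measure M A - q\<bar> \<le> t"
      using A(1,2) by blast
  qed
  define t where "t n = 1 / real (Suc n)" for n
  have t_pos: "t n > 0" for n by (simp add: t_def)
  have t_lim: "t \<longlonglongrightarrow> 0" unfolding t_def using LIMSEQ_inverse_real_of_nat by (simp add: inverse_eq_divide)
  have t_mono: "t m \<le> t n" if "n \<le> m" for n m using that by (simp add: t_def frac_le)
  have "\<exists>A. A \<in> sets M \<and> A \<subseteq> Y \<and> bdry K Y A \<le> t n \<and> \<bar>measure M A - q\<bar> \<le> t n" for n
    using q_val t_pos[of n] unfolding almost_invariant_value_def by blast
  then obtain A where A_sets: "\<And>n. A n \<in> sets M" and AY: "\<And>n. A n \<subseteq> Y"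
    and A_bd: "\<And>n. bdry K Y (A n) \<le> t n" and A_q: "\<And>n. \<bar>measure M (A n) - q\<bar> \<le> t n"
    by metis
  \<comment> \<open>Intersections are again almost invariant. If their measures lay between
    \<open>z\<close> and \<open>q - z\<close> for arbitrarily late indices, a limit would be a
    positive value below \<open>q\<close>.\<close>
  have gap: "\<exists>N. \<forall>n\<ge>N. \<forall>m\<ge>N. measure M (A n \<inter> A m) \<le> z \<or> q - z \<le> measure M (A n \<inter> A m)" if z: "z > 0" for z
  proof (rule ccontr)
    assume "\<not> ?thesis"
    then have "\<forall>N. \<exists>n m. N \<le> n \<and> N \<le> m \<and> z < measure M (A n \<inter> A m) \<and> measure M (A n \<inter> A m) < q - z"
      by (auto simp: not_le)
    then obtain n m where nm: "\<And>N. N \<le> n N" "\<And>N. N \<le> m N" "\<And>N. z < measure M (A (n N) \<inter> A (m N))"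
      "\<And>N. measure M (A (n N) \<inter> A (m N)) < q - z" by metis
    have "\<exists>c. z \<le> c \<and> c \<le> q - z \<and> almost_invariant_value K Y c"
    proof (rule almost_invariant_value_limit)
      have lim: "(\<lambda>N. t N + t N) \<longlonglongrightarrow> 0" using tendsto_add[OF t_lim t_lim] by simp
      have "bdry K Y (A (n N) \<inter> A (m N)) \<le> t N + t N" for N
        using bdry_Int[OF A_sets A_sets Y, of K "n N" "m N"] A_bd[of "n N"] A_bd[of "m N"]
          t_mono[OF nm(1)[of N]] t_mono[OF nm(2)[of N]] by linarith
      then show "(\<lambda>N. bdry K Y (A (n N) \<inter> A (m N))) \<longlonglongrightarrow> 0"
        by (intro real_tendsto_sandwich[OF _ _ tendsto_const lim]) (auto simp: bdry_nonneg)
    qed (use A_sets AY nm(3,4) in \<open>auto simp: less_imp_le\<close>)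
    then obtain c where "z \<le> c" "c \<le> q - z" "c \<in> C" using z by (auto simp: C_def)
    then show False using q_least[of c] z by linarith
  qed
  \<comment> \<open>The threshold \<open>q / 2\<close> tells the two alternatives of
    \<open>gap\<close> apart as soon as \<open>z \<le> q / 4\<close>.\<close>
  define col where "col e = (if q / 2 \<le> measure M (\<Inter>n\<in>e. A n) then 1 else 0 :: nat)" for e
  have "\<forall>n\<in>UNIV. \<forall>m\<in>UNIV. n \<noteq> m \<longrightarrow> col {n, m} < 2" by (simp add: col_def)
  from Ramsey2[OF infinite_UNIV_nat this]
  obtain H k where H: "infinite H" "k < 2" and Hk: "\<And>n m. n \<in> H \<Longrightarrow> m \<in> H \<Longrightarrow> n \<noteq> m \<Longrightarrow> col {n, m} = k"
    by blast
  have k1: "k = 1"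
  proof (rule ccontr)
    assume "k \<noteq> 1"
    then have disj: "measure M (A n \<inter> A m) < q / 2" if "n \<in> H" "m \<in> H" "n \<noteq> m" for n m
      using Hk[OF that] H(2) by (auto simp: col_def split: if_splits)
    \<comment> \<open>In the other colour, \<open>j\<close> sets of measure at least
      \<open>3 / 4 * q\<close> would lose at most \<open>q / 4\<close> each to overlaps. Their union
      would have measure at least \<open>j * (q / 2)\<close>, which exceeds one.\<close>
    obtain j :: nat where j: "2 / q < real j" using reals_Archimedean2 by blast
    define z where "z = q / (4 * (1 + real j))"
    have z: "z > 0" "real j * z \<le> q / 4" "z \<le> q / 4" using qpos by (auto simp: z_def divide_simps)
    obtain N1 where N1: "\<And>n m. n \<ge> N1 \<Longrightarrow> m \<ge> N1 \<Longrightarrow> measure M (A n \<inter> A m) \<le> z \<or> q - z \<le> measure M (A n \<inter> A m)"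
      using gap[OF z(1)] by blast
    obtain N2 where N2: "t N2 < q / 4"
      using LIMSEQ_D[OF t_lim, of "q / 4"] qpos t_pos by (auto simp: abs_of_pos)
    have "infinite (H - {..<max N1 N2})" using H(1) by auto
    then obtain J where J: "finite J" "card J = j" "J \<subseteq> H - {..<max N1 N2}"
      using infinite_arbitrarily_large by blast
    have "(\<Sum>n\<in>J. measure M (A n)) \<le> measure M (\<Union>n\<in>J. A n) + (\<Sum>n\<in>J. \<Sum>m\<in>J - {n}. measure M (A n \<inter> A m))"
      using J A_sets by (intro sum_measure_le_measure_UN) auto
    also have "\<dots> \<le> 1 + (\<Sum>n\<in>J. \<Sum>m\<in>J - {n}. z)"
    proof (intro add_mono sum_mono)
      fix n m assume nm: "n \<in> J" "m \<in> J - {n}"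
      then have "measure M (A n \<inter> A m) < q / 2" using disj J by auto
      moreover have "n \<ge> N1" "m \<ge> N1" using nm J by auto
      ultimately show "measure M (A n \<inter> A m) \<le> z" using N1[of n m] z qpos by linarith
    qed simp
    also have "(\<Sum>n\<in>J. \<Sum>m\<in>J - {n}. z) \<le> (\<Sum>n\<in>J. real j * z)"
      using J z by (intro sum_mono) (auto simp: mult_right_mono)
    also have "\<dots> \<le> real j * (q / 4)" using mult_left_mono[OF z(2), of "real j"] J(2) by simp
    finally have le: "(\<Sum>n\<in>J. measure M (A n)) \<le> 1 + real j * (q / 4)" by simp
    have "(\<Sum>n\<in>J. 3 / 4 * q) \<le> (\<Sum>n\<in>J. measure M (A n))"
    proof (rule sum_mono)
      fix n assume "n \<in> J"
      then have "t n \<le> t N2" using J by (intro t_mono) auto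
      then show "3 / 4 * q \<le> measure M (A n)" using N2 A_q[of n] by linarith
    qed
    then have "real j * (q / 2) \<le> 1" using le J by (simp add: algebra_simps)
    then show False using j qpos by (simp add: divide_simps mult.commute)
  qed
  define h where "h = enumerate H"
  have hH: "h n \<in> H" for n unfolding h_def using H(1) by (rule enumerate_in_set)
  have h_ge: "n \<le> h n" for n unfolding h_def using H(1) by (rule le_enumerate)
  have Cauchy: "\<exists>N. \<forall>n\<ge>N. \<forall>m\<ge>N. measure M (A (h n) - A (h m)) \<le> e" if e: "e > 0" for e
  proof -
    define z where "z = min (e / 2) (q / 4)"
    have z: "z > 0" "z \<le> e / 2" "z \<le> q / 4" using e qpos by (auto simp: z_def)
    obtain N1 where N1: "\<And>n m. n \<ge> N1 \<Longrightarrow> m \<ge> N1 \<Longrightarrow> measure M (A n \<inter> A m) \<le> z \<or> q - z \<le> measure M (A n \<inter> A m)"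
      using gap[OF z(1)] by blast
    obtain N2 where N2: "t N2 < e / 2"
      using LIMSEQ_D[OF t_lim, of "e / 2"] e t_pos by (auto simp: abs_of_pos)
    have "measure M (A (h n) - A (h m)) \<le> e" if nm: "n \<ge> max N1 N2" "m \<ge> max N1 N2" for n m
    proof (cases "h n = h m")
      case False
      \<comment> \<open>This colour excludes the small alternative, so late sets agree up to a small
        part of their measure.\<close>
      have "col {h n, h m} = 1" using Hk[OF hH hH False] k1 by simp
      then have "q / 2 \<le> measure M (A (h n) \<inter> A (h m))"
        unfolding col_def by (simp split: if_splits)
      moreover have "N1 \<le> h n" "N1 \<le> h m"
        using nm order_trans[OF _ h_ge[of n]] order_trans[OF _ h_ge[of m]] by simp_all
      ultimately have "q - z \<le> measure M (A (h n) \<inter> A (h m))"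
        using N1[of "h n" "h m"] z qpos by linarith
      moreover have "t (h n) \<le> t N2" using nm order_trans[OF _ h_ge[of n]] by (intro t_mono) simp
      moreover have "measure M (A (h n) - A (h m)) = measure M (A (h n)) - measure M (A (h n) \<inter> A (h m))"
        using A_sets by (intro finite_measure_Diff')
      ultimately show ?thesis using A_q[of "h n"] N2 z by linarith
    qed (use e in simp)
    then show ?thesis by blast
  qed
  obtain Z r where Z: "Z \<in> sets M" and r: "\<And>k. k \<le> r k"
    and l1: "(\<lambda>k. measure M (A (h (r k)) - Z)) \<longlonglongrightarrow> 0"
    and l2: "(\<lambda>k. measure M (Z - A (h (r k)))) \<longlonglongrightarrow> 0" and ZA: "Z \<subseteq> (\<Union>n. A (h n))"
    using Cauchy_sets_limit[of "\<lambda>n. A (h n)", OF A_sets Cauchy] by metis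
  have ZY: "Z \<subseteq> Y" using ZA AY by blast
  define s where "s k = t k + (measure M (A (h (r k)) - Z) + measure M (Z - A (h (r k))))" for k
  have s_lim: "s \<longlonglongrightarrow> 0"
    unfolding s_def using tendsto_add[OF t_lim tendsto_add[OF l1 l2]] by simp
  have t_le: "t (h (r k)) \<le> t k" for k using r[of k] h_ge[of "r k"] by (intro t_mono) linarith
  have Zs: "bdry K Y Z \<le> (1 + real (card K)) * s k" for k
  proof -
    have "bdry K Y Z \<le> bdry K Y (A (h (r k))) + real (card K) * (measure M (Z - A (h (r k))) + measure M (A (h (r k)) - Z))"
      by (rule bdry_perturb[OF Z A_sets Y])
    also have "bdry K Y (A (h (r k))) \<le> s k"
      using A_bd[of "h (r k)"] t_le[of k] measure_nonneg[of M "A (h (r k)) - Z"] measure_nonneg[of M "Z - A (h (r k))"]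
      unfolding s_def by linarith
    also have "real (card K) * (measure M (Z - A (h (r k))) + measure M (A (h (r k)) - Z)) \<le> real (card K) * s k"
      using t_pos[of k] by (intro mult_left_mono) (auto simp: s_def)
    finally show ?thesis by (simp add: algebra_simps)
  qed
  have "(\<lambda>k. (1 + real (card K)) * s k) \<longlonglongrightarrow> 0"
    using tendsto_mult_right_zero[OF s_lim] by simp
  \<comment> \<open>The boundary of the limit is exactly zero, not merely small; this lets almost
    invariant sets of \<open>Z\<close> count as almost invariant sets of \<open>Y\<close> at every
    scale.\<close>
  then have "bdry K Y Z \<le> 0" by (rule LIMSEQ_le_const) (use Zs in blast)
  then have bdZ: "bdry K Y Z = 0" using bdry_nonneg[of K Y Z] by simp
  have Zq: "\<bar>measure M Z - q\<bar> \<le> s k" for k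
  proof -
    let ?A = "A (h (r k))"
    have "measure M Z \<le> measure M (?A \<union> (Z - ?A))" using Z A_sets by (intro finite_measure_mono) auto
    also have "\<dots> \<le> measure M ?A + measure M (Z - ?A)" using Z A_sets by (intro measure_Un_le) auto
    finally have 1: "measure M Z \<le> measure M ?A + measure M (Z - ?A)" .
    have "measure M ?A \<le> measure M (Z \<union> (?A - Z))" using Z A_sets by (intro finite_measure_mono) auto
    also have "\<dots> \<le> measure M Z + measure M (?A - Z)" using Z A_sets by (intro measure_Un_le) auto
    finally show ?thesis using 1 A_q[of "h (r k)"] t_le[of k]
        measure_nonneg[of M "?A - Z"] measure_nonneg[of M "Z - ?A"] unfolding s_def by linarith
  qed
  have "\<bar>measure M Z - q\<bar> \<le> 0" by (rule LIMSEQ_le_const[OF s_lim]) (use Zq in blast)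
  then have mZ: "measure M Z = q" by simp
  obtain c where c: "0 < c" "c < q" "almost_invariant_value K Z c"
    using not_strongly_ergodic_value[OF Z nse[OF Z ZY]] mZ qpos by metis
  have "c \<in> C"
    unfolding C_def almost_invariant_value_def
  proof (intro CollectI conjI allI impI c(1))
    fix t :: real assume "t > 0"
    then obtain B where B: "B \<in> sets M" "B \<subseteq> Z" "bdry K Z B \<le> t" "\<bar>measure M B - c\<bar> \<le> t"
      using c(3) unfolding almost_invariant_value_def by blast
    then show "\<exists>A\<in>sets M. A \<subseteq> Y \<and> bdry K Y A \<le> t \<and> \<bar>measure M A - c\<bar> \<le> t"
      using bdry_trans[OF B(1) Z Y B(2) ZY, of K] bdZ ZY by (intro bexI[of _ B]) auto
  qed
  then show False using q_least[of c] c by simp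
qed

end

section \<open>Tiles\<close>

text \<open>Exhaustion using only increasing sequences: each step realises at least half of the
  largest possible gain in \<open>m\<close>, so an upper bound of the sequence leaves no
  gain.\<close>

lemma exists_maximal_extension:
  fixes m :: "'p \<Rightarrow> real"
  assumes refl: "\<And>p. p \<in> F \<Longrightarrow> le p p"
    and trans: "\<And>p q r. le p q \<Longrightarrow> le q r \<Longrightarrow> le p r"
    and mono: "\<And>p q. p \<in> F \<Longrightarrow> q \<in> F \<Longrightarrow> le p q \<Longrightarrow> m p \<le> m q"
    and bound: "\<And>p. p \<in> F \<Longrightarrow> m p \<le> b"
    and chain: "\<And>f :: nat \<Rightarrow> 'p. (\<And>n. f n \<in> F) \<Longrightarrow> (\<And>n k. n \<le> k \<Longrightarrow> le (f n) (f k)) \<Longrightarrow> \<exists>u\<in>F. \<forall>n. le (f n) u"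
    and p0: "p0 \<in> F"
  shows "\<exists>p\<in>F. \<forall>q\<in>F. le p q \<longrightarrow> m q \<le> m p"
proof -
  have "\<exists>q\<in>F. le p q \<and> (\<forall>r\<in>F. le p r \<longrightarrow> m r - m p \<le> 2 * (m q - m p))" if p: "p \<in> F" for p
  proof -
    define V where "V = m ` {r \<in> F. le p r}"
    have bdd: "bdd_above V" unfolding V_def using bound by (auto intro!: bdd_aboveI2)
    have pV: "m p \<in> V" using refl p by (auto simp: V_def)
    have le_Sup: "m r \<le> Sup V" if "r \<in> F" "le p r" for r
      using that bdd by (auto simp: V_def intro!: cSup_upper)
    show ?thesis
    proof (cases "Sup V \<le> m p")
      case True
      then have "m r - m p \<le> 2 * (m p - m p)" if "r \<in> F" "le p r" for r using le_Sup[OF that] by simp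
      then show ?thesis using p refl by blast
    next
      case False
      then have "(Sup V + m p) / 2 < Sup V" by simp
      moreover have "V \<noteq> {}" using pV by blast
      ultimately obtain v where "v \<in> V" "(Sup V + m p) / 2 < v" using less_cSupD by blast
      then obtain q where q: "q \<in> F" "le p q" "(Sup V + m p) / 2 < m q"
        unfolding V_def by blast
      have "m r - m p \<le> 2 * (m q - m p)" if "r \<in> F" "le p r" for r
        using le_Sup[OF that] q(3) by (simp add: field_simps)
      then show ?thesis using q by blast
    qed
  qed
  then obtain nx where nx: "\<And>p. p \<in> F \<Longrightarrow> nx p \<in> F" "\<And>p. p \<in> F \<Longrightarrow> le p (nx p)"
    "\<And>p r. p \<in> F \<Longrightarrow> r \<in> F \<Longrightarrow> le p r \<Longrightarrow> m r - m p \<le> 2 * (m (nx p) - m p)"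
    by metis
  define f where "f n = (nx ^^ n) p0" for n
  have fF: "f n \<in> F" for n by (induction n) (use p0 nx in \<open>auto simp: f_def\<close>)
  have f_Suc: "f (Suc n) = nx (f n)" for n by (simp add: f_def)
  have f_le: "le (f n) (f k)" if "n \<le> k" for n k
    using that
  proof (induction k rule: dec_induct)
    case (step k)
    then show ?case using trans nx(2)[OF fF] f_Suc by metis
  qed (use refl fF in auto)
  obtain u where u: "u \<in> F" "\<And>n. le (f n) u" using chain[of f] fF f_le by blast
  have "incseq (\<lambda>n. m (f n))" using mono fF f_le by (auto simp: incseq_def)
  then obtain l where l: "(\<lambda>n. m (f n)) \<longlonglongrightarrow> l" "\<forall>n. m (f n) \<le> l"
    using incseq_convergent[of "\<lambda>n. m (f n)" b] bound fF by blast
  have "m q \<le> m u" if q: "q \<in> F" "le u q" for q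
  proof -
    \<comment> \<open>Any extension of \<open>u\<close> also extends every stage, so its gain is at
      most twice the gain made there, and these gains tend to zero.\<close>
    have "(\<lambda>n. m (f n) + 2 * (m (f (Suc n)) - m (f n))) \<longlonglongrightarrow> l + 2 * (l - l)"
      by (intro tendsto_intros l LIMSEQ_Suc)
    moreover have "m q \<le> m (f n) + 2 * (m (f (Suc n)) - m (f n))" for n
      using nx(3)[OF fF q(1), of n] trans[OF u(2) q(2)] by (simp add: f_Suc)
    ultimately have "m q \<le> l" by (intro LIMSEQ_le_const[where X = "\<lambda>n. m (f n) + 2 * (m (f (Suc n)) - m (f n))"]) auto
    also have "l \<le> m u" by (rule LIMSEQ_le_const2[OF l(1)]) (use mono fF u in blast)
    finally show ?thesis .
  qed
  then show ?thesis using u(1) by blast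
qed

context subrelation begin

text \<open>Failure of expansion is covered by the measurable sets \<open>D H\<close>, one for each
  finite shape \<open>H\<close> of a bad set. A shape of positive measure, based at a subset
  \<open>B\<close> small enough to keep the translated copies disjoint, gives the tile.\<close>

lemma tile_exists:
  assumes Z: "Z \<in> sets M" and K: "finite K" and notiso: "\<not> (AE x in M. x \<in> Z \<longrightarrow> isoperimetric K Z e x)"
  shows "\<exists>W E. tile K Z e W E \<and> 0 < measure M W"
proof -
  \<comment> \<open>Membership is measurable in \<open>x\<close> and expresses that the
    \<open>g\<close>-edge at \<open>a h x\<close> is a boundary edge of the orbit segment given by
    \<open>H\<close>; \<open>f\<close> counts such edges.\<close>
  define X where "X H g h = {x. a g (a h x) \<in> Z \<and> (a h x, a g (a h x)) \<in> S \<and> (\<forall>h'\<in>H. a g (a h x) \<noteq> a h' x)}" for H g h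
  have X_sets: "X H g h \<in> sets M" if "finite H" for H g h
  proof -
    have "X H g h = a (g + h) -` Z \<inter> {x. (a h x, a (g + h) x) \<in> S} \<inter> (space M - (\<Union>h'\<in>H. {x. a (g + h) x = a h' x}))"
      by (auto simp: X_def act_add)
    also have "\<dots> \<in> sets M"
      using Z S_meas that
      by (intro sets.Int sets.Diff sets.finite_UN sets.top sets_act_vimage sets_act_rel sets_act_eq)
    finally show ?thesis .
  qed
  define f where "f H x = (\<Sum>g\<in>K. \<Sum>h\<in>H. indicat_real (X H g h) x)" for H x
  define D where "D H = {x \<in> Z. inj_on (\<lambda>g. a g x) H \<and> (\<forall>g\<in>H. a g x \<in> Z \<and> (x, a g x) \<in> S) \<and>
      f H x < e * real (card H)}" for H
  have D_sets: "D H \<in> sets M" if "finite H" for H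
  proof -
    have "D H = Z \<inter> (space M - (\<Union>(g, h)\<in>{(g, h) \<in> H \<times> H. g \<noteq> h}. {x. a g x = a h x}))
        \<inter> (space M - (\<Union>g\<in>H. space M - (a g -` Z \<inter> {x. (x, a g x) \<in> S}))) \<inter> {x \<in> space M. f H x < e * real (card H)}"
      by (auto simp: D_def inj_on_def)
    also have "\<dots> \<in> sets M"
    proof (intro sets.Int sets.Diff sets.finite_UN sets.top Z that)
      have [measurable]: "f H \<in> borel_measurable M"
        unfolding f_def using X_sets[OF that] by (intro borel_measurable_sum borel_measurable_indicator)
      show "{x \<in> space M. f H x < e * real (card H)} \<in> sets M" by measurable
      show "finite {(g, h) \<in> H \<times> H. g \<noteq> h}" by (rule finite_subset[of _ "H \<times> H"]) (use that in auto)
    qed (use Z S_meas in \<open>auto intro: sets_act_vimage sets_rel sets_act_eq\<close>)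
    finally show ?thesis .
  qed
  have cover: "\<exists>H. finite H \<and> x \<in> D H" if xZ: "x \<in> Z" and xn: "\<not> isoperimetric K Z e x" for x
  proof -
    obtain L where L: "finite L" "L \<subseteq> S `` {x} \<inter> Z"
      "(\<Sum>g\<in>K. real (card {y \<in> L. a g y \<in> Z - L \<and> (y, a g y) \<in> S})) < e * real (card L)"
      using xn unfolding isoperimetric_def by (auto simp: not_le)
    have "\<forall>l\<in>L. \<exists>g. l = a g x" using L(2) S_orbit by blast
    then obtain \<sigma> where \<sigma>: "\<And>l. l \<in> L \<Longrightarrow> a (\<sigma> l) x = l" by metis
    \<comment> \<open>One group element is chosen per point of \<open>L\<close>, so the shape acts
      injectively at \<open>x\<close> even if \<open>x\<close> has a stabiliser.\<close>
    define H where "H = \<sigma> ` L"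
    have HL: "(\<lambda>g. a g x) ` H = L" using \<sigma> by (force simp: H_def)
    have inj: "inj_on (\<lambda>g. a g x) H" using \<sigma> by (auto simp: H_def inj_on_def)
    have finH: "finite H" using L by (simp add: H_def)
    have cH: "card H = card L" using card_image[OF inj] HL by simp
    have "f H x = (\<Sum>g\<in>K. real (card {y \<in> L. a g y \<in> Z - L \<and> (y, a g y) \<in> S}))"
      unfolding f_def
    proof (rule sum.cong[OF refl])
      fix g
      have "(\<Sum>h\<in>H. indicat_real (X H g h) x) = real (card {h \<in> H. x \<in> X H g h})"
        using finH by (simp add: indicator_def sum.If_cases Int_def)
      also have "{h \<in> H. x \<in> X H g h} = {h \<in> H. a g (a h x) \<in> Z - L \<and> (a h x, a g (a h x)) \<in> S}"
        unfolding X_def HL[symmetric] by auto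
      also have "card \<dots> = card ((\<lambda>g. a g x) ` {h \<in> H. a g (a h x) \<in> Z - L \<and> (a h x, a g (a h x)) \<in> S})"
        by (rule card_image[symmetric]) (rule inj_on_subset[OF inj], auto)
      also have "(\<lambda>g. a g x) ` {h \<in> H. a g (a h x) \<in> Z - L \<and> (a h x, a g (a h x)) \<in> S}
          = {y \<in> (\<lambda>g. a g x) ` H. a g y \<in> Z - L \<and> (y, a g y) \<in> S}" by auto
      finally show "(\<Sum>h\<in>H. indicat_real (X H g h) x) = real (card {y \<in> L. a g y \<in> Z - L \<and> (y, a g y) \<in> S})"
        unfolding HL .
    qed
    moreover have "\<forall>g\<in>H. a g x \<in> Z \<and> (x, a g x) \<in> S" using L(2) HL by auto
    ultimately have "x \<in> D H" using xZ inj L(3) cH by (simp add: D_def)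
    then show ?thesis using finH by blast
  qed
  \<comment> \<open>There are only countably many finite shapes; if every \<open>D H\<close> were
    null, expansion would hold almost everywhere.\<close>
  have "\<exists>H. finite H \<and> D H \<notin> null_sets M"
  proof (rule ccontr)
    assume "\<not> ?thesis"
    then have "AE x in M. \<forall>H\<in>Collect finite. x \<notin> D H"
      by (intro AE_ball_countable[THEN iffD2] countable_Collect_finite) (auto intro: AE_not_in)
    then have "AE x in M. x \<in> Z \<longrightarrow> isoperimetric K Z e x"
      using cover by (auto elim!: eventually_mono)
    then show False using notiso by simp
  qed
  then obtain H where finH: "finite H" and Hnn: "D H \<notin> null_sets M" by blast
  obtain U :: "nat \<Rightarrow> 'x set" where U: "\<And>i. open (U i)"
    and Usep: "\<And>x P. finite P \<Longrightarrow> x \<notin> P \<Longrightarrow> \<exists>i. x \<in> U i \<and> U i \<inter> P = {}"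
    by (rule separating_open_sequence) blast
  have U_sets: "U i \<in> sets M" for i using U std_borel by auto
  \<comment> \<open>These are the elements through which copies of the shape based at two points
    could meet. In \<open>V i\<close> each of them fixes the point or moves it out of
    \<open>U i\<close>, so distinct base points have disjoint copies.\<close>
  define Q where "Q = (\<lambda>(h, h'). - h + h') ` (H \<times> H)"
  have finQ: "finite Q" using finH by (simp add: Q_def)
  define V where "V i = {x \<in> D H \<inter> U i. \<forall>g\<in>Q. a g x = x \<or> a g x \<notin> U i}" for i
  have V_sets: "V i \<in> sets M" for i
  proof -
    have "V i = D H \<inter> U i \<inter> (space M - (\<Union>g\<in>Q. a g -` U i - {x. a g x = a 0 x}))"
      by (auto simp: V_def act_zero)
    then show ?thesis using D_sets[OF finH] U_sets finQ sets.top[of M]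
      by (auto intro!: sets.Int sets.Diff sets.finite_UN sets_act_vimage sets_act_eq)
  qed
  have "D H = (\<Union>i. V i)"
  proof (intro equalityI subsetI)
    fix x assume x: "x \<in> D H"
    have "finite ((\<lambda>g. a g x) ` Q - {x})" "x \<notin> (\<lambda>g. a g x) ` Q - {x}" using finQ by auto
    from Usep[OF this] obtain i where "x \<in> U i" "U i \<inter> ((\<lambda>g. a g x) ` Q - {x}) = {}" by blast
    then have "x \<in> V i" using x by (auto simp: V_def)
    then show "x \<in> (\<Union>i. V i)" by blast
  qed (auto simp: V_def)
  then obtain i where i: "V i \<notin> null_sets M" using Hnn null_sets_UN[of V M] by metis
  define B where "B = V i"
  have B_sets: "B \<in> sets M" by (simp add: B_def V_sets)
  have Bpos: "0 < measure M B"
    using i B_sets measure_eq_0_null_sets null_setsI[of M B]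
    by (auto simp: B_def emeasure_eq_measure zero_less_measure_iff)
  have BD: "B \<subseteq> D H" by (auto simp: B_def V_def)
  have uniq: "x = x' \<and> h = h'" if "x \<in> B" "x' \<in> B" "h \<in> H" "h' \<in> H" "a h x = a h' x'" for x x' h h'
  proof -
    have "a (- h + h') x' = a (- h) (a h x)" using that(5) by (simp add: act_add)
    then have eq: "a (- h + h') x' = x" by simp
    have "- h + h' \<in> Q" using that by (force simp: Q_def)
    then have "x = x'" using that(1,2) eq unfolding B_def V_def by auto
    moreover have "inj_on (\<lambda>g. a g x) H" using that(1) BD by (auto simp: D_def)
    ultimately show ?thesis using that(3-5) by (auto simp: inj_on_def)
  qed
  define W where "W = (\<Union>h\<in>H. a h ` B)"
  define E where "E = {(y, y'). \<exists>x\<in>B. \<exists>h\<in>H. \<exists>h'\<in>H. y = a h x \<and> y' = a h' x}"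
  have E_eq: "E = (\<Union>h\<in>H. \<Union>h'\<in>H. {(y, y'). y' = a (h' - h) y} \<inter> (a h ` B \<times> UNIV))"
  proof -
    have "a (h' - h) (a h x) = a h' x" for h h' x by (simp flip: act_add)
    then show ?thesis unfolding E_def by force
  qed
  have E_sets: "E \<in> sets (M \<Otimes>\<^sub>M M)"
    unfolding E_eq using finH B_sets sets.top[of M]
    by (intro sets.finite_UN sets.Int sets_pair_eq pair_measureI sets_act_image) auto
  have W_sets: "W \<in> sets M" unfolding W_def using finH B_sets by (intro sets.finite_UN sets_act_image)
  have Bprop: "a h x \<in> Z" "(x, a h x) \<in> S" if "x \<in> B" "h \<in> H" for x h
    using that BD by (auto simp: D_def)
  have mW: "measure M W = real (card H) * measure M B"
  proof -
    have "measure M W = (\<Sum>h\<in>H. measure M (a h ` B))"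
      unfolding W_def
    proof (rule finite_measure_finite_Union[OF finH])
      show "disjoint_family_on (\<lambda>h. a h ` B) H"
        unfolding disjoint_family_on_def using uniq by blast
    qed (use B_sets sets_act_image in auto)
    then show ?thesis using B_sets by (simp add: measure_act_image)
  qed
  have eqE: "equiv W E"
  proof (rule equivI)
    show "refl_on W E" by (auto simp: refl_on_def W_def E_def)
    show "E \<subseteq> W \<times> W" by (auto simp: W_def E_def)
    show "sym E" by (auto simp: sym_def E_def)
    show "trans E"
    proof (rule transI)
      fix x y z assume "(x, y) \<in> E" "(y, z) \<in> E"
      then obtain u v h1 h2 h3 h4 where *: "u \<in> B" "v \<in> B" "h1 \<in> H" "h2 \<in> H" "h3 \<in> H" "h4 \<in> H"
        "x = a h1 u" "y = a h2 u" "y = a h3 v" "z = a h4 v" unfolding E_def by blast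
      then have "u = v" using uniq[of u v h2 h3] by simp
      then show "(x, z) \<in> E" using * unfolding E_def by blast
    qed
  qed
  \<comment> \<open>For the empty shape the strict inequality in \<open>D\<close> reads
    \<open>0 < 0\<close>.\<close>
  have Hne: "H \<noteq> {}"
  proof
    assume "H = {}"
    moreover obtain x where "x \<in> B" using Bpos by (metis all_not_in_conv less_irrefl measure_empty)
    ultimately show False using BD by (auto simp: D_def f_def)
  qed
  have bound: "(\<Sum>g\<in>K. measure M {x \<in> W. a g x \<in> Z \<and> (x, a g x) \<in> S - E}) \<le> e * measure M W"
  proof -
    have "measure M {x \<in> W. a g x \<in> Z \<and> (x, a g x) \<in> S - E} \<le> (\<Sum>h\<in>H. measure M (B \<inter> X H g h))" for g
    proof -
      have "{x \<in> W. a g x \<in> Z \<and> (x, a g x) \<in> S - E} \<subseteq> (\<Union>h\<in>H. a h ` (B \<inter> X H g h))"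
        by (auto simp: W_def X_def E_def)
      then have "measure M {x \<in> W. a g x \<in> Z \<and> (x, a g x) \<in> S - E} \<le> measure M (\<Union>h\<in>H. a h ` (B \<inter> X H g h))"
        using finH B_sets X_sets by (intro finite_measure_mono sets.finite_UN sets_act_image sets.Int) auto
      also have "\<dots> \<le> (\<Sum>h\<in>H. measure M (a h ` (B \<inter> X H g h)))"
        using finH B_sets X_sets by (intro measure_UNION_le sets_act_image sets.Int) auto
      also have "\<dots> = (\<Sum>h\<in>H. measure M (B \<inter> X H g h))"
        using finH B_sets X_sets by (intro sum.cong refl measure_act_image sets.Int) auto
      finally show ?thesis .
    qed
    then have "(\<Sum>g\<in>K. measure M {x \<in> W. a g x \<in> Z \<and> (x, a g x) \<in> S - E})
       \<le> (\<Sum>g\<in>K. \<Sum>h\<in>H. measure M (B \<inter> X H g h))" by (rule sum_mono)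
    \<comment> \<open>Passing to integrals allows the pointwise bound on \<open>f H\<close> to be
      used before integrating over \<open>B\<close>.\<close>
    also have "\<dots> = (\<Sum>g\<in>K. \<Sum>h\<in>H. integral\<^sup>L M (indicat_real (B \<inter> X H g h)))"
      by simp
    also have "\<dots> = (\<integral>x. (\<Sum>g\<in>K. \<Sum>h\<in>H. indicat_real (B \<inter> X H g h) x) \<partial>M)"
      using B_sets X_sets[OF finH] by (simp add: Bochner_Integration.integral_sum emeasure_eq_measure)
    also have "\<dots> \<le> (\<integral>x. e * real (card H) * indicat_real B x \<partial>M)"
    proof (rule integral_mono)
      fix x
      show "(\<Sum>g\<in>K. \<Sum>h\<in>H. indicat_real (B \<inter> X H g h) x) \<le> e * real (card H) * indicat_real B x"
      proof (cases "x \<in> B")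
        case True
        then have "f H x < e * real (card H)" using BD by (auto simp: D_def)
        then show ?thesis using True by (simp add: f_def indicator_inter_arith)
      qed (simp add: indicator_inter_arith)
    qed (use B_sets X_sets[OF finH] in \<open>auto simp: emeasure_eq_measure intro!: Bochner_Integration.integrable_sum\<close>)
    also have "\<dots> = e * measure M W" using B_sets by (simp add: mW)
    finally show ?thesis .
  qed
  have "tile K Z e W E"
    unfolding tile_def
  proof (intro conjI W_sets E_sets eqE bound ballI)
    show "W \<subseteq> Z" using Bprop by (auto simp: W_def)
    show "E \<subseteq> S"
    proof
      fix p assume "p \<in> E"
      then obtain x h h' where "x \<in> B" "h \<in> H" "h' \<in> H" "p = (a h x, a h' x)"
        unfolding E_def by blast
      then show "p \<in> S" using S_trans[OF S_sym[OF Bprop(2)] Bprop(2)] by blast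
    qed
    fix y assume "y \<in> W"
    then obtain x h where xh: "x \<in> B" "h \<in> H" "y = a h x" by (auto simp: W_def)
    have "E `` {y} \<subseteq> (\<lambda>h. a h x) ` H"
      using xh uniq unfolding E_def by blast
    then show "finite (E `` {y})" using finH by (rule finite_subset[OF _ finite_imageI])
  qed
  moreover have "0 < measure M W" using Bpos Hne finH by (simp add: mW card_gt_0_iff)
  ultimately show ?thesis by blast
qed

end

section \<open>Hyperfiniteness\<close>

context subrelation begin

section \<open>Partial tilings\<close>

lemma sets_edge_Diff:
  assumes "A \<in> sets M" "B \<in> sets M" "E \<in> sets (M \<Otimes>\<^sub>M M)"
  shows "{x \<in> A. a g x \<in> B \<and> (x, a g x) \<in> S - E} \<in> sets M"
  by (rule sets_edge[OF assms(1,2) sets.Diff[OF S_meas assms(3)]])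

text \<open>Both orientations of an edge at \<open>W\<close> are charged, so an edge between an
  early and a later tile is paid for once, by the early one.\<close>

definition cut :: "'x set \<Rightarrow> 'g \<Rightarrow> 'x set \<Rightarrow> ('x \<times> 'x) set \<Rightarrow> 'x set" where
  "cut X0 g W E = {x \<in> X0. a g x \<in> X0 \<and> (x, a g x) \<in> S - E \<and> (x \<in> W \<or> a g x \<in> W)}"

text \<open>The factor \<open>2\<close> pays for the incoming as well as the outgoing edges of each
  tile.\<close>

definition partial_tilings :: "'x set \<Rightarrow> 'g set \<Rightarrow> real \<Rightarrow> ('x set \<times> ('x \<times> 'x) set) set" where
  "partial_tilings X0 K e = {(W, E). W \<in> sets M \<and> W \<subseteq> X0 \<and> E \<in> sets (M \<Otimes>\<^sub>M M) \<and> equiv W E \<and>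
     (\<forall>x\<in>W. finite (E `` {x})) \<and> E \<subseteq> S \<and> (\<Sum>g\<in>K. measure M (cut X0 g W E)) \<le> 2 * e * measure M W}"

text \<open>Old classes are frozen rather than enlarged, so that the union along a chain keeps
  finite classes.\<close>

definition extends :: "'x set \<times> ('x \<times> 'x) set \<Rightarrow> 'x set \<times> ('x \<times> 'x) set \<Rightarrow> bool" where
  "extends p q \<longleftrightarrow> fst p \<subseteq> fst q \<and> (\<forall>x\<in>fst p. snd q `` {x} = snd p `` {x})"

lemma cut_sets:
  assumes "X0 \<in> sets M" "W \<in> sets M" "E \<in> sets (M \<Otimes>\<^sub>M M)"
  shows "cut X0 g W E \<in> sets M"
proof -
  have "cut X0 g W E = {x \<in> X0 \<inter> W. a g x \<in> X0 \<and> (x, a g x) \<in> S - E} \<union>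
     {x \<in> X0. a g x \<in> X0 \<inter> W \<and> (x, a g x) \<in> S - E}" by (auto simp: cut_def)
  also have "\<dots> \<in> sets M" using assms by (intro sets.Un sets_edge_Diff sets.Int)
  finally show ?thesis .
qed

lemma partial_tilings_chain:
  assumes X0: "X0 \<in> sets M" and e: "0 < e" and fF: "\<And>n. f n \<in> partial_tilings X0 K e"
    and f_le: "\<And>n k. n \<le> k \<Longrightarrow> extends (f n) (f k)"
  shows "\<exists>u\<in>partial_tilings X0 K e. \<forall>n::nat. extends (f n) u"
proof -
  define Wn where "Wn n = fst (f n)" for n
  define En where "En n = snd (f n)" for n
  have f: "Wn n \<in> sets M" "Wn n \<subseteq> X0" "En n \<in> sets (M \<Otimes>\<^sub>M M)" "equiv (Wn n) (En n)"
     "\<And>x. x \<in> Wn n \<Longrightarrow> finite (En n `` {x})" "En n \<subseteq> S"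
     "(\<Sum>g\<in>K. measure M (cut X0 g (Wn n) (En n))) \<le> 2 * e * measure M (Wn n)" for n
    using fF[of n] by (auto simp: partial_tilings_def Wn_def En_def)
  have W_mono: "Wn n \<subseteq> Wn k" and E_cls: "\<And>x. x \<in> Wn n \<Longrightarrow> En k `` {x} = En n `` {x}" if "n \<le> k" for n k
    using f_le[OF that] by (auto simp: extends_def Wn_def En_def)
  define W where "W = (\<Union>n. Wn n)"
  define E where "E = (\<Union>n. En n)"
  have E_iff: "(x, y) \<in> E \<longleftrightarrow> (x, y) \<in> En n" if x: "x \<in> Wn n" for x y n
  proof
    assume "(x, y) \<in> E"
    then obtain k where k: "(x, y) \<in> En k" by (auto simp: E_def)
    then have xk: "x \<in> Wn k" using f(4)[of k] by (auto simp: equiv_def)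
    show "(x, y) \<in> En n"
    proof (cases "n \<le> k")
      case True
      then show ?thesis using E_cls[OF True x] k by auto
    next
      case False
      then show ?thesis using E_cls[of k n x] xk k by auto
    qed
  qed (auto simp: E_def)
  have E_dom: "x \<in> W" if "(x, y) \<in> E" for x y
    using that f(4) unfolding E_def W_def equiv_def by blast
  have eqE: "equiv W E"
  proof (rule equivI)
    have dom2: "(y, x) \<in> E" if "(x, y) \<in> E" for x y
      using that f(4) unfolding E_def equiv_def sym_def by blast
    show "E \<subseteq> W \<times> W" using E_dom dom2 by auto
    show "sym E" using dom2 by (auto simp: sym_def)
    show "refl_on W E"
      unfolding refl_on_def W_def E_def using f(4) by (auto simp: equiv_def refl_on_def)
    show "trans E"
    proof (rule transI)
      fix x y z assume xy: "(x, y) \<in> E" and yz: "(y, z) \<in> E"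
      obtain n where x: "x \<in> Wn n" using E_dom[OF xy] by (auto simp: W_def)
      then have xyn: "(x, y) \<in> En n" using E_iff xy by blast
      then have "y \<in> Wn n" using f(4)[of n] by (auto simp: equiv_def)
      then have "(y, z) \<in> En n" using E_iff yz by blast
      then have "(x, z) \<in> En n" using xyn f(4)[of n] by (meson equiv_def transE)
      then show "(x, z) \<in> E" by (auto simp: E_def)
    qed
  qed
  have W_sets: "W \<in> sets M" unfolding W_def using f(1) by auto
  have E_sets: "E \<in> sets (M \<Otimes>\<^sub>M M)" unfolding E_def using f(3) by auto
  have cut_bound: "(\<Sum>g\<in>K. measure M (cut X0 g W E)) \<le> 2 * e * measure M W"
  proof -
    \<comment> \<open>With the relation fixed to its final value the cut sets visibly increase in
      \<open>n\<close>. The bound at stage \<open>n\<close> applies to them because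
      \<open>En n\<close> is contained in \<open>E\<close>.\<close>
    have "(\<lambda>n. measure M (cut X0 g (Wn n) E)) \<longlonglongrightarrow> measure M (cut X0 g W E)" for g
    proof -
      have "(\<lambda>n. measure M (cut X0 g (Wn n) E)) \<longlonglongrightarrow> measure M (\<Union>n. cut X0 g (Wn n) E)"
      proof (rule finite_Lim_measure_incseq)
        show "range (\<lambda>n. cut X0 g (Wn n) E) \<subseteq> sets M" using cut_sets[OF X0 f(1) E_sets] by auto
        show "incseq (\<lambda>n. cut X0 g (Wn n) E)" using W_mono by (fastforce simp: incseq_def cut_def)
      qed
      moreover have "(\<Union>n. cut X0 g (Wn n) E) = cut X0 g W E" by (auto simp: cut_def W_def)
      ultimately show ?thesis by simp
    qed
    then have lim: "(\<lambda>n. \<Sum>g\<in>K. measure M (cut X0 g (Wn n) E)) \<longlonglongrightarrow> (\<Sum>g\<in>K. measure M (cut X0 g W E))"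
      by (intro tendsto_sum)
    have "(\<Sum>g\<in>K. measure M (cut X0 g (Wn n) E)) \<le> 2 * e * measure M W" for n
    proof -
      have "(\<Sum>g\<in>K. measure M (cut X0 g (Wn n) E)) \<le> (\<Sum>g\<in>K. measure M (cut X0 g (Wn n) (En n)))"
        using cut_sets[OF X0 f(1) f(3)]
        by (intro sum_mono finite_measure_mono) (auto simp: cut_def E_def)
      also have "\<dots> \<le> 2 * e * measure M (Wn n)" by (rule f(7))
      also have "\<dots> \<le> 2 * e * measure M W"
        using e W_sets by (intro mult_left_mono finite_measure_mono) (auto simp: W_def)
      finally show ?thesis .
    qed
    then show ?thesis by (intro LIMSEQ_le_const2[OF lim]) blast
  qed
  have "(W, E) \<in> partial_tilings X0 K e"
    unfolding partial_tilings_def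
  proof (clarify, intro conjI ballI W_sets E_sets eqE cut_bound)
    show "W \<subseteq> X0" "E \<subseteq> S" using f(2,6) by (auto simp: W_def E_def)
    fix x assume "x \<in> W"
    then obtain n where n: "x \<in> Wn n" by (auto simp: W_def)
    then have "E `` {x} = En n `` {x}" using E_iff by auto
    then show "finite (E `` {x})" using f(5)[OF n] by simp
  qed
  moreover have "extends (f n) (W, E)" for n
    unfolding extends_def using E_iff by (auto simp: W_def Wn_def[symmetric] En_def[symmetric])
  ultimately show ?thesis by blast
qed

text \<open>Edges at \<open>W\<close> already lie in the old cut set. A new one starts in
  \<open>W'\<close> or is the reverse of one that does; since \<open>K\<close> is symmetric, both
  kinds have the same total.\<close>

lemma partial_tilings_extend:
  assumes X0: "X0 \<in> sets M" and K: "finite K" "uminus ` K = K"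
    and p: "(W, E) \<in> partial_tilings X0 K e" and t: "tile K (X0 - W) e W' E'"
  shows "(W \<union> W', E \<union> E') \<in> partial_tilings X0 K e" "extends (W, E) (W \<union> W', E \<union> E')"
proof -
  have W: "W \<in> sets M" "W \<subseteq> X0" "E \<in> sets (M \<Otimes>\<^sub>M M)" "equiv W E" "E \<subseteq> S"
     "\<And>x. x \<in> W \<Longrightarrow> finite (E `` {x})"
     "(\<Sum>g\<in>K. measure M (cut X0 g W E)) \<le> 2 * e * measure M W"
    using p by (auto simp: partial_tilings_def)
  have W': "W' \<in> sets M" "W' \<subseteq> X0 - W" "E' \<in> sets (M \<Otimes>\<^sub>M M)" "equiv W' E'" "E' \<subseteq> S"
     "\<And>x. x \<in> W' \<Longrightarrow> finite (E' `` {x})"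
     "(\<Sum>g\<in>K. measure M {x \<in> W'. a g x \<in> X0 - W \<and> (x, a g x) \<in> S - E'}) \<le> e * measure M W'"
    using t by (auto simp: tile_def)
  have EW: "E \<subseteq> W \<times> W" and EW': "E' \<subseteq> W' \<times> W'" using W(4) W'(4) by (auto simp: equiv_def)
  have disj: "W \<inter> W' = {}" using W'(2) by blast
  have cls: "(E \<union> E') `` {x} = E `` {x}" if "x \<in> W" for x using that EW' disj by blast
  have cls': "(E \<union> E') `` {x} = E' `` {x}" if "x \<in> W'" for x using that EW disj by blast
  show "extends (W, E) (W \<union> W', E \<union> E')" using cls by (auto simp: extends_def)
  have eqE: "equiv (W \<union> W') (E \<union> E')"
  proof (rule equivI)
    show "E \<union> E' \<subseteq> (W \<union> W') \<times> (W \<union> W')" using EW EW' by blast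
    show "refl_on (W \<union> W') (E \<union> E')" "sym (E \<union> E')"
      using W(4) W'(4) by (auto simp: equiv_def refl_on_def sym_def)
    have "trans E" "trans E'" using W(4) W'(4) by (auto simp: equiv_def)
    then show "trans (E \<union> E')" using EW EW' disj unfolding trans_def by blast
  qed
  define N where "N g = {x \<in> W'. a g x \<in> X0 - W \<and> (x, a g x) \<in> S - E'}" for g
  have N_sets: "N g \<in> sets M" for g unfolding N_def using W' W X0 by (intro sets_edge_Diff) auto
  have "cut X0 g (W \<union> W') (E \<union> E') \<subseteq> cut X0 g W E \<union> (N g \<union> a g -` N (- g))" for g
  proof
    fix x assume x: "x \<in> cut X0 g (W \<union> W') (E \<union> E')"
    show "x \<in> cut X0 g W E \<union> (N g \<union> a g -` N (- g))"
    proof (cases "x \<in> W \<or> a g x \<in> W")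
      case False
      have "(a g x, x) \<notin> E'" "(a g x, x) \<in> S"
        using x W'(4) S_sym by (auto simp: cut_def equiv_def sym_def)
      then show ?thesis using x False W'(2) by (auto simp: cut_def N_def)
    qed (use x in \<open>auto simp: cut_def\<close>)
  qed
  then have "measure M (cut X0 g (W \<union> W') (E \<union> E')) \<le> measure M (cut X0 g W E) + (measure M (N g) + measure M (N (- g)))" for g
  proof -
    have s: "cut X0 g W E \<in> sets M" "N g \<in> sets M" "a g -` N (- g) \<in> sets M"
      using cut_sets[OF X0 W(1,3)] N_sets sets_act_vimage by auto
    have "measure M (cut X0 g (W \<union> W') (E \<union> E')) \<le> measure M (cut X0 g W E \<union> (N g \<union> a g -` N (- g)))"
      using s \<open>cut X0 g (W \<union> W') (E \<union> E') \<subseteq> cut X0 g W E \<union> (N g \<union> a g -` N (- g))\<close>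
      by (intro finite_measure_mono) auto
    also have "\<dots> \<le> measure M (cut X0 g W E) + measure M (N g \<union> a g -` N (- g))"
      using s by (intro measure_Un_le) auto
    also have "\<dots> \<le> measure M (cut X0 g W E) + (measure M (N g) + measure M (a g -` N (- g)))"
      using s by (intro add_left_mono measure_Un_le)
    finally show ?thesis by (simp add: measure_act_vimage N_sets)
  qed
  then have "(\<Sum>g\<in>K. measure M (cut X0 g (W \<union> W') (E \<union> E')))
     \<le> (\<Sum>g\<in>K. measure M (cut X0 g W E) + (measure M (N g) + measure M (N (- g))))"
    by (rule sum_mono)
  also have "\<dots> = (\<Sum>g\<in>K. measure M (cut X0 g W E)) + ((\<Sum>g\<in>K. measure M (N g)) + (\<Sum>g\<in>K. measure M (N (- g))))"
    by (simp add: sum.distrib)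
  also have "(\<Sum>g\<in>K. measure M (N (- g))) = (\<Sum>g\<in>uminus ` K. measure M (N g))"
    by (subst sum.reindex) (auto simp: inj_on_def)
  also have "(\<Sum>g\<in>K. measure M (cut X0 g W E)) + ((\<Sum>g\<in>K. measure M (N g)) + (\<Sum>g\<in>uminus ` K. measure M (N g)))
      \<le> 2 * e * measure M W + (e * measure M W' + e * measure M W')"
    unfolding K(2) using W(7) W'(7) unfolding N_def by (intro add_mono)
  also have "\<dots> = 2 * e * measure M (W \<union> W')"
    using finite_measure_Union[OF W(1) W'(1) disj] by (simp add: algebra_simps)
  finally have bound: "(\<Sum>g\<in>K. measure M (cut X0 g (W \<union> W') (E \<union> E'))) \<le> 2 * e * measure M (W \<union> W')" .
  have "W \<union> W' \<subseteq> X0" using W(2) W'(2) by blast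
  moreover have "\<forall>x\<in>W \<union> W'. finite ((E \<union> E') `` {x})" using cls cls' W(6) W'(6) by auto
  ultimately show "(W \<union> W', E \<union> E') \<in> partial_tilings X0 K e"
    unfolding partial_tilings_def using W W' eqE bound by auto
qed

text \<open>A partial tiling of maximal measure covers \<open>X0\<close> up to a null set, as a
  remainder of positive measure would accept one more tile.\<close>

lemma finite_subrelation_exists:
  assumes X0: "X0 \<in> sets M" and K: "finite K" "uminus ` K = K" and e: "0 < e"
    and tiles: "\<And>Z. Z \<in> sets M \<Longrightarrow> Z \<subseteq> X0 \<Longrightarrow> 0 < measure M Z \<Longrightarrow> \<exists>W E. tile K Z e W E \<and> 0 < measure M W"
  shows "\<exists>E. E \<in> sets (M \<Otimes>\<^sub>M M) \<and> equiv X0 E \<and> (\<forall>x\<in>X0. finite (E `` {x})) \<and> E \<subseteq> S \<and>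
     (\<Sum>g\<in>K. measure M {x \<in> X0. a g x \<in> X0 \<and> (x, a g x) \<in> S - E}) \<le> 2 * e"
proof -
  have "\<exists>p\<in>partial_tilings X0 K e. \<forall>q\<in>partial_tilings X0 K e. extends p q \<longrightarrow> measure M (fst q) \<le> measure M (fst p)"
  proof (rule exists_maximal_extension[where b = 1 and ?p0.0 = "({}, {})"])
    show "extends p r" if "extends p q" "extends q r" for p q r
      using that unfolding extends_def by blast
    show "measure M (fst p) \<le> measure M (fst q)" if "q \<in> partial_tilings X0 K e" "extends p q" for p q
      using that by (intro finite_measure_mono) (auto simp: extends_def partial_tilings_def)
    show "\<exists>u\<in>partial_tilings X0 K e. \<forall>n. extends (f n) u"
      if "\<And>n. f n \<in> partial_tilings X0 K e" "\<And>n k. n \<le> k \<Longrightarrow> extends (f n) (f k)" for f :: "nat \<Rightarrow> _"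
      using partial_tilings_chain[OF X0 e that] .
    show "({}, {}) \<in> partial_tilings X0 K e"
      by (auto simp: partial_tilings_def cut_def equiv_def refl_on_def sym_def trans_def)
  qed (auto simp: extends_def)
  then obtain W E where p: "(W, E) \<in> partial_tilings X0 K e"
    and max: "\<And>q. q \<in> partial_tilings X0 K e \<Longrightarrow> extends (W, E) q \<Longrightarrow> measure M (fst q) \<le> measure M W"
    by (metis fst_conv surj_pair)
  have W: "W \<in> sets M" "W \<subseteq> X0" "E \<in> sets (M \<Otimes>\<^sub>M M)" "equiv W E" "E \<subseteq> S"
     "\<And>x. x \<in> W \<Longrightarrow> finite (E `` {x})"
     "(\<Sum>g\<in>K. measure M (cut X0 g W E)) \<le> 2 * e * measure M W"
    using p by (auto simp: partial_tilings_def)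
  define Z where "Z = X0 - W"
  have Z: "Z \<in> sets M" using X0 W by (auto simp: Z_def)
  have Z0: "measure M Z = 0"
  proof (rule ccontr)
    assume "measure M Z \<noteq> 0"
    then have "0 < measure M Z" by (simp add: zero_less_measure_iff)
    then obtain W' E' where t: "tile K Z e W' E'" "0 < measure M W'" using tiles[OF Z] by (auto simp: Z_def)
    note ext = partial_tilings_extend[OF X0 K p t(1)[unfolded Z_def]]
    have W': "W' \<in> sets M" "W \<inter> W' = {}" using t(1) by (auto simp: tile_def Z_def)
    show False using max[OF ext] finite_measure_Union[OF W(1) W'] t(2) by simp
  qed
  \<comment> \<open>The null remainder is filled with singleton classes. The diagonal is written as
    the graph of \<open>a 0\<close>, whose measurability is known.\<close>
  define E1 where "E1 = E \<union> {(x, y). y = a 0 x} \<inter> (Z \<times> UNIV)"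
  have E1_iff: "(x, y) \<in> E1 \<longleftrightarrow> (x, y) \<in> E \<or> x = y \<and> x \<in> Z" for x y by (auto simp: E1_def act_zero)
  have EW: "E \<subseteq> W \<times> W" using W(4) by (auto simp: equiv_def)
  have E1_sets: "E1 \<in> sets (M \<Otimes>\<^sub>M M)"
    unfolding E1_def using W(3) Z sets.top[of M] by (intro sets.Un sets.Int sets_pair_eq pair_measureI) auto
  have E1_eq: "equiv X0 E1"
  proof (rule equivI)
    show "E1 \<subseteq> X0 \<times> X0" using EW W(2) by (auto simp: E1_iff Z_def)
    show "refl_on X0 E1" using W(4) by (auto simp: refl_on_def equiv_def E1_iff Z_def)
    show "sym E1" using W(4) by (auto simp: sym_def equiv_def E1_iff)
    have "trans E" using W(4) by (simp add: equiv_def)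
    then show "trans E1" unfolding trans_def E1_iff by blast
  qed
  have "finite (E1 `` {x})" if "x \<in> X0" for x
  proof (cases "x \<in> W")
    case True
    then have "E1 `` {x} = E `` {x}" by (auto simp: E1_iff Z_def)
    then show ?thesis using W(6)[OF True] by simp
  next
    case False
    then have "E1 `` {x} \<subseteq> {x}" using EW by (auto simp: E1_iff)
    then show ?thesis by (rule finite_subset) simp
  qed
  moreover have "E1 \<subseteq> S" using W(5) S_refl by (auto simp: E1_iff)
  moreover have "(\<Sum>g\<in>K. measure M {x \<in> X0. a g x \<in> X0 \<and> (x, a g x) \<in> S - E1}) \<le> 2 * e"
  proof -
    have "measure M {x \<in> X0. a g x \<in> X0 \<and> (x, a g x) \<in> S - E1} \<le> measure M (cut X0 g W E)" for g
    proof -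
      have s: "cut X0 g W E \<in> sets M" using cut_sets[OF X0 W(1,3)] .
      have "measure M {x \<in> X0. a g x \<in> X0 \<and> (x, a g x) \<in> S - E1} \<le> measure M (cut X0 g W E \<union> Z)"
        using s Z by (intro finite_measure_mono) (auto simp: cut_def E1_iff Z_def)
      also have "\<dots> \<le> measure M (cut X0 g W E) + measure M Z" using s Z by (rule measure_Un_le)
      finally show ?thesis using Z0 by simp
    qed
    then have "(\<Sum>g\<in>K. measure M {x \<in> X0. a g x \<in> X0 \<and> (x, a g x) \<in> S - E1}) \<le> (\<Sum>g\<in>K. measure M (cut X0 g W E))"
      by (rule sum_mono)
    also have "\<dots> \<le> 2 * e * measure M W" by (rule W(7))
    also have "\<dots> \<le> 2 * e * 1" using e by (intro mult_left_mono) auto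
    finally show ?thesis by simp
  qed
  ultimately show ?thesis using E1_sets E1_eq by blast
qed

text \<open>Errors \<open>2 * (1/2) ^ n\<close> are summable, so by Borel-Cantelli each label is cut
  only finitely often at almost every point. Intersecting tails then makes the relations increase
  without losing those edges in the end.\<close>

lemma hyperfinite_of_tiles:
  assumes X0: "X0 \<in> sets M"
    and tiles: "\<And>K e Z. finite K \<Longrightarrow> 0 < e \<Longrightarrow> Z \<in> sets M \<Longrightarrow> Z \<subseteq> X0 \<Longrightarrow> 0 < measure M Z \<Longrightarrow>
      \<exists>W E. tile K Z e W E \<and> 0 < measure M W"
  shows "hyperfinite_on M S X0"
proof -
  define Kp where "Kp n = {g :: 'g. to_nat g \<le> n}" for n
  have finKp: "finite (Kp n)" for n
  proof -
    have "Kp n = to_nat -` {..n}" by (auto simp: Kp_def)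
    then show ?thesis by (simp add: finite_vimageI)
  qed
  define K where "K n = Kp n \<union> uminus ` Kp n" for n
  have K: "finite (K n)" "uminus ` K n = K n" for n
    using finKp by (auto simp: K_def image_Un image_image Un_commute)
  define ok where "ok n E \<longleftrightarrow> E \<in> sets (M \<Otimes>\<^sub>M M) \<and> equiv X0 E \<and> (\<forall>x\<in>X0. finite (E `` {x})) \<and> E \<subseteq> S \<and>
     (\<Sum>g\<in>K n. measure M {x \<in> X0. a g x \<in> X0 \<and> (x, a g x) \<in> S - E}) \<le> 2 * ((1/2) ^ n)" for n E
  have "\<exists>E. ok n E" for n
    unfolding ok_def by (rule finite_subrelation_exists[OF X0 K]) (use tiles K in auto)
  then obtain E where "\<And>n. ok n (E n)" by metis
  then have E: "\<And>n. E n \<in> sets (M \<Otimes>\<^sub>M M)" "\<And>n. equiv X0 (E n)"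
    "\<And>n x. x \<in> X0 \<Longrightarrow> finite (E n `` {x})" "\<And>n. E n \<subseteq> S"
    "\<And>n. (\<Sum>g\<in>K n. measure M {x \<in> X0. a g x \<in> X0 \<and> (x, a g x) \<in> S - E n}) \<le> 2 * ((1/2) ^ n)"
    unfolding ok_def by blast+
  define E' where "E' n = (\<Inter>m\<in>{n..}. E m)" for n
  define bad where "bad g n = {x \<in> X0. a g x \<in> X0 \<and> (x, a g x) \<in> S - E n}" for g n
  have bad_sets: "bad g n \<in> sets M" for g n unfolding bad_def by (rule sets_edge_Diff[OF X0 X0 E(1)])
  have "AE x in M. \<forall>g. eventually (\<lambda>n. x \<notin> bad g n) sequentially"
  proof (rule AE_all_countable[THEN iffD2], rule allI)
    fix g :: 'g
    \<comment> \<open>A fixed label belongs to \<open>K n\<close> from index \<open>to_nat g\<close>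
      on, which is enough for summability.\<close>
    have le: "norm (measure M (bad g n)) \<le> 2 * (1/2) ^ n" if "to_nat g \<le> n" for n
    proof -
      have "g \<in> K n" using that by (simp add: K_def Kp_def)
      then have "measure M (bad g n) \<le> (\<Sum>g\<in>K n. measure M (bad g n))"
        using K by (intro member_le_sum) auto
      then show ?thesis using E(5)[of n] by (simp add: bad_def)
    qed
    have "summable (\<lambda>n. 2 * (1/2::real) ^ n)" by (intro summable_mult summable_geometric) simp
    then have "summable (\<lambda>n. measure M (bad g n))"
      by (rule summable_comparison_test') (rule le)
    then have "AE x in M. eventually (\<lambda>n. x \<in> space M - bad g n) sequentially"
      using bad_sets by (intro borel_cantelli_AE1) (auto simp: emeasure_eq_measure)
    then show "AE x in M. eventually (\<lambda>n. x \<notin> bad g n) sequentially" by simp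
  qed
  then obtain N where N: "{x \<in> space M. \<not> (\<forall>g. eventually (\<lambda>n. x \<notin> bad g n) sequentially)} \<subseteq> N"
    "emeasure M N = 0" "N \<in> sets M" by (rule AE_E)
  have E'_sub: "E' n \<subseteq> E n" for n by (auto simp: E'_def)
  show ?thesis
    unfolding hyperfinite_on_def
  proof (intro exI[of _ E'] conjI allI ballI bexI[of _ N])
    show "E' n \<in> sets (M \<Otimes>\<^sub>M M)" for n
      unfolding E'_def using E(1) sets.top[of "M \<Otimes>\<^sub>M M"]
      by (intro sets.countable_INT'') (auto simp: space_pair_measure)
    show "equiv X0 (E' n)" for n
    proof (rule equivI)
      show "E' n \<subseteq> X0 \<times> X0" using E'_sub E(2) by (fastforce simp: equiv_def)
      have Em: "refl_on X0 (E m)" "sym (E m)" "trans (E m)" for m using E(2)[of m] by (simp_all add: equiv_def)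
      show "refl_on X0 (E' n)" using Em(1) by (simp add: refl_on_def E'_def)
      show "sym (E' n)" by (rule symI) (simp add: E'_def symD[OF Em(2)])
      show "trans (E' n)"
      proof (rule transI)
        fix x y z assume "(x, y) \<in> E' n" "(y, z) \<in> E' n"
        then show "(x, z) \<in> E' n" unfolding E'_def using transD[OF Em(3), of x y _ z] by simp
      qed
    qed
    show "finite (E' n `` {x})" if "x \<in> X0" for n x
      by (rule finite_subset[OF _ E(3)[OF that, of n]]) (use E'_sub in blast)
    show "E' n \<subseteq> E' (Suc n)" for n by (auto simp: E'_def)
    show "N \<in> null_sets M" using N by (simp add: null_sets_def)
    fix x y assume x: "x \<in> X0 - N" and y: "y \<in> X0 - N"
    show "(x, y) \<in> S \<longleftrightarrow> (\<exists>n. (x, y) \<in> E' n)"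
    proof
      assume xy: "(x, y) \<in> S"
      then obtain g where g: "y = a g x" using S_orbit by blast
      have "eventually (\<lambda>n. x \<notin> bad g n) sequentially" using x N(1) by auto
      then obtain n where "\<And>m. m \<ge> n \<Longrightarrow> x \<notin> bad g m" by (auto simp: eventually_sequentially)
      then have "\<forall>m\<ge>n. (x, y) \<in> E m" using x y xy g by (auto simp: bad_def)
      then show "\<exists>n. (x, y) \<in> E' n" by (auto simp: E'_def)
    qed (use E'_sub E(4) in blast)
  qed
qed

lemma hyperfinite_without_strong_ergodicity:
  assumes "exact_group TYPE('g)" "inf_contained_in_group M a" and X0: "X0 \<in> sets M"
    and nse: "\<And>Z. Z \<in> sets M \<Longrightarrow> Z \<subseteq> X0 \<Longrightarrow> 0 < measure M Z \<Longrightarrow> \<not> strongly_ergodic_on M S Z"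
  shows "hyperfinite_on M S X0"
proof (rule hyperfinite_of_tiles[OF X0])
  fix K :: "'g set" and e :: real and Z
  assume K: "finite K" and e: "0 < e" and Z: "Z \<in> sets M" "Z \<subseteq> X0" "0 < measure M Z"
  show "\<exists>W E. tile K Z e W E \<and> 0 < measure M W"
  proof (rule tile_exists[OF Z(1) K], rule notI)
    assume "AE x in M. x \<in> Z \<longrightarrow> isoperimetric K Z e x"
    from no_small_almost_invariant[OF assms(1,2) Z(1) K e this]
    obtain \<delta> \<eta> where "\<delta> > 0" "\<eta> > 0" and no: "\<And>A. A \<in> sets M \<Longrightarrow> A \<subseteq> Z \<Longrightarrow> 0 < measure M A \<Longrightarrow>
        measure M A \<le> \<delta> \<Longrightarrow> \<eta> * measure M A < bdry K Z A" by blast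
    then obtain A where "A \<in> sets M" "A \<subseteq> Z" "0 < measure M A" "measure M A \<le> \<delta>" "bdry K Z A \<le> \<eta> * measure M A"
      using small_almost_invariant_set[OF Z(1,3), of \<delta> \<eta> K] nse Z(2) by (meson order_trans)
    then show False using no[of A] by simp
  qed
qed

section \<open>The strongly ergodic part and the decomposition\<close>

definition strongly_ergodic_families :: "'x set set set" where
  "strongly_ergodic_families = {C. countable C \<and> disjoint C \<and>
     (\<forall>Z\<in>C. Z \<in> sets M \<and> 0 < measure M Z \<and> strongly_ergodic_on M S Z)}"

text \<open>Maximality refers to the measure of the union, which a further disjoint member of
  positive measure would increase. Countable families keep this union measurable and are stable
  under increasing sequences.\<close>

lemma maximal_strongly_ergodic_family:
  obtains C where "C \<in> strongly_ergodic_families"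
    "\<And>Z. Z \<in> sets M \<Longrightarrow> Z \<inter> \<Union> C = {} \<Longrightarrow> 0 < measure M Z \<Longrightarrow> \<not> strongly_ergodic_on M S Z"
proof -
  have Un_sets: "\<Union> C \<in> sets M" if "C \<in> strongly_ergodic_families" for C
    using that by (intro sets.countable_Union) (auto simp: strongly_ergodic_families_def)
  have "\<exists>C\<in>strongly_ergodic_families. \<forall>C'\<in>strongly_ergodic_families. C \<subseteq> C' \<longrightarrow> measure M (\<Union> C') \<le> measure M (\<Union> C)"
  proof (rule exists_maximal_extension[where b = 1 and ?p0.0 = "{}"])
    show "measure M (\<Union> C) \<le> measure M (\<Union> C')" if "C' \<in> strongly_ergodic_families" "C \<subseteq> C'" for C C'
      using that Un_sets by (intro finite_measure_mono) auto
    show "\<exists>u\<in>strongly_ergodic_families. \<forall>n. f n \<subseteq> u"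
      if f: "\<And>n. f n \<in> strongly_ergodic_families" and mono: "\<And>n k. n \<le> k \<Longrightarrow> f n \<subseteq> f k" for f :: "nat \<Rightarrow> _"
    proof (intro bexI[of _ "\<Union>n. f n"] allI UN_upper)
      have "disjoint (\<Union>n. f n)"
        unfolding disjoint_def
      proof (intro ballI impI)
        fix A B assume "A \<in> (\<Union>n. f n)" "B \<in> (\<Union>n. f n)" "A \<noteq> B"
        moreover from this obtain n k where "A \<in> f n" "B \<in> f k" by blast
        then have "A \<in> f (max n k)" "B \<in> f (max n k)" using mono[of n "max n k"] mono[of k "max n k"] by auto
        ultimately show "A \<inter> B = {}" using f[of "max n k"] by (auto simp: strongly_ergodic_families_def disjoint_def)
      qed
      then show "(\<Union>n. f n) \<in> strongly_ergodic_families"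
        using f by (auto simp: strongly_ergodic_families_def)
    qed simp
    show "{} \<in> strongly_ergodic_families" by (auto simp: strongly_ergodic_families_def disjoint_def)
  qed auto
  then obtain C where C: "C \<in> strongly_ergodic_families"
    and max: "\<And>C'. C' \<in> strongly_ergodic_families \<Longrightarrow> C \<subseteq> C' \<Longrightarrow> measure M (\<Union> C') \<le> measure M (\<Union> C)" by blast
  show ?thesis
  proof (rule that[OF C], rule notI)
    fix Z assume Z: "Z \<in> sets M" "Z \<inter> \<Union> C = {}" "0 < measure M Z" "strongly_ergodic_on M S Z"
    have "disjoint (insert Z C)"
      using C Z(2) unfolding strongly_ergodic_families_def disjoint_def by blast
    then have "insert Z C \<in> strongly_ergodic_families"
      using C Z by (auto simp: strongly_ergodic_families_def)
    then have "measure M (Z \<union> \<Union> C) \<le> measure M (\<Union> C)" using max[of "insert Z C"] by auto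
    then show False using finite_measure_Union[OF Z(1) Un_sets[OF C] Z(2)] Z(3) by simp
  qed
qed

end

theorem theorem7p1:
  fixes M :: "'x::polish_space measure"
    and a :: "'g::{group_add, countable} \<Rightarrow> 'x \<Rightarrow> 'x"
    and S :: "('x \<times> 'x) set"
  assumes exact: "exact_group TYPE('g)"
    and prob: "prob_space M"
    and std_borel: "sets M = sets borel"
    and act_zero: "\<And>x. a 0 x = x"
    and act_add: "\<And>g h x. a (g + h) x = a g (a h x)"
    and act_meas: "\<And>g. a g \<in> measurable M M"
    and act_pres: "\<And>g. distr M M (a g) = M"
    and ergodic: "ergodic_action M a"
    and infc: "inf_contained_in_group M a"
    and S_sub: "S \<subseteq> orbit_rel a"
    and S_equiv: "equiv (space M) S"
    and S_meas: "S \<in> sets (M \<Otimes>\<^sub>M M)"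
  shows "\<exists>X::nat \<Rightarrow> 'x set.
           (\<forall>i. X i \<in> sets M) \<and> disjoint_family X \<and> (\<Union>i. X i) = space M \<and>
           hyperfinite_on M S (X 0) \<and>
           (\<forall>i\<ge>1. X i = {} \<or> (measure M (X i) > 0 \<and> strongly_ergodic_on M S (X i)))"
proof -
  interpret prob_space M by (rule prob)
  interpret subrelation M a S
    by unfold_locales (use std_borel act_zero act_add act_meas act_pres S_sub S_equiv S_meas in auto)
  obtain C where C: "C \<in> strongly_ergodic_families"
    and nse: "\<And>Z. Z \<in> sets M \<Longrightarrow> Z \<inter> \<Union> C = {} \<Longrightarrow> 0 < measure M Z \<Longrightarrow> \<not> strongly_ergodic_on M S Z"
    using maximal_strongly_ergodic_family by blast
  have countC: "countable C" and disjC: "disjoint C"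
    and CZ: "\<And>Z. Z \<in> C \<Longrightarrow> Z \<in> sets M \<and> 0 < measure M Z \<and> strongly_ergodic_on M S Z"
    using C by (auto simp: strongly_ergodic_families_def)
  have UC: "\<Union> C \<in> sets M" using CZ countC by (intro sets.countable_Union) auto
  \<comment> \<open>This enumeration also covers finite or empty \<open>C\<close>: an index that is
    not attained gives the empty piece.\<close>
  define piece where "piece n = \<Union> {Z \<in> C. to_nat_on C Z = n}" for n
  have piece: "piece n = {} \<or> piece n \<in> C" for n
  proof (cases "\<exists>Z\<in>C. to_nat_on C Z = n")
    case True
    then obtain Z where "Z \<in> C" "to_nat_on C Z = n" by blast
    then have "{Z \<in> C. to_nat_on C Z = n} = {Z}"
      using inj_on_to_nat_on[OF countC] by (auto simp: inj_on_def)
    then show ?thesis using \<open>Z \<in> C\<close> by (simp add: piece_def)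
  qed (auto simp: piece_def)
  have piece_UN: "(\<Union>n. piece n) = \<Union> C" by (auto simp: piece_def)
  have piece_disj: "piece n \<inter> piece k = {}" if "n \<noteq> k" for n k
  proof (rule ccontr)
    assume "piece n \<inter> piece k \<noteq> {}"
    then obtain x Z Z' where "x \<in> Z" "x \<in> Z'" "Z \<in> C" "Z' \<in> C" "to_nat_on C Z = n" "to_nat_on C Z' = k"
      unfolding piece_def by blast
    then show False using disjointD[OF disjC, of Z Z'] that by auto
  qed
  \<comment> \<open>Index zero is reserved for the complement of the family, so the pieces are
    shifted by one.\<close>
  define X where "X i = (case i of 0 \<Rightarrow> space M - \<Union> C | Suc n \<Rightarrow> piece n)" for i
  show ?thesis
  proof (intro exI[of _ X] conjI allI impI)
    have X0: "X 0 \<in> sets M" using sets.compl_sets[OF UC] by (simp add: X_def)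
    have "piece n \<in> sets M" for n using piece[of n] CZ by auto
    then show "X i \<in> sets M" for i using X0 by (cases i) (simp_all add: X_def)
    have "X i \<inter> X j = {}" if "i \<noteq> j" for i j
      using that piece_disj piece_UN by (cases i; cases j) (auto simp: X_def)
    then show "disjoint_family X" by (simp add: disjoint_family_on_def)
    have "(\<Union>i. X i) = X 0 \<union> (\<Union>n. X (Suc n))"
      by (metis UN_insert UNIV_nat_eq image_image)
    then show "(\<Union>i. X i) = space M" using piece_UN by (simp add: X_def)
    show "hyperfinite_on M S (X 0)"
    proof (rule hyperfinite_without_strong_ergodicity[OF exact infc])
      show "X 0 \<in> sets M" by (rule X0)
      show "\<not> strongly_ergodic_on M S Z" if "Z \<in> sets M" "Z \<subseteq> X 0" "0 < measure M Z" for Z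
        using that by (intro nse) (auto simp: X_def)
    qed
    show "X i = {} \<or> (measure M (X i) > 0 \<and> strongly_ergodic_on M S (X i))" if "i \<ge> 1" for i
      using that piece CZ by (cases i) (auto simp: X_def)
  qed
qed

end
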